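(* Let $[u]$ be a constant (nonzero) multiple of one of $u$ ($\rho=1$), $\sin(\pi u/\omega_1)$ ($\rho=2$), or $e(au^2)\sigma(u;\Omega)$ ($\rho=4$). Let $\delta,\kappa\in\mathbb{C}$ with $\delta,\kappa,\kappa-\delta\notin\Omega$, let $\mu=(\mu_1,\dots,\mu_{2\rho})\in\mathbb{C}^{2\rho}$, let $m,n\ge 0$ be integers, and let $x=(x_1,\dots,x_m)$, $y=(y_1,\dots,y_n)$. (1) Let $G(u|\delta)$ be a nonzero meromorphic function with $G(u+\delta|\delta)=c_0\,[u]\,G(u|\delta)$ for some nonzero constant $c_0$, and let $\Phi_{BC}(x;y|\delta,\kappa)$ be either of the two functions $$\prod_{j=1}^{m}\prod_{l=1}^{n}\frac{G(x_j\pm y_l+\frac12(\delta-\kappa)|\delta)}{G(x_j\pm y_l+\frac12(\delta+\kappa)|\delta)}\qquad\text{or}\qquad \prod_{j=1}^{m}\prod_{l=1}^{n}\prod_{\epsilon_1,\epsilon_2=\pm}G(\epsilon_1x_j+\epsilon_2y_l+\tfrac12(\delta-\kappa)|\delta).$$ Under the balancing condition $2(m-n)\kappa+c^{(\mu|\delta,\kappa)}=0$, $$E_x^{(\mu|\delta,\kappa)}\Phi_{BC}(x;y|\delta,\kappa)=E_y^{(\nu|\delta,\kappa)}\Phi_{BC}(x;y|\delta,\kappa),$$ where $\nu=(\nu_1,\dots,\nu_{2\rho})$ with $\nu_r=\frac12(\delta+\kappa)-\mu_r$ $(r=1,\dots,2\rho)$. (2) Let $\Psi_{BC}(x;y)=\prod_{j=1}^{m}\prod_{l=1}^{n}[x_j\pm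 y_l]$. Under the balancing condition $2m\kappa+2n\delta+c^{(\mu|\delta,\kappa)}=0$, $$[\kappa]\,E_x^{(\mu|\delta,\kappa)}\Psi_{BC}(x;y)+[\delta]\,E_y^{(\mu|\kappa,\delta)}\Psi_{BC}(x;y)=0.$$
   Context: Notation: $e(u)=\exp(2\pi\sqrt{-1}\,u)$; $\Omega$ is the zero set of $[u]$: $\Omega=0$ (rational case, $\rho=1$), $\Omega=\mathbb{Z}\omega_1$ with $\omega_1\neq0$ (trigonometric case, $\rho=2$), $\Omega=\mathbb{Z}\omega_1\oplus\mathbb{Z}\omega_2$ with $\omega_1,\omega_2$ linearly independent over $\mathbb{R}$ (elliptic case, $\rho=4$); $a\in\mathbb{C}$, and $\sigma(u;\Omega)$ is the Weierstrass sigma function of $\Omega$. The elements $\omega_1,\dots,\omega_\rho\in\Omega$ are: rational: $\omega_1=0$; trigonometric: $\omega_1$ and $\omega_2=0$; elliptic: $\omega_1,\omega_2$, $\omega_3=-\omega_1-\omega_2$, $\omega_4=0$. There are $\eta_r\in\mathbb{C}$, $\epsilon_r=\pm1$ with $[u+\omega_r]=\epsilon_r\,e(\eta_r(u+\frac12\omega_r))[u]$ $(r=1,\dots,\rho)$; in the rational and trigonometric cases, and for $\omega_4=0$ in the elliptic case, one takes $\eta_r=0$. The symbol $\pm$ inside a function denotes a product over both signs, e.g. $[x\pm y]=[x+y][x-y]$, $G(x\pm y+c)=G(x+y+c)G(x-y+c)$, $[x\pm y+c]=[x+y+c][x-y+c]$. $T_{x_i}^{\pm\delta}$ shifts $x_i\mapsto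 x_i\pm\delta$. Put $$c^{(\mu|\delta,\kappa)}=\sum_{s=1}^{2\rho}\mu_s-\tfrac{\rho}{2}(\delta+\kappa)+\sum_{s=1}^{\rho}\omega_s .$$ For $N$ variables $x=(x_1,\dots,x_N)$, the Ruijsenaars operator of type $BC_N$ (defined when $\kappa,\kappa-\delta\notin\Omega$) is $$E_x^{(\mu|\delta,\kappa)}=\sum_{i=1}^{N}A_i^{+}(x)T_{x_i}^{\delta}+\sum_{i=1}^{N}A_i^{-}(x)T_{x_i}^{-\delta}+\sum_{r=1}^{\rho}A_r^{0}(x),$$ with $$A_i^{+}(x)=A_i^{+}(x;\mu|\delta,\kappa)=\frac{\prod_{s=1}^{2\rho}[x_i+\mu_s]}{\prod_{s=1}^{\rho}[x_i-\frac12\omega_s][x_i+\frac12(\delta-\omega_s)]}\prod_{1\le j\le N,\,j\ne i}\frac{[x_i\pm x_j+\kappa]}{[x_i\pm x_j]},\qquad A_i^{-}(x)=A_i^{+}(-x),$$ $$A_r^{0}(x)=A_r^{0}(x;\mu|\delta,\kappa)=\frac{e\big(-(N\kappa+\frac12c^{(\mu|\delta,\kappa)})\eta_r\big)\prod_{s=1}^{2\rho}[\frac12(\omega_r-\delta)+\mu_s]}{[\kappa]\prod_{s\ne r}[\frac12(\omega_r-\omega_s)]\prod_{s=1}^{\rho}[\frac12(\omega_r-\omega_s+\kappa-\delta)]}\prod_{j=1}^{N}\frac{[\frac12(\omega_r-\delta)\pm x_j+\kappa]}{[\frac12(\omega_r-\delta)\pm x_j]} .$$ Operators with subscript $x$ use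 $N=m$, those with subscript $y$ use $N=n$ (for $N=0$ the operator is multiplication by the constant $\sum_rA_r^0$). $E_y^{(\mu|\kappa,\delta)}$ is obtained by exchanging $\delta$ and $\kappa$ in the definition (so the shifts are by $\pm\kappa$). *)

theory Defs
  imports "HOL-Complex_Analysis.Complex_Analysis"
begin

definition e :: "complex \<Rightarrow> complex" where
  "e u = exp (2 * of_real pi * \<i> * u)"

datatype periods = Rational | Trigonometric complex | Elliptic complex complex

fun valid_periods :: "periods \<Rightarrow> bool" where
  "valid_periods Rational \<longleftrightarrow> True"
| "valid_periods (Trigonometric w1) \<longleftrightarrow> w1 \<noteq> 0"
| "valid_periods (Elliptic w1 w2) \<longleftrightarrow>
     (\<forall>s t :: real. s *\<^sub>R w1 + t *\<^sub>R w2 = 0 \<longrightarrow> s = 0 \<and> t = 0)"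

fun Omega :: "periods \<Rightarrow> complex set" where
  "Omega Rational = {0}"
| "Omega (Trigonometric w1) = {of_int k * w1 | k :: int. True}"
| "Omega (Elliptic w1 w2) = {of_int k * w1 + of_int l * w2 | k l :: int. True}"

fun rho :: "periods \<Rightarrow> nat" where
  "rho Rational = 1"
| "rho (Trigonometric w1) = 2"
| "rho (Elliptic w1 w2) = 4"

text \<open>Only the indices \<open>1, \<dots>, rho P\<close> of \<open>omega P\<close> and \<open>eta P br\<close> are meaningful; finite
  families of complex numbers are functions on \<open>nat\<close>, indexed from 1 throughout.\<close>

fun omega :: "periods \<Rightarrow> nat \<Rightarrow> complex" where
  "omega Rational r = 0"
| "omega (Trigonometric w1) r = (if r = 1 then w1 else 0)"
| "omega (Elliptic w1 w2) r =
     (if r = 1 then w1 else if r = 2 then w2 else if r = 3 then - w1 - w2 else 0)"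

text \<open>The product over the nonzero lattice points is unordered: a limit along the net of finite
  subsets. (It converges absolutely when \<open>L\<close> is a lattice.)\<close>

definition weierstrass_sigma :: "complex set \<Rightarrow> complex \<Rightarrow> complex" where
  "weierstrass_sigma L u =
     u * Lim (finite_subsets_at_top (L - {0}))
           (\<lambda>F. \<Prod>w\<in>F. (1 - u / w) * exp (u / w + (u / w)\<^sup>2 / 2))"

fun is_bracket :: "periods \<Rightarrow> (complex \<Rightarrow> complex) \<Rightarrow> bool" where
  "is_bracket Rational br \<longleftrightarrow> (\<exists>C. C \<noteq> 0 \<and> (\<forall>u. br u = C * u))"
| "is_bracket (Trigonometric w1) br \<longleftrightarrow>
     (\<exists>C. C \<noteq> 0 \<and> (\<forall>u. br u = C * sin (of_real pi * u / w1)))"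
| "is_bracket (Elliptic w1 w2) br \<longleftrightarrow>
     (\<exists>C a. C \<noteq> 0 \<and>
       (\<forall>u. br u = C * (e (a * u\<^sup>2) * weierstrass_sigma (Omega (Elliptic w1 w2)) u)))"

text \<open>For the nonzero periods of the elliptic case the quasi-periodicity relation determines the
  exponent uniquely, so the choice operator involves no actual choice.\<close>

fun eta :: "periods \<Rightarrow> (complex \<Rightarrow> complex) \<Rightarrow> nat \<Rightarrow> complex" where
  "eta Rational br r = 0"
| "eta (Trigonometric w1) br r = 0"
| "eta (Elliptic w1 w2) br r =
     (if r = 4 then 0
      else (SOME h. \<exists>\<epsilon>\<in>{1, -1}. \<forall>u.
              br (u + omega (Elliptic w1 w2) r)
                = \<epsilon> * e (h * (u + omega (Elliptic w1 w2) r / 2)) * br u))"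

definition c_const :: "periods \<Rightarrow> (nat \<Rightarrow> complex) \<Rightarrow> complex \<Rightarrow> complex \<Rightarrow> complex" where
  "c_const P \<mu> \<delta> \<kappa> =
     (\<Sum>s = 1..2 * rho P. \<mu> s) - of_nat (rho P) / 2 * (\<delta> + \<kappa>) + (\<Sum>s = 1..rho P. omega P s)"

definition A_plus ::
  "periods \<Rightarrow> (complex \<Rightarrow> complex) \<Rightarrow> nat \<Rightarrow> (nat \<Rightarrow> complex) \<Rightarrow> complex \<Rightarrow> complex
     \<Rightarrow> nat \<Rightarrow> (nat \<Rightarrow> complex) \<Rightarrow> complex" where
  "A_plus P br N \<mu> \<delta> \<kappa> i x =
     (\<Prod>s = 1..2 * rho P. br (x i + \<mu> s))
       / (\<Prod>s = 1..rho P. br (x i - omega P s / 2) * br (x i + (\<delta> - omega P s) / 2))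
     * (\<Prod>j\<in>{1..N} - {i}.
          (br (x i + x j + \<kappa>) * br (x i - x j + \<kappa>)) / (br (x i + x j) * br (x i - x j)))"

definition A_minus ::
  "periods \<Rightarrow> (complex \<Rightarrow> complex) \<Rightarrow> nat \<Rightarrow> (nat \<Rightarrow> complex) \<Rightarrow> complex \<Rightarrow> complex
     \<Rightarrow> nat \<Rightarrow> (nat \<Rightarrow> complex) \<Rightarrow> complex" where
  "A_minus P br N \<mu> \<delta> \<kappa> i x = A_plus P br N \<mu> \<delta> \<kappa> i (\<lambda>j. - x j)"

definition A_zero ::
  "periods \<Rightarrow> (complex \<Rightarrow> complex) \<Rightarrow> nat \<Rightarrow> (nat \<Rightarrow> complex) \<Rightarrow> complex \<Rightarrow> complex
     \<Rightarrow> nat \<Rightarrow> (nat \<Rightarrow> complex) \<Rightarrow> complex" where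
  "A_zero P br N \<mu> \<delta> \<kappa> r x =
     (e (- (of_nat N * \<kappa> + c_const P \<mu> \<delta> \<kappa> / 2) * eta P br r)
        * (\<Prod>s = 1..2 * rho P. br ((omega P r - \<delta>) / 2 + \<mu> s)))
       / (br \<kappa>
          * (\<Prod>s\<in>{1..rho P} - {r}. br ((omega P r - omega P s) / 2))
          * (\<Prod>s = 1..rho P. br ((omega P r - omega P s + \<kappa> - \<delta>) / 2)))
     * (\<Prod>j = 1..N.
          (br ((omega P r - \<delta>) / 2 + x j + \<kappa>) * br ((omega P r - \<delta>) / 2 - x j + \<kappa>))
            / (br ((omega P r - \<delta>) / 2 + x j) * br ((omega P r - \<delta>) / 2 - x j)))"

definition E_op ::
  "periods \<Rightarrow> (complex \<Rightarrow> complex) \<Rightarrow> nat \<Rightarrow> (nat \<Rightarrow> complex) \<Rightarrow> complex \<Rightarrow> complex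
     \<Rightarrow> ((nat \<Rightarrow> complex) \<Rightarrow> complex) \<Rightarrow> (nat \<Rightarrow> complex) \<Rightarrow> complex" where
  "E_op P br N \<mu> \<delta> \<kappa> F x =
     (\<Sum>i = 1..N. A_plus P br N \<mu> \<delta> \<kappa> i x * F (x(i := x i + \<delta>)))
     + (\<Sum>i = 1..N. A_minus P br N \<mu> \<delta> \<kappa> i x * F (x(i := x i - \<delta>)))
     + (\<Sum>r = 1..rho P. A_zero P br N \<mu> \<delta> \<kappa> r x * F x)"

text \<open>Equations between meromorphic functions of several variables are stated pointwise, at every
  point where no factor of any term is singular (the complement of a locally finite family of
  hyperplanes). \<open>coeffs_regular\<close> says that no denominator of a coefficient vanishes; the constant
  denominators of \<open>A_zero\<close> never do when \<open>\<kappa>\<close> and \<open>\<kappa> - \<delta>\<close> lie outside \<open>Omega P\<close>.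
  \<open>E_defined\<close> moreover asks that the argument of the operator, whose domain is \<open>D\<close>, be defined at
  the point and at all its shifts.\<close>

definition A_plus_regular ::
  "periods \<Rightarrow> (complex \<Rightarrow> complex) \<Rightarrow> nat \<Rightarrow> complex \<Rightarrow> nat \<Rightarrow> (nat \<Rightarrow> complex) \<Rightarrow> bool" where
  "A_plus_regular P br N \<delta> i x \<longleftrightarrow>
     (\<forall>s\<in>{1..rho P}. br (x i - omega P s / 2) \<noteq> 0 \<and> br (x i + (\<delta> - omega P s) / 2) \<noteq> 0)
     \<and> (\<forall>j\<in>{1..N} - {i}. br (x i + x j) \<noteq> 0 \<and> br (x i - x j) \<noteq> 0)"

definition coeffs_regular ::
  "periods \<Rightarrow> (complex \<Rightarrow> complex) \<Rightarrow> nat \<Rightarrow> complex \<Rightarrow> (nat \<Rightarrow> complex) \<Rightarrow> bool" where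
  "coeffs_regular P br N \<delta> x \<longleftrightarrow>
     (\<forall>i\<in>{1..N}. A_plus_regular P br N \<delta> i x \<and> A_plus_regular P br N \<delta> i (\<lambda>j. - x j))
     \<and> (\<forall>r\<in>{1..rho P}. \<forall>j\<in>{1..N}.
          br ((omega P r - \<delta>) / 2 + x j) \<noteq> 0 \<and> br ((omega P r - \<delta>) / 2 - x j) \<noteq> 0)"

definition E_defined ::
  "periods \<Rightarrow> (complex \<Rightarrow> complex) \<Rightarrow> nat \<Rightarrow> complex \<Rightarrow> ((nat \<Rightarrow> complex) \<Rightarrow> bool)
     \<Rightarrow> (nat \<Rightarrow> complex) \<Rightarrow> bool" where
  "E_defined P br N \<delta> D x \<longleftrightarrow>
     coeffs_regular P br N \<delta> x \<and> D x
     \<and> (\<forall>i\<in>{1..N}. D (x(i := x i + \<delta>)) \<and> D (x(i := x i - \<delta>)))"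

definition Phi_quot ::
  "(complex \<Rightarrow> complex) \<Rightarrow> complex \<Rightarrow> complex \<Rightarrow> nat \<Rightarrow> nat
     \<Rightarrow> (nat \<Rightarrow> complex) \<Rightarrow> (nat \<Rightarrow> complex) \<Rightarrow> complex" where
  "Phi_quot G \<delta> \<kappa> m n x y =
     (\<Prod>j = 1..m. \<Prod>l = 1..n.
        (G (x j + y l + (\<delta> - \<kappa>) / 2) * G (x j - y l + (\<delta> - \<kappa>) / 2))
        / (G (x j + y l + (\<delta> + \<kappa>) / 2) * G (x j - y l + (\<delta> + \<kappa>) / 2)))"

text \<open>HOL functions are total, and \<open>meromorphic_on\<close> puts no constraint on the values at isolated
  points; \<open>G analytic_on {z}\<close> expresses that \<open>G\<close> is regular at \<open>z\<close>, with its correct value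
  there.\<close>

definition Phi_quot_defined ::
  "(complex \<Rightarrow> complex) \<Rightarrow> complex \<Rightarrow> complex \<Rightarrow> nat \<Rightarrow> nat
     \<Rightarrow> (nat \<Rightarrow> complex) \<Rightarrow> (nat \<Rightarrow> complex) \<Rightarrow> bool" where
  "Phi_quot_defined G \<delta> \<kappa> m n x y \<longleftrightarrow>
     (\<forall>j\<in>{1..m}. \<forall>l\<in>{1..n}. \<forall>\<epsilon>\<in>{1, -1}.
        G analytic_on {x j + \<epsilon> * y l + (\<delta> - \<kappa>) / 2}
        \<and> G analytic_on {x j + \<epsilon> * y l + (\<delta> + \<kappa>) / 2}
        \<and> G (x j + \<epsilon> * y l + (\<delta> + \<kappa>) / 2) \<noteq> 0)"

definition Phi_prod ::
  "(complex \<Rightarrow> complex) \<Rightarrow> complex \<Rightarrow> complex \<Rightarrow> nat \<Rightarrow> nat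
     \<Rightarrow> (nat \<Rightarrow> complex) \<Rightarrow> (nat \<Rightarrow> complex) \<Rightarrow> complex" where
  "Phi_prod G \<delta> \<kappa> m n x y =
     (\<Prod>j = 1..m. \<Prod>l = 1..n. \<Prod>\<epsilon>1\<in>{1, -1}. \<Prod>\<epsilon>2\<in>{1, -1}.
        G (\<epsilon>1 * x j + \<epsilon>2 * y l + (\<delta> - \<kappa>) / 2))"

definition Phi_prod_defined ::
  "(complex \<Rightarrow> complex) \<Rightarrow> complex \<Rightarrow> complex \<Rightarrow> nat \<Rightarrow> nat
     \<Rightarrow> (nat \<Rightarrow> complex) \<Rightarrow> (nat \<Rightarrow> complex) \<Rightarrow> bool" where
  "Phi_prod_defined G \<delta> \<kappa> m n x y \<longleftrightarrow>
     (\<forall>j\<in>{1..m}. \<forall>l\<in>{1..n}. \<forall>\<epsilon>1\<in>{1, -1}. \<forall>\<epsilon>2\<in>{1, -1}.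
        G analytic_on {\<epsilon>1 * x j + \<epsilon>2 * y l + (\<delta> - \<kappa>) / 2})"

definition Psi ::
  "(complex \<Rightarrow> complex) \<Rightarrow> nat \<Rightarrow> nat \<Rightarrow> (nat \<Rightarrow> complex) \<Rightarrow> (nat \<Rightarrow> complex) \<Rightarrow> complex" where
  "Psi br m n x y = (\<Prod>j = 1..m. \<Prod>l = 1..n. br (x j + y l) * br (x j - y l))"

end

theory Submission
  imports Defs
begin

text \<open>
  All identities here are instances of one partial fraction identity for the bracket. If the
  points \<open>a\<^sub>k\<close> are pairwise incongruent modulo the periods, if there are as many \<open>b\<^sub>j\<close> as \<open>a\<^sub>k\<close>,
  and if \<open>\<Sum> a\<^sub>k = \<Sum> b\<^sub>j\<close>, then
  \<open>\<Sum>\<^sub>k \<Prod>\<^sub>j [a\<^sub>k - b\<^sub>j] / \<Prod>\<^bsub>i \<noteq> k\<^esub> [a\<^sub>k - a\<^sub>i] = 0\<close> (\<open>residue_sum_eq_0\<close>).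
  In the elliptic case this is the vanishing of the sum of the residues of the elliptic function
  \<open>\<Prod> [z - b\<^sub>j] / \<Prod> [z - a\<^sub>k]\<close>; uniformly in the three cases it follows by induction from the
  three-term relation of the bracket.

  For the first part, divide \<open>E\<^sub>x \<Phi> - E\<^sub>y \<Phi>\<close> by \<open>\<Phi>\<close>. A shift of \<open>x\<^sub>i\<close> or \<open>y\<^sub>l\<close> by \<open>\<plusminus>\<delta>\<close> multiplies \<open>\<Phi>\<close> by
  an explicit quotient of brackets, and \<open>2 m + 2 n + 2 \<rho>\<close> terms remain. Take as poles
  \<open>\<plusminus>x\<^sub>j\<close>, \<open>\<plusminus>y\<^sub>l - (\<delta> + \<kappa>)/2\<close>, \<open>(\<omega>\<^sub>s - \<delta>)/2\<close>, \<open>(\<omega>\<^sub>s - \<kappa>)/2\<close> and as zeros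
  \<open>- \<mu>\<^sub>s\<close>, \<open>\<plusminus>x\<^sub>j - \<kappa>\<close>, \<open>\<plusminus>y\<^sub>l - (\<delta> - \<kappa>)/2\<close>. The residues are exactly these terms, up to the common factor
  \<open>[\<kappa>]\<close>: the pairs \<open>\<plusminus>x\<^sub>j\<close> and \<open>\<plusminus>y\<^sub>l\<close> give the coefficients of the shifts, the half periods give the
  coefficients of order zero, and the balancing condition says that the poles and the zeros have the
  same sum. For the second part, take the poles \<open>\<plusminus>x\<^sub>j\<close>, \<open>\<plusminus>y\<^sub>l\<close> and the same half periods, and
  the zeros \<open>- \<mu>\<^sub>s\<close>, \<open>\<plusminus>x\<^sub>j - \<kappa>\<close>, \<open>\<plusminus>y\<^sub>l - \<delta>\<close>.

  Two properties of the bracket turn the residues into the coefficients. The duplication formula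
  \<open>[2 u] = D \<Prod>\<^sub>s [u - \<omega>\<^sub>s / 2]\<close> cancels the factors \<open>[2 x + \<kappa>] / [2 x]\<close> coming from the pole \<open>- x\<close>
  and the zero \<open>- x - \<kappa>\<close> against the half periods. Quasi-periodicity evaluates the remaining products
  at half periods (\<open>half_period_pair\<close>); they are exponentials, and the balancing condition
  identifies them with the exponential in \<open>A_zero\<close>.

  The three-term relation, the duplication formula and quasi-periodicity are elementary in the
  rational and trigonometric cases. In the elliptic case they are derived from the product defining
  the sigma function: comparing finite partial products gives quasi-periodicity
  (\<open>sigma_quasi_periodic\<close>), and the two functional equations then follow from Liouville's theorem
  (\<open>proportional_if_same_multipliers\<close>).

  The residue identity needs pairwise incongruent poles, which regularity of the coefficients does
  not guarantee: for instance \<open>x\<^sub>1\<close> may be congruent to \<open>(\<omega>\<^sub>1 - \<kappa>)/2\<close>. The point \<open>(x, y)\<close> is therefore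
  moved along a line on which the poles are distinct near, but possibly not at, the given point;
  both sides are continuous along the line, so the identity persists in the limit.
\<close>

section \<open>The Weierstrass sigma function\<close>

lemma weierstrass_factor_two: "weierstrass_factor 2 z = (1 - z) * exp (z + z\<^sup>2 / 2)"
  by (simp add: weierstrass_factor_def numeral_2_eq_2)

text \<open>Only two features of a lattice enter the construction of its sigma function: it is a group, and
  the sum of the inverse cubes of its nonzero points converges absolutely.\<close>

locale sigma_lattice =
  fixes L :: "complex set"
  assumes zero_mem: "0 \<in> L"
    and diff_mem: "u \<in> L \<Longrightarrow> v \<in> L \<Longrightarrow> u - v \<in> L"
    and summable_cubes: "(\<lambda>w. inverse (norm w ^ 3)) summable_on L - {0}"
begin

lemma minus_mem: "u \<in> L \<Longrightarrow> - u \<in> L"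
  using diff_mem[OF zero_mem] by simp

lemma add_mem: "u \<in> L \<Longrightarrow> v \<in> L \<Longrightarrow> u + v \<in> L"
  using diff_mem[of u "- v"] minus_mem[of v] by simp

text \<open>Every point of norm at most \<open>R\<close> contributes at least \<open>1 / R\<^sup>3\<close> to a convergent sum.\<close>

lemma finite_bounded_points: "finite {w \<in> L - {0}. norm w \<le> R}"
proof (rule ccontr)
  let ?K = "{w \<in> L - {0}. norm w \<le> R}"
  let ?f = "\<lambda>w::complex. inverse (norm w ^ 3)"
  assume inf: "infinite ?K"
  then have "?K \<noteq> {}" by (metis finite.emptyI)
  then obtain w where "w \<in> L - {0}" "norm w \<le> R" by blast
  then have R: "R > 0" by (metis Diff_iff insertI1 less_le_trans zero_less_norm_iff singletonD)
  obtain n :: nat where n: "of_nat n * inverse (R ^ 3) > infsum ?f (L - {0})"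
    using reals_Archimedean3[of "inverse (R ^ 3)"] R by auto
  obtain F where F: "F \<subseteq> ?K" "finite F" "card F = n"
    using infinite_arbitrarily_large[OF inf] by blast
  have "of_nat n * inverse (R ^ 3) = (\<Sum>w\<in>F. inverse (R ^ 3))"
    using F by simp
  also have "\<dots> \<le> sum ?f F"
    using F R by (intro sum_mono le_imp_inverse_le power_mono) auto
  also have "\<dots> \<le> infsum ?f (L - {0})"
    using F by (intro finite_sum_le_infsum summable_cubes) auto
  finally show False using n by simp
qed

text \<open>For \<open>norm u < R\<close> the factors with \<open>norm w\<close> large differ from 1 by \<open>O(1 / norm w ^ 3)\<close>. Their
  logarithms therefore form a uniformly convergent series, whose sum \<open>H\<close> is holomorphic, and the
  finitely many other factors, indexed by \<open>K\<close>, carry all zeros in the disc.\<close>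

lemma local_product:
  assumes R: "R > 0"
  obtains K H where "finite K" "K \<subseteq> L - {0}" "{w \<in> L - {0}. norm w < R} \<subseteq> K"
    "H holomorphic_on ball 0 R"
    "\<And>u. u \<in> ball 0 R \<Longrightarrow>
       ((\<lambda>F. \<Prod>w\<in>F. weierstrass_factor 2 (u / w)) \<longlongrightarrow>
         (\<Prod>w\<in>K. weierstrass_factor 2 (u / w)) * exp (H u)) (finite_subsets_at_top (L - {0}))"
proof -
  \<comment> \<open>The bound \<open>2 * R\<close> makes \<open>norm (u / w) \<le> 1 / 2\<close> for the remaining factors.\<close>
  define K where "K = {w \<in> L - {0}. norm w \<le> 2 * R}"
  define f where "f = (\<lambda>w u. if w \<in> K then 0 else Ln (weierstrass_factor 2 (u / w)))"
  have finK: "finite K" unfolding K_def by (rule finite_bounded_points)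
  have near: "norm (weierstrass_factor 2 (u / w) - 1) \<le> 3 * (R ^ 3 * inverse (norm w ^ 3))"
      "norm (weierstrass_factor 2 (u / w) - 1) < 1 / 2"
    if "w \<in> L - {0}" "w \<notin> K" "norm u \<le> R" for u w
  proof -
    have w: "norm w > 2 * R" "w \<noteq> 0" using that by (auto simp: K_def)
    have q: "norm (u / w) \<le> R / norm w" 
      using that by (simp add: norm_divide divide_right_mono)
    have h: "R / norm w \<le> 1 / 2" using w R by (simp add: field_simps)
    have "norm (weierstrass_factor 2 (u / w) - 1) \<le> 3 * norm (u / w) ^ 3"
      using weierstrass_factor_bound[of "u / w" 2] q h by (simp add: numeral_3_eq_3)
    also have "norm (u / w) ^ 3 \<le> (R / norm w) ^ 3"
      using q by (intro power_mono) auto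
    finally have 1: "norm (weierstrass_factor 2 (u / w) - 1) \<le> 3 * (R / norm w) ^ 3" by simp
    then show "norm (weierstrass_factor 2 (u / w) - 1) \<le> 3 * (R ^ 3 * inverse (norm w ^ 3))"
      by (simp add: power_divide field_simps)
    have "(R / norm w) ^ 3 \<le> (1 / 2) ^ 3" using h R by (intro power_mono) auto
    then show "norm (weierstrass_factor 2 (u / w) - 1) < 1 / 2"
      using 1 by (simp add: power3_eq_cube)
  qed
  have notneg: "weierstrass_factor 2 (u / w) \<notin> \<real>\<^sub>\<le>\<^sub>0"
    if "w \<in> L - {0}" "w \<notin> K" "norm u \<le> R" for u w
  proof
    assume "weierstrass_factor 2 (u / w) \<in> \<real>\<^sub>\<le>\<^sub>0"
    then have "Re (weierstrass_factor 2 (u / w)) \<le> 0" by (auto elim: nonpos_Reals_cases)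
    moreover have "\<bar>Re (weierstrass_factor 2 (u / w) - 1)\<bar> < 1 / 2"
      using near(2)[OF that] abs_Re_le_cmod le_less_trans by blast
    ultimately show False by simp
  qed
  have bound: "norm (f w u) \<le> 6 * R ^ 3 * inverse (norm w ^ 3)"
    if "w \<in> L - {0}" "u \<in> cball 0 R" for w u
  proof (cases "w \<in> K")
    case False
    then have "norm (f w u) \<le> 2 * norm (weierstrass_factor 2 (u / w) - 1)"
      using norm_Ln_le[of "weierstrass_factor 2 (u / w) - 1"] near(2)[of w u] that
      by (simp add: f_def)
    also have "\<dots> \<le> 2 * (3 * (R ^ 3 * inverse (norm w ^ 3)))"
      using near(1)[of w u] that False by simp
    finally show ?thesis by simp
  qed (use R in \<open>simp add: f_def\<close>)
  have ul: "uniform_limit (cball 0 R) (\<lambda>F u. \<Sum>w\<in>F. f w u) (\<lambda>u. \<Sum>\<^sub>\<infinity>w\<in>L - {0}. f w u)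
      (finite_subsets_at_top (L - {0}))"
    using bound summable_on_cmult_right[OF summable_cubes, of "6 * R ^ 3"]
    by (rule Weierstrass_m_test_general)
  have hf: "(\<lambda>u. f w u) holomorphic_on cball 0 R" if "w \<in> L - {0}" for w
  proof (cases "w \<in> K")
    case False
    then show ?thesis unfolding f_def using notneg[OF that False] that
      by (auto intro!: holomorphic_intros)
  qed (simp add: f_def)
  have hs: "eventually (\<lambda>F. continuous_on (cball 0 R) (\<lambda>u. \<Sum>w\<in>F. f w u) \<and>
      (\<lambda>u. \<Sum>w\<in>F. f w u) holomorphic_on ball 0 R) (finite_subsets_at_top (L - {0}))"
  proof (rule eventually_finite_subsets_at_top_weakI)
    fix F assume F: "finite F" "F \<subseteq> L - {0}"
    have "(\<lambda>u. \<Sum>w\<in>F. f w u) holomorphic_on cball 0 R"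
      using F hf by (intro holomorphic_intros) auto
    then show "continuous_on (cball 0 R) (\<lambda>u. \<Sum>w\<in>F. f w u) \<and>
      (\<lambda>u. \<Sum>w\<in>F. f w u) holomorphic_on ball 0 R"
      by (meson ball_subset_cball holomorphic_on_imp_continuous_on holomorphic_on_subset)
  qed
  define H where "H = (\<lambda>u. \<Sum>\<^sub>\<infinity>w\<in>L - {0}. f w u)"
  have "H holomorphic_on ball 0 R"
    using holomorphic_uniform_limit[OF hs ul] by (auto simp: H_def)
  moreover have "((\<lambda>F. \<Prod>w\<in>F. weierstrass_factor 2 (u / w)) \<longlongrightarrow>
         (\<Prod>w\<in>K. weierstrass_factor 2 (u / w)) * exp (H u)) (finite_subsets_at_top (L - {0}))"
    if u: "u \<in> ball 0 R" for u
  proof (rule Lim_transform_eventually)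
    have "((\<lambda>F. \<Sum>w\<in>F. f w u) \<longlongrightarrow> H u) (finite_subsets_at_top (L - {0}))"
      using tendsto_uniform_limitI[OF ul, of u] u by (simp add: H_def)
    then show "((\<lambda>F. (\<Prod>w\<in>K. weierstrass_factor 2 (u / w)) * exp (\<Sum>w\<in>F. f w u)) \<longlongrightarrow>
         (\<Prod>w\<in>K. weierstrass_factor 2 (u / w)) * exp (H u)) (finite_subsets_at_top (L - {0}))"
      by (intro tendsto_intros)
    have "eventually (\<lambda>F. finite F \<and> K \<subseteq> F \<and> F \<subseteq> L - {0}) (finite_subsets_at_top (L - {0}))"
      unfolding eventually_finite_subsets_at_top using finK by (auto simp: K_def)
    then show "eventually (\<lambda>F. (\<Prod>w\<in>K. weierstrass_factor 2 (u / w)) * exp (\<Sum>w\<in>F. f w u)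
       = (\<Prod>w\<in>F. weierstrass_factor 2 (u / w))) (finite_subsets_at_top (L - {0}))"
    proof eventually_elim
      case (elim F)
      have "(\<Sum>w\<in>F. f w u) = (\<Sum>w\<in>F - K. Ln (weierstrass_factor 2 (u / w)))"
        using elim by (intro sum.mono_neutral_cong_right) (auto simp: f_def)
      also have "exp \<dots> = (\<Prod>w\<in>F - K. weierstrass_factor 2 (u / w))"
        using elim u notneg[of _ u] by (subst exp_sum) (fastforce intro!: prod.cong exp_Ln)+
      finally show ?case
        using elim by (simp add: prod.subset_diff[of K F] mult.commute)
    qed
  qed
  moreover have "{w \<in> L - {0}. norm w < R} \<subseteq> K" using R by (auto simp: K_def)
  ultimately show ?thesis using that finK by (auto simp: K_def)
qed

abbreviation sigma :: "complex \<Rightarrow> complex" where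
  "sigma \<equiv> weierstrass_sigma L"

lemma tendsto_sigma:
  "((\<lambda>F. u * (\<Prod>w\<in>F. weierstrass_factor 2 (u / w))) \<longlongrightarrow> sigma u) (finite_subsets_at_top (L - {0}))"
proof -
  have R: "norm u + 1 > 0" by (simp add: add_nonneg_pos)
  obtain l where l: "((\<lambda>F. \<Prod>w\<in>F. weierstrass_factor 2 (u / w)) \<longlongrightarrow> l) (finite_subsets_at_top (L - {0}))"
  proof (rule local_product[OF R])
    fix K H
    assume "\<And>v. v \<in> ball 0 (norm u + 1) \<Longrightarrow>
       ((\<lambda>F. \<Prod>w\<in>F. weierstrass_factor 2 (v / w)) \<longlongrightarrow>
         (\<Prod>w\<in>K. weierstrass_factor 2 (v / w)) * exp (H v)) (finite_subsets_at_top (L - {0}))"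
    from that[OF this[of u]] show thesis by simp
  qed
  have "sigma u = u * l"
    unfolding weierstrass_sigma_def weierstrass_factor_two[symmetric]
    using l by (simp add: tendsto_Lim)
  then show ?thesis using l by (auto intro: tendsto_intros)
qed

text \<open>Holomorphy and the zeros of sigma, and the simplicity of the zero at 0, are read off from this
  representation.\<close>

lemma sigma_local_form:
  assumes R: "R > 0"
  obtains K H where "finite K" "K \<subseteq> L - {0}" "{w \<in> L - {0}. norm w < R} \<subseteq> K"
    "H holomorphic_on ball 0 R"
    "\<And>u. u \<in> ball 0 R \<Longrightarrow> sigma u = u * ((\<Prod>w\<in>K. weierstrass_factor 2 (u / w)) * exp (H u))"
proof (rule local_product[OF R])
  fix K H
  assume a: "finite K" "K \<subseteq> L - {0}" "{w \<in> L - {0}. norm w < R} \<subseteq> K" "H holomorphic_on ball 0 R"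
    "\<And>u. u \<in> ball 0 R \<Longrightarrow>
       ((\<lambda>F. \<Prod>w\<in>F. weierstrass_factor 2 (u / w)) \<longlongrightarrow>
         (\<Prod>w\<in>K. weierstrass_factor 2 (u / w)) * exp (H u)) (finite_subsets_at_top (L - {0}))"
  show ?thesis
    using tendsto_unique[OF _ tendsto_sigma tendsto_mult_left[OF a(5)]]
    by (intro that[of K H] a) auto
qed

lemma sigma_eq_0_iff: "sigma u = 0 \<longleftrightarrow> u \<in> L"
proof -
  have R: "norm u + 1 > 0" by (simp add: add_nonneg_pos)
  show ?thesis
  proof (rule sigma_local_form[OF R])
    fix K H
    assume a: "finite K" "K \<subseteq> L - {0}" "{w \<in> L - {0}. norm w < norm u + 1} \<subseteq> K"
      "\<And>v. v \<in> ball 0 (norm u + 1) \<Longrightarrow> sigma v = v * ((\<Prod>w\<in>K. weierstrass_factor 2 (v / w)) * exp (H v))"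
    have "sigma u = 0 \<longleftrightarrow> u = 0 \<or> (\<exists>w\<in>K. u = w)"
      using a(1,2) by (subst a(4)) (auto simp: prod_zero_iff)
    then show ?thesis using a(2,3) zero_mem by auto
  qed
qed

lemma sigma_holomorphic: "sigma holomorphic_on UNIV"
proof -
  have "sigma field_differentiable at u" for u
  proof -
    have R: "norm u + 1 > 0" by (simp add: add_nonneg_pos)
    show ?thesis
    proof (rule sigma_local_form[OF R])
      fix K H
      assume a: "finite K" "K \<subseteq> L - {0}" "H holomorphic_on ball 0 (norm u + 1)"
        "\<And>v. v \<in> ball 0 (norm u + 1) \<Longrightarrow> sigma v = v * ((\<Prod>w\<in>K. weierstrass_factor 2 (v / w)) * exp (H v))"
      have "(\<lambda>v. v * ((\<Prod>w\<in>K. weierstrass_factor 2 (v / w)) * exp (H v))) holomorphic_on ball 0 (norm u + 1)"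
        using a(2) by (intro holomorphic_intros a) auto
      then have "sigma holomorphic_on ball 0 (norm u + 1)"
        by (rule holomorphic_transform) (simp add: a(4))
      then show ?thesis
        by (rule holomorphic_on_imp_differentiable_at) auto
    qed
  qed
  then show ?thesis by (simp add: holomorphic_on_def field_differentiable_at_within)
qed

lemma deriv_sigma_zero: "deriv sigma 0 \<noteq> 0"
proof (rule sigma_local_form[of 1])
  fix K H
  assume a: "finite K" "K \<subseteq> L - {0}" "H holomorphic_on ball 0 1"
    "\<And>v. v \<in> ball 0 1 \<Longrightarrow> sigma v = v * ((\<Prod>w\<in>K. weierstrass_factor 2 (v / w)) * exp (H v))"
  define g where "g = (\<lambda>v. (\<Prod>w\<in>K. weierstrass_factor 2 (v / w)) * exp (H v))"
  have "g holomorphic_on ball 0 1"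
    unfolding g_def using a(2) by (intro holomorphic_intros a) auto
  then obtain g' where g': "(g has_field_derivative g') (at 0)"
    using holomorphic_on_imp_differentiable_at[of g "ball 0 1" 0] by (auto simp: field_differentiable_def)
  have "((\<lambda>v. v * g v) has_field_derivative g 0) (at 0)"
    using DERIV_mult[OF DERIV_ident g'] by simp
  then have "(sigma has_field_derivative g 0) (at 0)"
    by (rule has_field_derivative_transform_within_open[of _ _ _ "ball 0 1"]) (auto simp: a(4) g_def)
  then have "deriv sigma 0 = g 0" by (rule DERIV_imp_deriv)
  then show ?thesis by (simp add: g_def)
qed simp

text \<open>Negation permutes the lattice, so it preserves the net of its finite subsets.\<close>

lemma sigma_minus: "sigma (- u) = - sigma u"
proof -
  have "filterlim (\<lambda>F. uminus ` F) (finite_subsets_at_top (L - {0})) (finite_subsets_at_top (L - {0}))"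
    unfolding filterlim_finite_subsets_at_top
  proof (intro allI impI)
    fix X assume X: "finite X \<and> X \<subseteq> L - {0}"
    show "eventually (\<lambda>y. finite (uminus ` y) \<and> X \<subseteq> uminus ` y \<and> uminus ` y \<subseteq> L - {0})
        (finite_subsets_at_top (L - {0}))"
      unfolding eventually_finite_subsets_at_top
    proof (intro exI[of _ "uminus ` X"] conjI allI impI)
      show "uminus ` X \<subseteq> L - {0}" using X minus_mem by auto
      fix Y assume Y: "finite Y \<and> uminus ` X \<subseteq> Y \<and> Y \<subseteq> L - {0}"
      have "uminus ` (uminus ` X) \<subseteq> uminus ` Y" using Y by blast
      then show "X \<subseteq> uminus ` Y" by (simp add: image_image)
      show "uminus ` Y \<subseteq> L - {0}" using Y minus_mem by auto
    qed (use X in auto)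
  qed
  from filterlim_compose[OF tendsto_sigma this, of u]
  have "((\<lambda>F. u * (\<Prod>w\<in>uminus ` F. weierstrass_factor 2 (u / w))) \<longlongrightarrow> sigma u) (finite_subsets_at_top (L - {0}))" .
  then have "((\<lambda>F. - u * (\<Prod>w\<in>F. weierstrass_factor 2 (- u / w))) \<longlongrightarrow> - sigma u) (finite_subsets_at_top (L - {0}))"
    by (subst (asm) prod.reindex) (auto simp: o_def dest: tendsto_minus)
  then show ?thesis
    using tendsto_unique[OF _ tendsto_sigma[of "- u"]] by simp
qed

end

section \<open>Quasi-periodicity of sigma\<close>

lemma entire_generic_nonzero:
  assumes "h holomorphic_on UNIV" "h z0 \<noteq> 0"
  shows "eventually (\<lambda>z. h z \<noteq> 0) (at (u :: complex))"
  using non_zero_neighbour_alt[OF assms(1) _ _ _ _ assms(2), of u] by (simp add: connected_UNIV)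

text \<open>The zeros of \<open>h\<close> are isolated, so an equation proved off them extends by continuity. This
  removes genericity assumptions on parameters.\<close>

lemma entire_generic_eq:
  fixes f g h :: "complex \<Rightarrow> complex"
  assumes h: "h holomorphic_on UNIV" "h z0 \<noteq> 0"
    and cont: "isCont f u" "isCont g u"
    and eq: "\<And>z. h z \<noteq> 0 \<Longrightarrow> f z = g z"
  shows "f u = g u"
proof (rule tendsto_unique)
  show "(f \<longlongrightarrow> f u) (at u)" using cont by (simp add: isCont_def)
  have "eventually (\<lambda>z. g z = f z) (at u)"
    using entire_generic_nonzero[OF h] by eventually_elim (simp add: eq)
  then show "(f \<longlongrightarrow> g u) (at u)" 
    by (rule Lim_transform_eventually[rotated]) (use cont in \<open>simp add: isCont_def\<close>)
qed simp

context sigma_lattice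
begin

lemma sigma_nontrivial: obtains u where "sigma u \<noteq> 0"
proof -
  have "sigma = (\<lambda>_. 0)" if "\<And>u. sigma u = 0" using that by auto
  then show ?thesis using deriv_sigma_zero that by force
qed

text \<open>The bound may fail at the finitely many points of norm at most \<open>R\<close>.\<close>

lemma summable_if_cubic_decay:
  fixes g :: "complex \<Rightarrow> complex"
  assumes "\<And>w. w \<in> L - {0} \<Longrightarrow> norm w > R \<Longrightarrow> norm (g w) \<le> C * inverse (norm w ^ 3)"
  shows "g summable_on L - {0}"
proof -
  let ?K = "{w \<in> L - {0}. norm w \<le> R}"
  have "(\<lambda>w. C * inverse (norm w ^ 3)) summable_on (L - {0}) - ?K"
    by (rule summable_on_subset_banach[OF summable_on_cmult_right[OF summable_cubes]]) auto
  then have "g summable_on (L - {0}) - ?K"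
    by (rule abs_summable_summable[OF Infinite_Sum.abs_summable_on_comparison_test']) (use assms in auto)
  moreover have "g summable_on ?K"
    by (intro summable_on_finite finite_bounded_points)
  ultimately have "g summable_on ((L - {0}) - ?K) \<union> ?K"
    by (intro summable_on_Un_disjoint) auto
  moreover have "((L - {0}) - ?K) \<union> ?K = L - {0}" by auto
  ultimately show ?thesis by simp
qed

text \<open>Replacing \<open>u\<close> by \<open>u + \<omega>\<close> turns the zeros \<open>{0} \<union> F\<close> of a partial product of sigma into their
  translates by \<open>- \<omega>\<close>. These are again 0 together with a finite set of nonzero lattice points, and
  the net of these sets is cofinal.\<close>

lemma filterlim_shifted_subsets:
  assumes \<omega>: "\<omega> \<in> L"
  shows "filterlim (\<lambda>F. (\<lambda>w. w - \<omega>) ` (insert 0 F - {\<omega>}))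
     (finite_subsets_at_top (L - {0})) (finite_subsets_at_top (L - {0}))"
  unfolding filterlim_finite_subsets_at_top
proof (intro allI impI)
  let ?s = "\<lambda>F. (\<lambda>w. w - \<omega>) ` (insert 0 F - {\<omega>})"
  fix X assume X: "finite X \<and> X \<subseteq> L - {0}"
  show "eventually (\<lambda>F. finite (?s F) \<and> X \<subseteq> ?s F \<and> ?s F \<subseteq> L - {0}) (finite_subsets_at_top (L - {0}))"
    unfolding eventually_finite_subsets_at_top
  proof (intro exI[of _ "(\<lambda>x. x + \<omega>) ` X - {0}"] conjI allI impI)
    show "(\<lambda>x. x + \<omega>) ` X - {0} \<subseteq> L - {0}" using X \<omega> add_mem by auto
    fix F assume F: "finite F \<and> (\<lambda>x. x + \<omega>) ` X - {0} \<subseteq> F \<and> F \<subseteq> L - {0}"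
    show "X \<subseteq> ?s F"
    proof
      fix x assume x: "x \<in> X"
      then have "x + \<omega> \<in> insert 0 F - {\<omega>}" using F X by auto
      then show "x \<in> ?s F" by (intro image_eqI[of _ _ "x + \<omega>"]) auto
    qed
    show "?s F \<subseteq> L - {0}" using F \<omega> diff_mem zero_mem by auto
  qed (use X in auto)
qed

text \<open>The partial product over \<open>F\<close>, evaluated at \<open>u + \<omega>\<close>, and the partial product over the translated
  set, evaluated at \<open>u\<close>, have the same zeros; their quotient is exactly
  \<open>c\<^sub>F exp (a\<^sub>F u\<^sup>2 + b\<^sub>F u)\<close>. The coefficients \<open>a\<^sub>F\<close> and \<open>b\<^sub>F\<close> are partial sums of series whose terms decay
  like \<open>1 / norm w ^ 3\<close>, so they converge. At a point where sigma does not vanish everything else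
  converges to a nonzero limit, so \<open>c\<^sub>F\<close> converges too.\<close>

lemma sigma_shift_exp_quadratic:
  assumes \<omega>: "\<omega> \<in> L" "\<omega> \<noteq> 0"
  obtains c \<alpha> \<beta> where "\<And>u. sigma (u + \<omega>) = c * exp (\<alpha> * u\<^sup>2 + \<beta> * u) * sigma u"
proof -
  let ?A = "finite_subsets_at_top (L - {0})"
  define P where "P = (\<lambda>F u. u * (\<Prod>w\<in>F. weierstrass_factor 2 (u / w)))"
  define s where "s = (\<lambda>F. (\<lambda>w. w - \<omega>) ` (insert 0 F - {\<omega>}))"
  \<comment> \<open>\<open>a\<close> and \<open>b\<close> are the contributions of \<open>w\<close> to the coefficients of \<open>u\<^sup>2\<close> and \<open>u\<close>. They are 0 at \<open>\<omega>\<close>, whose factor vanishes at \<open>u = 0\<close> after the shift and is split off below.\<close>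
  define a where "a = (\<lambda>w. if w = \<omega> then 0 else (1 / w\<^sup>2 - 1 / (w - \<omega>)\<^sup>2) / 2)"
  define b where "b = (\<lambda>w. if w = \<omega> then 0 else 1 / w + \<omega> / w\<^sup>2 - 1 / (w - \<omega>))"
  define c where "c = (\<lambda>F. - exp (3 / 2) * (\<Prod>w\<in>F - {\<omega>}. (w - \<omega>) / w * exp (\<omega> / w + (\<omega> / w)\<^sup>2 / 2)))"
  have far: "norm (w - \<omega>) \<ge> norm w / 2" "w \<noteq> \<omega>" "w \<noteq> 0" if "norm w > 2 * norm \<omega>" for w
    using that norm_triangle_ineq2[of w \<omega>] \<omega>(2) by auto
  have "norm (a w) \<le> 5 * norm \<omega> * inverse (norm w ^ 3)" if "norm w > 2 * norm \<omega>" for w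
  proof -
    note f = far[OF that]
    have "a w = \<omega> * (\<omega> - 2 * w) / (2 * w\<^sup>2 * (w - \<omega>)\<^sup>2)"
      using f by (simp add: a_def divide_simps) (simp add: algebra_simps power2_eq_square)
    then have "norm (a w) = norm \<omega> * norm (\<omega> - 2 * w) / (2 * (norm w)\<^sup>2 * (norm (w - \<omega>))\<^sup>2)"
      by (simp add: norm_mult norm_divide norm_power)
    also have "\<dots> \<le> norm \<omega> * (5 / 2 * norm w) / (2 * (norm w)\<^sup>2 * (norm w / 2)\<^sup>2)"
    proof (intro frac_le mult_left_mono power_mono mult_pos_pos)
      have "norm (\<omega> - 2 * w) \<le> norm \<omega> + 2 * norm w"
        using norm_triangle_ineq4[of \<omega> "2 * w"] by (simp add: norm_mult)
      then show "norm (\<omega> - 2 * w) \<le> 5 / 2 * norm w" using that by simp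
    qed (use f in auto)
    also have "\<dots> = 5 * norm \<omega> * inverse (norm w ^ 3)"
      using f by (simp add: field_simps power2_eq_square power3_eq_cube)
    finally show ?thesis .
  qed
  then have "a summable_on L - {0}" by (rule summable_if_cubic_decay)
  then obtain \<alpha> where \<alpha>: "(sum a \<longlongrightarrow> \<alpha>) ?A"
    by (auto simp: summable_on_def has_sum_def)
  have "norm (b w) \<le> 2 * (norm \<omega>)\<^sup>2 * inverse (norm w ^ 3)" if "norm w > 2 * norm \<omega>" for w
  proof -
    note f = far[OF that]
    have "b w = - (\<omega>\<^sup>2 / (w\<^sup>2 * (w - \<omega>)))"
      using f by (simp add: b_def divide_simps) (simp add: algebra_simps power2_eq_square)
    then have "norm (b w) = (norm \<omega>)\<^sup>2 / ((norm w)\<^sup>2 * norm (w - \<omega>))"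
      by (simp add: norm_mult norm_divide norm_power)
    also have "\<dots> \<le> (norm \<omega>)\<^sup>2 / ((norm w)\<^sup>2 * (norm w / 2))"
      using f by (intro divide_left_mono mult_left_mono mult_pos_pos) auto
    also have "\<dots> = 2 * (norm \<omega>)\<^sup>2 * inverse (norm w ^ 3)"
      using f by (simp add: field_simps power2_eq_square power3_eq_cube)
    finally show ?thesis .
  qed
  then have "b summable_on L - {0}" by (rule summable_if_cubic_decay)
  then obtain \<beta> where \<beta>: "(sum b \<longlongrightarrow> \<beta>) ?A"
    by (auto simp: summable_on_def has_sum_def)
  have P: "((\<lambda>F. P F u) \<longlongrightarrow> sigma u) ?A" for u
    unfolding P_def by (rule tendsto_sigma)
  have Ps: "((\<lambda>F. P (s F) u) \<longlongrightarrow> sigma u) ?A" for u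
    unfolding s_def by (rule filterlim_compose[OF P filterlim_shifted_subsets[OF \<omega>(1)]])
  have X: "((\<lambda>F. exp (sum a F * u\<^sup>2 + (3 / \<omega> + sum b F) * u)) \<longlongrightarrow> exp (\<alpha> * u\<^sup>2 + (3 / \<omega> + \<beta>) * u)) ?A" for u
    by (intro tendsto_intros \<alpha> \<beta>)
  have key: "P F (u + \<omega>) = c F * exp (sum a F * u\<^sup>2 + (3 / \<omega> + sum b F) * u) * P (s F) u"
    if F: "finite F" "F \<subseteq> L - {0}" "\<omega> \<in> F" for F u
  proof -
    let ?G = "F - {\<omega>}"
    have G: "finite ?G" using F by simp
    have "P F (u + \<omega>) = (u + \<omega>) * (weierstrass_factor 2 ((u + \<omega>) / \<omega>) * (\<Prod>w\<in>?G. weierstrass_factor 2 ((u + \<omega>) / w)))"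
      unfolding P_def using F by (subst prod.remove[of F \<omega>]) auto
    also have "(\<Prod>w\<in>?G. weierstrass_factor 2 ((u + \<omega>) / w)) =
       (\<Prod>w\<in>?G. ((w - \<omega>) / w * exp (\<omega> / w + (\<omega> / w)\<^sup>2 / 2)) * exp (a w * u\<^sup>2 + b w * u) * weierstrass_factor 2 (u / (w - \<omega>)))"
    proof (rule prod.cong)
      fix w assume "w \<in> ?G"
      then have w: "w \<noteq> 0" "w - \<omega> \<noteq> 0" "w \<noteq> \<omega>" using F by auto
      have "1 - (u + \<omega>) / w = (w - \<omega>) / w * (1 - u / (w - \<omega>))"
        using w by (simp add: divide_simps)
      moreover have "(u + \<omega>) / w + ((u + \<omega>) / w)\<^sup>2 / 2 =
          (\<omega> / w + (\<omega> / w)\<^sup>2 / 2) + (a w * u\<^sup>2 + b w * u) + (u / (w - \<omega>) + (u / (w - \<omega>))\<^sup>2 / 2)"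
        using w by (simp add: a_def b_def power_divide algebra_simps add_divide_distrib diff_divide_distrib power2_eq_square)
      ultimately show "weierstrass_factor 2 ((u + \<omega>) / w) =
         ((w - \<omega>) / w * exp (\<omega> / w + (\<omega> / w)\<^sup>2 / 2)) * exp (a w * u\<^sup>2 + b w * u) * weierstrass_factor 2 (u / (w - \<omega>))"
        by (simp only: weierstrass_factor_two exp_add mult.assoc mult.left_commute)
    qed simp
    also have "\<dots> = (\<Prod>w\<in>?G. (w - \<omega>) / w * exp (\<omega> / w + (\<omega> / w)\<^sup>2 / 2))
         * exp (\<Sum>w\<in>?G. a w * u\<^sup>2 + b w * u) * (\<Prod>w\<in>?G. weierstrass_factor 2 (u / (w - \<omega>)))"
      using G by (simp only: prod.distrib exp_sum)
    also have "(\<Sum>w\<in>?G. a w * u\<^sup>2 + b w * u) = sum a F * u\<^sup>2 + sum b F * u"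
    proof -
      have "sum a ?G = sum a F"
        by (rule sum.mono_neutral_left) (use F in \<open>auto simp: a_def\<close>)
      moreover have "sum b ?G = sum b F"
        by (rule sum.mono_neutral_left) (use F in \<open>auto simp: b_def\<close>)
      ultimately show ?thesis by (simp only: sum.distrib sum_distrib_right[symmetric])
    qed
    \<comment> \<open>The factor of \<open>\<omega>\<close>, compared with the new factor of \<open>- \<omega>\<close>, leaves the exponent \<open>3 / 2 + 3 u / \<omega>\<close> without a quadratic term.\<close>
    also have "weierstrass_factor 2 ((u + \<omega>) / \<omega>) = - (u / \<omega>) * exp (3 / 2) * exp (3 / \<omega> * u) * exp (- u / \<omega> + (- u / \<omega>)\<^sup>2 / 2)"
    proof -
      have "(u + \<omega>) / \<omega> + ((u + \<omega>) / \<omega>)\<^sup>2 / 2 = 3 / 2 + 3 / \<omega> * u + (- u / \<omega> + (- u / \<omega>)\<^sup>2 / 2)"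
        using \<omega> by (simp add: divide_simps) (simp add: algebra_simps power2_eq_square)
      moreover have "1 - (u + \<omega>) / \<omega> = - (u / \<omega>)" using \<omega> by (simp add: divide_simps)
      ultimately show ?thesis by (simp only: weierstrass_factor_two exp_add mult.assoc)
    qed
    finally have 1: "P F (u + \<omega>) = (u + \<omega>) * (- (u / \<omega>) * exp (3 / 2) * exp (3 / \<omega> * u) * exp (- u / \<omega> + (- u / \<omega>)\<^sup>2 / 2) *
       ((\<Prod>w\<in>?G. (w - \<omega>) / w * exp (\<omega> / w + (\<omega> / w)\<^sup>2 / 2)) * exp (sum a F * u\<^sup>2 + sum b F * u) *
         (\<Prod>w\<in>?G. weierstrass_factor 2 (u / (w - \<omega>)))))" .
    have "P (s F) u = u * (\<Prod>w\<in>insert 0 F - {\<omega>}. weierstrass_factor 2 (u / (w - \<omega>)))"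
      unfolding P_def s_def by (subst prod.reindex) (auto simp: inj_on_def)
    also have "insert 0 F - {\<omega>} = insert 0 ?G" using \<omega> by auto
    also have "(\<Prod>w\<in>insert 0 ?G. weierstrass_factor 2 (u / (w - \<omega>))) =
       weierstrass_factor 2 (u / (0 - \<omega>)) * (\<Prod>w\<in>?G. weierstrass_factor 2 (u / (w - \<omega>)))"
      using G F by (subst prod.insert) auto
    also have "weierstrass_factor 2 (u / (0 - \<omega>)) = (u + \<omega>) / \<omega> * exp (- u / \<omega> + (- u / \<omega>)\<^sup>2 / 2)"
      using \<omega> by (simp add: weierstrass_factor_two add_divide_distrib)
    finally have 2: "P (s F) u = u * ((u + \<omega>) / \<omega> * exp (- u / \<omega> + (- u / \<omega>)\<^sup>2 / 2) *
        (\<Prod>w\<in>?G. weierstrass_factor 2 (u / (w - \<omega>))))" .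
    have 3: "exp (sum a F * u\<^sup>2 + (3 / \<omega> + sum b F) * u) = exp (3 / \<omega> * u) * exp (sum a F * u\<^sup>2 + sum b F * u)"
      by (simp add: exp_add[symmetric] algebra_simps)
    show ?thesis unfolding 1 2 3 c_def by (simp add: mult_ac)
  qed
  have ev: "eventually (\<lambda>F. finite F \<and> F \<subseteq> L - {0} \<and> \<omega> \<in> F) ?A"
    unfolding eventually_finite_subsets_at_top using \<omega> by (intro exI[of _ "{\<omega>}"]) auto
  obtain u0 where u0: "sigma u0 \<noteq> 0" by (rule sigma_nontrivial)
  let ?E = "\<lambda>u. exp (\<alpha> * u\<^sup>2 + (3 / \<omega> + \<beta>) * u)"
  define C where "C = sigma (u0 + \<omega>) / (?E u0 * sigma u0)"
  have c: "(c \<longlongrightarrow> C) ?A"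
  proof (rule Lim_transform_eventually)
    show "((\<lambda>F. P F (u0 + \<omega>) / (exp (sum a F * u0\<^sup>2 + (3 / \<omega> + sum b F) * u0) * P (s F) u0)) \<longlongrightarrow> C) ?A"
      unfolding C_def by (intro tendsto_divide P Ps tendsto_mult X) (use u0 in simp)
    have "eventually (\<lambda>F. P (s F) u0 \<noteq> 0) ?A"
      using tendsto_imp_eventually_ne[OF Ps u0] .
    then show "eventually (\<lambda>F. P F (u0 + \<omega>) / (exp (sum a F * u0\<^sup>2 + (3 / \<omega> + sum b F) * u0) * P (s F) u0) = c F) ?A"
      using ev by eventually_elim (simp add: key)
  qed
  have "sigma (u + \<omega>) = C * ?E u * sigma u" for u
  proof (rule tendsto_unique[OF _ P])
    have "((\<lambda>F. c F * exp (sum a F * u\<^sup>2 + (3 / \<omega> + sum b F) * u) * P (s F) u) \<longlongrightarrow> C * ?E u * sigma u) ?A"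
      by (intro tendsto_mult c X Ps)
    then show "((\<lambda>F. P F (u + \<omega>)) \<longlongrightarrow> C * ?E u * sigma u) ?A"
      by (rule Lim_transform_eventually) (use ev in \<open>eventually_elim, simp add: key\<close>)
  qed simp
  then show ?thesis using that by blast
qed

text \<open>Since sigma is odd, the multiplier \<open>c exp (\<alpha> u\<^sup>2 + \<beta> u)\<close> at \<open>u\<close> is the inverse of the multiplier at
  \<open>- u - \<omega>\<close>. The product of the two being 1 forces \<open>\<alpha> = 0\<close> and \<open>c\<^sup>2 = exp (\<beta> \<omega>)\<close>.\<close>

lemma sigma_quasi_periodic:
  assumes \<omega>: "\<omega> \<in> L"
  obtains \<epsilon> h where "\<epsilon> = 1 \<or> \<epsilon> = -1" "\<And>u. sigma (u + \<omega>) = \<epsilon> * exp (h * (u + \<omega> / 2)) * sigma u"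
proof (cases "\<omega> = 0")
  case True
  then show ?thesis by (intro that[of 1 0]) auto
next
  case False
  obtain c \<alpha> \<beta> where q: "\<And>u. sigma (u + \<omega>) = c * exp (\<alpha> * u\<^sup>2 + \<beta> * u) * sigma u"
    using sigma_shift_exp_quadratic[OF \<omega> False] by blast
  obtain u0 where u0: "sigma u0 \<noteq> 0" by (rule sigma_nontrivial)
  let ?f = "\<lambda>u. c\<^sup>2 * exp (\<alpha> * (u\<^sup>2 + (u + \<omega>)\<^sup>2) - \<beta> * \<omega>)"
  have one: "?f u = 1" for u
  proof (rule entire_generic_eq[where f = ?f and g = "\<lambda>_. 1", OF sigma_holomorphic u0])
    fix z assume z: "sigma z \<noteq> 0"
    have "sigma z = c * exp (\<alpha> * (z + \<omega>)\<^sup>2 - \<beta> * (z + \<omega>)) * sigma (z + \<omega>)"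
    proof -
      have "(- (z + \<omega>))\<^sup>2 = (z + \<omega>)\<^sup>2" by (rule power2_minus)
      then show ?thesis
        using q[of "- (z + \<omega>)"] sigma_minus[of "z + \<omega>"] sigma_minus[of z]
        by (simp add: algebra_simps)
    qed
    also have "\<dots> = c * exp (\<alpha> * (z + \<omega>)\<^sup>2 - \<beta> * (z + \<omega>)) * (c * exp (\<alpha> * z\<^sup>2 + \<beta> * z) * sigma z)"
      by (simp only: q)
    also have "\<dots> = c\<^sup>2 * (exp (\<alpha> * (z + \<omega>)\<^sup>2 - \<beta> * (z + \<omega>)) * exp (\<alpha> * z\<^sup>2 + \<beta> * z)) * sigma z"
      by (simp add: power2_eq_square)
    also have "exp (\<alpha> * (z + \<omega>)\<^sup>2 - \<beta> * (z + \<omega>)) * exp (\<alpha> * z\<^sup>2 + \<beta> * z) = exp (\<alpha> * (z\<^sup>2 + (z + \<omega>)\<^sup>2) - \<beta> * \<omega>)"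
      by (simp add: exp_add[symmetric] algebra_simps)
    finally show "?f z = 1" using z by simp
  qed (auto intro!: continuous_intros)
  have "(?f has_field_derivative ?f 0 * (\<alpha> * (2 * \<omega>))) (at 0)"
    by (auto intro!: derivative_eq_intros)
  moreover have "(?f has_field_derivative 0) (at 0)" by (simp add: one)
  ultimately have "?f 0 * (\<alpha> * (2 * \<omega>)) = 0" by (rule DERIV_unique)
  then have \<alpha>: "\<alpha> = 0" using one[of 0] False by auto
  define \<epsilon> where "\<epsilon> = c * exp (- \<beta> * \<omega> / 2)"
  have "\<epsilon>\<^sup>2 = c\<^sup>2 * exp (- \<beta> * \<omega>)"
    by (simp add: \<epsilon>_def power_mult_distrib exp_double[symmetric])
  then have "\<epsilon>\<^sup>2 = 1" using one[of 0] \<alpha> by simp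
  then have "\<epsilon> = 1 \<or> \<epsilon> = -1" by (simp add: power2_eq_1_iff)
  moreover have "sigma (u + \<omega>) = \<epsilon> * exp (\<beta> * (u + \<omega> / 2)) * sigma u" for u
  proof -
    have "exp (\<beta> * u) = exp (- \<beta> * \<omega> / 2) * exp (\<beta> * (u + \<omega> / 2))"
      by (simp add: exp_add[symmetric] algebra_simps)
    then show ?thesis by (simp add: q \<alpha> \<epsilon>_def)
  qed
  ultimately show ?thesis using that by blast
qed

end

section \<open>Lattices in the plane\<close>

locale period_lattice =
  fixes w1 w2 :: complex
  assumes independent: "valid_periods (Elliptic w1 w2)"
begin

abbreviation \<Lambda> :: "complex set" where
  "\<Lambda> \<equiv> Omega (Elliptic w1 w2)"

definition det :: real where
  "det = Re w1 * Im w2 - Im w1 * Re w2"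

lemma det_nonzero: "det \<noteq> 0"
proof
  assume d: "det = 0"
  have ind: "s = 0 \<and> t = 0" if "s *\<^sub>R w1 + t *\<^sub>R w2 = 0" for s t :: real
    using independent that by simp
  have "Im w2 = 0 \<and> - Im w1 = 0"
    by (rule ind) (use d in \<open>simp add: complex_eq_iff det_def algebra_simps\<close>)
  moreover have "Re w2 = 0 \<and> - Re w1 = 0"
    by (rule ind) (use d in \<open>simp add: complex_eq_iff det_def algebra_simps\<close>)
  ultimately have "w1 = 0" by (simp add: complex_eq_iff)
  then show False using ind[of 1 0] by simp
qed

text \<open>By Cramer's rule, \<open>fst_coord\<close> and \<open>snd_coord\<close> are the coordinates with respect to the real basis
  \<open>w1\<close>, \<open>w2\<close> of the plane.\<close>

definition fst_coord :: "complex \<Rightarrow> real" where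
  "fst_coord u = (Re u * Im w2 - Im u * Re w2) / det"

definition snd_coord :: "complex \<Rightarrow> real" where
  "snd_coord u = (Re w1 * Im u - Im w1 * Re u) / det"

lemma coords_unique:
  "fst_coord (of_real s * w1 + of_real t * w2) = s"
  "snd_coord (of_real s * w1 + of_real t * w2) = t"
  using det_nonzero by (simp_all add: fst_coord_def snd_coord_def det_def field_simps)

lemma coords_eq: "u = of_real (fst_coord u) * w1 + of_real (snd_coord u) * w2"
proof -
  have "det * Re u = (Re u * Im w2 - Im u * Re w2) * Re w1 + (Re w1 * Im u - Im w1 * Re u) * Re w2"
    "det * Im u = (Re u * Im w2 - Im u * Re w2) * Im w1 + (Re w1 * Im u - Im w1 * Re u) * Im w2"
    by (simp_all add: det_def algebra_simps)
  then show ?thesis using det_nonzero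
    by (simp add: complex_eq_iff fst_coord_def snd_coord_def divide_simps) 
       (simp add: mult.commute)
qed

lemma int_coords_unique:
  "fst_coord (of_int k * w1 + of_int l * w2) = of_int k"
  "snd_coord (of_int k * w1 + of_int l * w2) = of_int l"
  using coords_unique[of "of_int k" "of_int l"] by simp_all

lemma coords_bounded: obtains K where "K > 0" "\<And>u. \<bar>fst_coord u\<bar> \<le> K * norm u" "\<And>u. \<bar>snd_coord u\<bar> \<le> K * norm u"
proof -
  have bd: "\<bar>a * c - b * d\<bar> / D \<le> ((\<bar>c\<bar> + \<bar>d\<bar>) / D) * M" 
    if "\<bar>a\<bar> \<le> M" "\<bar>b\<bar> \<le> M" "D > 0" for a b c d D M :: real
  proof -
    have "\<bar>a * c - b * d\<bar> \<le> \<bar>a\<bar> * \<bar>c\<bar> + \<bar>b\<bar> * \<bar>d\<bar>"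
      using abs_triangle_ineq4[of "a * c" "b * d"] by (simp add: abs_mult)
    also have "\<dots> \<le> M * \<bar>c\<bar> + M * \<bar>d\<bar>"
      using that by (intro add_mono mult_right_mono) auto
    finally show ?thesis using that by (simp add: divide_right_mono algebra_simps flip: add_divide_distrib)
  qed
  define K where "K = (\<bar>Im w2\<bar> + \<bar>Re w2\<bar>) / \<bar>det\<bar> + (\<bar>Im w1\<bar> + \<bar>Re w1\<bar>) / \<bar>det\<bar> + 1"
  have K0: "K > 0" using det_nonzero by (simp add: K_def add_nonneg_pos)
  have 1: "\<bar>fst_coord u\<bar> \<le> (\<bar>Im w2\<bar> + \<bar>Re w2\<bar>) / \<bar>det\<bar> * norm u" for u
    using bd[of "Re u" "norm u" "Im u" "\<bar>det\<bar>" "Im w2" "Re w2"] det_nonzero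
    by (simp add: fst_coord_def abs_Re_le_cmod abs_Im_le_cmod)
  have 2: "\<bar>snd_coord u\<bar> \<le> (\<bar>Im w1\<bar> + \<bar>Re w1\<bar>) / \<bar>det\<bar> * norm u" for u
    using bd[of "Re u" "norm u" "Im u" "\<bar>det\<bar>" "Im w1" "Re w1"] det_nonzero
    by (simp add: snd_coord_def abs_Re_le_cmod abs_Im_le_cmod abs_minus_commute mult.commute)
  have "\<bar>fst_coord u\<bar> \<le> K * norm u" "\<bar>snd_coord u\<bar> \<le> K * norm u" for u
    by (rule order_trans[OF 1], rule mult_right_mono, simp_all add: K_def)
       (rule order_trans[OF 2], rule mult_right_mono, simp_all add: K_def)
  with K0 that show ?thesis by blast
qed

lemma summable_int_powr: "(\<lambda>k::int. (1 + \<bar>of_int k\<bar> :: real) powr (-3/2)) summable_on UNIV"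
proof -
  let ?p = "\<lambda>k::int. (1 + \<bar>of_int k\<bar> :: real) powr (-3/2)"
  have n: "(\<lambda>n::nat. (1 + real n) powr (-3/2)) summable_on UNIV"
    using summable_real_powr_iff[of "-3/2"] summable_Suc_iff[of "\<lambda>n. real n powr (-3/2)"]
    by (subst summable_on_UNIV_nonneg_real_iff) (simp_all add: add.commute)
  have "?p summable_on range int"
    by (subst summable_on_reindex) (use n in \<open>auto simp: o_def\<close>)
  moreover have "?p summable_on (\<lambda>n. - int n) ` UNIV"
    by (subst summable_on_reindex) (use n in \<open>auto simp: o_def inj_on_def\<close>)
  then have "?p summable_on ((\<lambda>n. - int n) ` UNIV - range int)"
    by (rule summable_on_subset_banach) auto
  ultimately have "?p summable_on (range int \<union> ((\<lambda>n. - int n) ` UNIV - range int))"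
    by (rule summable_on_Un_disjoint) auto
  moreover have "range int \<union> ((\<lambda>n. - int n) ` UNIV - range int) = UNIV"
  proof -
    have "k \<in> range int \<or> k \<in> range (\<lambda>n. - int n)" for k :: int
      by (cases k rule: int_cases2) auto
    then show ?thesis by auto
  qed
  ultimately show ?thesis by simp
qed

text \<open>If \<open>u = k w1 + l w2\<close> is not zero, then \<open>\<bar>k\<bar>\<close> and \<open>\<bar>l\<bar>\<close> are at most \<open>K norm u\<close> and
  \<open>1 \<le> K norm u\<close>, so \<open>(1 + \<bar>k\<bar>) (1 + \<bar>l\<bar>) \<le> (2 K norm u)\<^sup>2\<close>. Hence \<open>1 / norm u ^ 3\<close> is dominated by
  a product of two convergent series in one variable.\<close>

lemma sigma_lattice_Omega: "sigma_lattice \<Lambda>"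
proof
  show "0 \<in> \<Lambda>" by (auto intro!: exI[of _ "0 :: int"])
  show "u - v \<in> \<Lambda>" if uv: "u \<in> \<Lambda>" "v \<in> \<Lambda>" for u v
  proof -
    from uv obtain a b c d :: int where "u = of_int a * w1 + of_int b * w2" "v = of_int c * w1 + of_int d * w2" by auto
    then have "u - v = of_int (a - c) * w1 + of_int (b - d) * w2" by (simp add: algebra_simps)
    then show ?thesis unfolding Omega.simps by blast
  qed
  let ?h = "\<lambda>(k::int, l::int). of_int k * w1 + of_int l * w2"
  let ?p = "\<lambda>k::int. (1 + \<bar>of_int k\<bar> :: real) powr (-3/2)"
  let ?I = "(UNIV \<times> UNIV) - {(0::int, 0::int)}"
  have inj: "inj ?h"
  proof (rule injI)
    fix x y assume e: "?h x = ?h y"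
    obtain k l k' l' where xy: "x = (k, l)" "y = (k', l')" by (cases x, cases y) auto
    show "x = y" using e int_coords_unique[of k l] int_coords_unique[of k' l'] unfolding xy by simp
  qed
  have img: "\<Lambda> - {0} = ?h ` ?I"
  proof -
    have "\<Lambda> = range ?h" by auto
    moreover have "{0} = ?h ` {(0, 0)}" by simp
    ultimately show ?thesis using image_set_diff[OF inj, of UNIV "{(0,0)}"] by simp
  qed
  obtain K where K: "K > 0" "\<And>u. \<bar>fst_coord u\<bar> \<le> K * norm u" "\<And>u. \<bar>snd_coord u\<bar> \<le> K * norm u"
    using coords_bounded by blast
  have "(\<lambda>(k, l). ?p k * ?p l) summable_on (UNIV :: int set) \<times> (UNIV :: int set)"
  proof (rule summable_on_SigmaI)
    show "((\<lambda>l. (case (k, l) of (k, l) \<Rightarrow> ?p k * ?p l)) has_sum ?p k * infsum ?p UNIV) UNIV" for k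
      using has_sum_cmult_right[OF has_sum_infsum[OF summable_int_powr]] by simp
    show "(\<lambda>k. ?p k * infsum ?p UNIV) summable_on UNIV"
      by (rule summable_on_cmult_left[OF summable_int_powr])
  qed auto
  then have "(\<lambda>x. (2 * K) ^ 3 * (case x of (k, l) \<Rightarrow> ?p k * ?p l)) summable_on ?I"
    by (intro summable_on_cmult_right) (rule summable_on_subset_banach, auto)
  then have "(\<lambda>x. inverse (norm (?h x) ^ 3)) summable_on ?I"
  proof (rule summable_on_comparison_test)
    fix x assume x: "x \<in> ?I"
    obtain k l where kl: "x = (k, l)" by (cases x)
    let ?u = "of_int k * w1 + of_int l * w2"
    have k: "\<bar>of_int k\<bar> \<le> K * norm ?u" and l: "\<bar>of_int l\<bar> \<le> K * norm ?u"
      using K(2)[of ?u] K(3)[of ?u] by (simp_all add: int_coords_unique)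
    have "1 \<le> \<bar>k\<bar> \<or> 1 \<le> \<bar>l\<bar>" using x kl by auto
    then have "1 \<le> \<bar>real_of_int k\<bar> \<or> 1 \<le> \<bar>real_of_int l\<bar>" by linarith
    then have ge1: "1 \<le> K * norm ?u" using k l by linarith
    have pos: "norm ?u > 0" using ge1 K(1) by (metis mult_zero_right not_one_le_zero norm_eq_zero zero_less_norm_iff)
    have "(1 + \<bar>real_of_int k\<bar>) * (1 + \<bar>real_of_int l\<bar>) \<le> (2 * K * norm ?u) * (2 * K * norm ?u)"
      using k l ge1 by (intro mult_mono) auto
    then have "((1 + \<bar>real_of_int k\<bar>) * (1 + \<bar>real_of_int l\<bar>)) powr (3/2) \<le> ((2 * K * norm ?u) * (2 * K * norm ?u)) powr (3/2)"
      by (intro powr_mono2) auto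
    also have "\<dots> = (2 * K * norm ?u) ^ 3"
    proof -
      have cube: "(y * y) powr (3/2) = y ^ 3" if "y > 0" for y :: real
      proof -
        have "(y * y) powr (3/2) = (y powr 2) powr (3/2)" using that by (simp add: power2_eq_square)
        also have "\<dots> = y powr 3" by (simp only: powr_powr) simp
        finally show ?thesis using that by simp
      qed
      show ?thesis by (rule cube) (use K(1) pos in simp)
    qed
    finally have le: "((1 + \<bar>real_of_int k\<bar>) * (1 + \<bar>real_of_int l\<bar>)) powr (3/2) \<le> (2 * K) ^ 3 * norm ?u ^ 3"
      by (simp add: power_mult_distrib)
    have "inverse (norm ?u ^ 3) \<le> (2 * K) ^ 3 * inverse (((1 + \<bar>real_of_int k\<bar>) * (1 + \<bar>real_of_int l\<bar>)) powr (3/2))"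
    proof -
      have "1 + \<bar>real_of_int k\<bar> > 0" "1 + \<bar>real_of_int l\<bar> > 0" by linarith+
      then have "((1 + \<bar>real_of_int k\<bar>) * (1 + \<bar>real_of_int l\<bar>)) powr (3/2) > 0" by simp
      with le pos show ?thesis by (simp add: field_simps)
    qed
    also have "inverse (((1 + \<bar>real_of_int k\<bar>) * (1 + \<bar>real_of_int l\<bar>)) powr (3/2)) = ?p k * ?p l"
      by (simp add: powr_mult powr_minus)
    finally show "inverse (norm (?h x) ^ 3) \<le> (2 * K) ^ 3 * (case x of (k, l) \<Rightarrow> ?p k * ?p l)"
      by (simp add: kl)
  qed auto
  then show "(\<lambda>w. inverse (norm w ^ 3)) summable_on \<Lambda> - {0}"
    unfolding img by (subst summable_on_reindex) (use inj in \<open>auto intro: inj_on_subset simp: o_def\<close>)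
qed

sublocale sigma_lattice \<Lambda>
  by (rule sigma_lattice_Omega)

lemma half_period_mem_iff:
  "(of_int a * w1 + of_int b * w2) / 2 \<in> \<Lambda> \<longleftrightarrow> even a \<and> even b"
proof
  assume "(of_int a * w1 + of_int b * w2) / 2 \<in> \<Lambda>"
  then obtain k l :: int where kl: "(of_int a * w1 + of_int b * w2) / 2 = of_int k * w1 + of_int l * w2" by auto
  then have "of_int a * w1 + of_int b * w2 = of_int (2 * k) * w1 + of_int (2 * l) * w2"
    by (simp add: field_simps)
  then have "real_of_int a = of_int (2 * k) \<and> real_of_int b = of_int (2 * l)"
    by (metis int_coords_unique)
  then have "a = 2 * k" "b = 2 * l" by (simp_all only: of_int_eq_iff)
  then show "even a \<and> even b" by simp
next
  assume "even a \<and> even b"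
  then obtain k l where "a = 2 * k" "b = 2 * l" by (auto elim!: evenE)
  then have "(of_int a * w1 + of_int b * w2) / 2 = of_int k * w1 + of_int l * w2" by (simp add: field_simps)
  then show "(of_int a * w1 + of_int b * w2) / 2 \<in> \<Lambda>" by auto
qed

text \<open>The zeros of \<open>h\<close> are simple and are zeros of \<open>f\<close>, so \<open>f / h\<close> extends to an entire function. It is
  doubly periodic, hence bounded by its maximum over a period parallelogram, and Liouville's theorem
  applies.\<close>

lemma proportional_if_same_multipliers:
  assumes f: "f holomorphic_on UNIV" and h: "h holomorphic_on UNIV" "h z0 \<noteq> 0"
    and m: "\<And>w u. w \<in> {w1, w2} \<Longrightarrow> m w u \<noteq> 0"
    and fm: "\<And>w u. w \<in> {w1, w2} \<Longrightarrow> f (u + w) = m w u * f u"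
    and hm: "\<And>w u. w \<in> {w1, w2} \<Longrightarrow> h (u + w) = m w u * h u"
    and zeros: "\<And>u. h u = 0 \<Longrightarrow> f u = 0 \<and> deriv h u \<noteq> 0"
  obtains c where "\<And>u. f u = c * h u"
proof -
  \<comment> \<open>By l'Hospital's rule this is the continuous extension of \<open>f / h\<close>.\<close>
  define g where "g u = (if h u = 0 then deriv f u / deriv h u else f u / h u)" for u
  have lim: "(g \<longlongrightarrow> g u) (at u)" for u
  proof -
    have "((\<lambda>z. f z / h z) \<longlongrightarrow> g u) (at u)"
    proof (cases "h u = 0")
      case True
      then show ?thesis
        using zeros[of u] holomorphic_derivI[OF f, of u] holomorphic_derivI[OF h(1), of u]
        by (intro lhopital_complex_simple[where f' = "deriv f u" and g' = "deriv h u"]) (auto simp: g_def)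
    next
      case False
      have "isCont f u" "isCont h u" 
        using f h(1) by (auto simp: holomorphic_on_imp_continuous_on continuous_on_eq_continuous_at dest!: holomorphic_on_imp_continuous_on)
      then show ?thesis using False by (auto simp: g_def isCont_def intro!: tendsto_divide)
    qed
    moreover have "eventually (\<lambda>z. f z / h z = g z) (at u)"
      using entire_generic_nonzero[OF h] by eventually_elim (simp add: g_def)
    ultimately show ?thesis by (rule Lim_transform_eventually)
  qed
  have "g field_differentiable (at u)" for u
  proof -
    obtain r where r: "r > 0" "\<And>z. z \<in> ball u r \<Longrightarrow> z \<noteq> u \<Longrightarrow> h z \<noteq> 0"
      using entire_generic_nonzero[OF h, of u] by (auto simp: eventually_at dist_commute)
    have "(\<lambda>z. f z / h z) holomorphic_on ball u r - {u}"
      using r by (intro holomorphic_on_divide holomorphic_on_subset[OF f] holomorphic_on_subset[OF h(1)]) auto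
    then have "g holomorphic_on ball u r - {u}"
      by (rule holomorphic_transform) (use r in \<open>auto simp: g_def\<close>)
    then have "g holomorphic_on ball u r"
      by (rule no_isolated_singularity'[rotated]) (auto intro: lim tendsto_within_subset)
    then show ?thesis using r(1) by (intro holomorphic_on_imp_differentiable_at[of g "ball u r"]) auto
  qed
  then have hol: "g holomorphic_on UNIV"
    by (simp add: holomorphic_on_def field_differentiable_at_within)
  have contg: "isCont g u" for u using lim by (simp add: isCont_def)
  have per: "g (u + w) = g u" if w: "w \<in> {w1, w2}" for u w
  proof (rule entire_generic_eq[OF h, where f = "\<lambda>u. g (u + w)" and g = g])
    show "isCont (\<lambda>u. g (u + w)) u" 
      by (rule isCont_o2[OF _ contg]) (auto intro!: continuous_intros)
  qed (use m[OF w] fm[OF w] hm[OF w] in \<open>auto simp: g_def contg\<close>)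
  have per_nat: "g (u + of_nat n * w) = g u" if w: "w \<in> {w1, w2}" for u w n
  proof (induction n)
    case (Suc n)
    then show ?case using per[OF w, of "u + of_nat n * w"] by (simp add: algebra_simps)
  qed simp
  have per_int: "g (u + of_int k * w) = g u" if w: "w \<in> {w1, w2}" for u w k
    using per_nat[OF w, of u "nat k"] per_nat[OF w, of "u + of_int k * w" "nat (- k)"]
    by (cases "k \<ge> 0") simp_all
  let ?Q = "(\<lambda>(s, t). of_real s * w1 + of_real t * w2) ` ({0..1} \<times> {0..1 :: real})"
  have "compact (g ` ?Q)"
  proof (intro compact_continuous_image compact_Times compact_Icc)
    show "continuous_on ?Q g" using contg by (simp add: continuous_at_imp_continuous_on)
  qed (auto intro!: continuous_intros simp: case_prod_unfold)
  then have "bounded (g ` ?Q)" by (rule compact_imp_bounded)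
  moreover have "range g \<subseteq> g ` ?Q"
  proof (clarify)
    fix u
    let ?s = "fst_coord u" and ?t = "snd_coord u"
    let ?v = "of_real (frac ?s) * w1 + of_real (frac ?t) * w2"
    have u: "u = ?v + of_int \<lfloor>?s\<rfloor> * w1 + of_int \<lfloor>?t\<rfloor> * w2"
      using coords_eq[of u] by (simp add: frac_def algebra_simps)
    have "g u = g ?v"
      by (subst u) (simp only: per_int insertI1 insertI2)
    moreover have "?v \<in> ?Q"
      by (rule image_eqI[of _ _ "(frac ?s, frac ?t)"]) (auto simp: frac_ge_0 less_imp_le[OF frac_lt_1])
    ultimately show "g u \<in> g ` ?Q" by (metis image_eqI)
  qed
  ultimately have "bounded (range g)" by (rule bounded_subset)
  then obtain c where c: "\<And>u. g u = c"
    using Liouville_theorem[OF hol] by (auto simp: constant_on_def)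
  have "f u = c * h u" for u
    using c[of u] zeros[of u] by (cases "h u = 0") (auto simp: g_def)
  then show ?thesis using that by blast
qed

end

declare Omega.simps [simp del] omega.simps [simp del]

section \<open>The bracket and its functional equations\<close>

lemma e_add: "e (a + b) = e a * e b"
  by (simp add: e_def ring_distribs exp_add)

lemma e_nonzero [simp]: "e a \<noteq> 0"
  by (simp add: e_def)

lemma e_zero [simp]: "e 0 = 1"
  by (simp add: e_def)

lemma e_holomorphic [holomorphic_intros]: "f holomorphic_on S \<Longrightarrow> (\<lambda>u. e (f u)) holomorphic_on S"
  unfolding e_def by (intro holomorphic_intros)

text \<open>These properties suffice for the partial fraction identity. The second one says that the zeros
  form a group, so that being congruent modulo the zeros is an equivalence relation; the third one is
  the three-term relation, also named after Weierstrass, Riemann and Fay.\<close>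

locale odd_bracket =
  fixes br :: "complex \<Rightarrow> complex"
  assumes br_minus: "br (- u) = - br u"
    and br_zero_diff: "br u = 0 \<Longrightarrow> br v = 0 \<Longrightarrow> br (u - v) = 0"
    and three_term: "br (t + p) * br (t - p) * (br (q + r) * br (q - r))
      + br (t + q) * br (t - q) * (br (r + p) * br (r - p))
      + br (t + r) * br (t - r) * (br (p + q) * br (p - q)) = 0"
begin

lemma br_zero [simp]: "br 0 = 0"
  using br_minus[of 0] by simp

lemma br_commute: "br (u - v) = - br (v - u)"
  using br_minus[of "v - u"] by simp

end

text \<open>The common ground of the rational, trigonometric and elliptic cases. The last property reflects
  that the exponents \<open>\<eta>\<^sub>r\<close> vanish outside the elliptic case, where \<open>\<rho> = 4\<close> and the four periods add
  up to zero.\<close>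

locale ruijsenaars_bracket = odd_bracket br
  for P :: periods and br :: "complex \<Rightarrow> complex" +
  assumes br_holomorphic: "br holomorphic_on UNIV"
    and br_eq_0_iff: "br u = 0 \<longleftrightarrow> u \<in> Omega P"
    and br_nontrivial: "\<exists>u. br u \<noteq> 0"
    and quasi_periodic: "r \<in> {1..rho P} \<Longrightarrow>
      \<exists>\<epsilon>\<in>{1, -1}. \<forall>u. br (u + omega P r) = \<epsilon> * e (eta P br r * (u + omega P r / 2)) * br u"
    and duplication: "\<exists>D. D \<noteq> 0 \<and> (\<forall>u. br (2 * u) = D * (\<Prod>s = 1..rho P. br (u - omega P s / 2)))"
    and half_period_nonzero: "r \<in> {1..rho P} \<Longrightarrow> s \<in> {1..rho P} \<Longrightarrow> r \<noteq> s \<Longrightarrow>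
      br ((omega P r - omega P s) / 2) \<noteq> 0"
    and eta_nonzero: "eta P br r \<noteq> 0 \<Longrightarrow> rho P = 4 \<and> (\<Sum>s = 1..rho P. omega P s) = 0"

lemma odd_bracket_rational:
  assumes "\<And>u. br u = C * u"
  shows "odd_bracket br"
  by standard (auto simp: assms algebra_simps)

lemma bracket_rational:
  assumes "is_bracket Rational br"
  shows "ruijsenaars_bracket Rational br"
proof -
  from assms obtain C where C: "C \<noteq> 0" "\<And>u. br u = C * u" by auto
  note [simp] = Omega.simps omega.simps
  interpret odd_bracket br by (rule odd_bracket_rational[OF C(2)])
  show ?thesis
  proof
    have "br = (\<lambda>u. C * u)" using C by auto
    then show "br holomorphic_on UNIV" by (auto intro!: holomorphic_intros)
    show "\<exists>u. br u \<noteq> 0" using C by (intro exI[of _ 1]) simp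
    show "\<exists>D. D \<noteq> 0 \<and> (\<forall>u. br (2 * u) = D * (\<Prod>s = 1..rho Rational. br (u - omega Rational s / 2)))"
      by (intro exI[of _ 2]) (simp add: C)
  qed (auto simp: C)
qed

lemma sin_plus_minus: "sin (x + y) * sin (x - y) = (sin x)\<^sup>2 - (sin (y :: complex))\<^sup>2"
  unfolding sin_add sin_diff using sin_cos_squared_add[of x] sin_cos_squared_add[of y] by algebra

lemma bracket_trigonometric:
  assumes "w1 \<noteq> 0" "is_bracket (Trigonometric w1) br"
  shows "ruijsenaars_bracket (Trigonometric w1) br"
proof -
  from assms obtain C where C: "C \<noteq> 0" "\<And>u. br u = C * sin (of_real pi * u / w1)" by auto
  let ?s = "\<lambda>u. of_real pi * u / w1"
  note [simp] = Omega.simps omega.simps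
  have zero: "br u = 0 \<longleftrightarrow> u \<in> Omega (Trigonometric w1)" for u
  proof -
    have "br u = 0 \<longleftrightarrow> (\<exists>k::int. ?s u = of_real (of_int k * pi))"
      using C by (simp add: sin_eq_0)
    also have "\<dots> \<longleftrightarrow> (\<exists>k::int. u = of_int k * w1)"
      using assms(1) by (intro ex_cong1) (simp add: field_simps)
    finally show ?thesis by auto
  qed
  have prod: "br (x + y) * br (x - y) = C\<^sup>2 * ((sin (?s x))\<^sup>2 - (sin (?s y))\<^sup>2)" for x y
  proof -
    have "br (x + y) * br (x - y) = C\<^sup>2 * (sin (?s x + ?s y) * sin (?s x - ?s y))"
      by (simp add: C ring_distribs add_divide_distrib diff_divide_distrib power2_eq_square)
    then show ?thesis by (simp only: sin_plus_minus)
  qed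
  interpret odd_bracket br
  proof
    show "br (u - v) = 0" if "br u = 0" "br v = 0" for u v
    proof -
      from that obtain k l :: int where "u = of_int k * w1" "v = of_int l * w1" by (auto simp: zero)
      then have "u - v = of_int (k - l) * w1" by (simp add: algebra_simps)
      then show ?thesis unfolding zero Omega.simps by blast
    qed
    show "br (t + p) * br (t - p) * (br (q + r) * br (q - r))
      + br (t + q) * br (t - q) * (br (r + p) * br (r - p))
      + br (t + r) * br (t - r) * (br (p + q) * br (p - q)) = 0" for t p q r
      unfolding prod by (simp add: algebra_simps)
  qed (simp add: C(2))
  have anti: "br (u + w1) = - br u" for u
  proof -
    have "?s (u + w1) = ?s u + of_real pi" using assms(1) by (simp add: field_simps)
    then show ?thesis by (simp only: C(2)) (simp add: sin_add)
  qed
  have cosine: "br (u - w1 / 2) = - C * cos (?s u)" for u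
  proof -
    have "?s (u - w1 / 2) = - (of_real pi / 2 - ?s u)" using assms(1) by (simp add: field_simps)
    then show ?thesis by (simp only: C(2) sin_minus) (simp add: sin_diff)
  qed
  have half: "br (w1 / 2) \<noteq> 0"
    using cosine[of w1] assms(1) C(1) by simp
  show ?thesis
  proof
    have "br = (\<lambda>u. C * sin (?s u))" using C by auto
    then show "br holomorphic_on UNIV" using assms(1) by (auto intro!: holomorphic_intros)
    show "\<exists>u. br u \<noteq> 0" using half by blast
    show "\<exists>\<epsilon>\<in>{1, -1}. \<forall>u. br (u + omega (Trigonometric w1) r)
        = \<epsilon> * e (eta (Trigonometric w1) br r * (u + omega (Trigonometric w1) r / 2)) * br u" for r
      by (cases "r = 1") (simp_all add: anti)
    show "\<exists>D. D \<noteq> 0 \<and> (\<forall>u. br (2 * u) = D * (\<Prod>s = 1..rho (Trigonometric w1). br (u - omega (Trigonometric w1) s / 2)))"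
    proof (intro exI[of _ "- 2 / C"] conjI allI)
      fix u
      have "br (2 * u) = 2 * C * sin (?s u) * cos (?s u)"
        using sin_double[of "?s u"] by (simp add: C(2) mult_ac)
      also have "\<dots> = (- 2 / C) * (br (u - w1 / 2) * br u)" unfolding cosine using C by simp
      also have "br (u - w1 / 2) * br u = (\<Prod>s = 1..rho (Trigonometric w1). br (u - omega (Trigonometric w1) s / 2))"
        by (simp add: numeral_2_eq_2)
      finally show "br (2 * u) = (- 2 / C) * (\<Prod>s = 1..rho (Trigonometric w1). br (u - omega (Trigonometric w1) s / 2))" .
    qed (use C in simp)
    show "br ((omega (Trigonometric w1) r - omega (Trigonometric w1) s) / 2) \<noteq> 0"
      if "r \<in> {1..rho (Trigonometric w1)}" "s \<in> {1..rho (Trigonometric w1)}" "r \<noteq> s" for r s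
    proof -
      from that have "r = 1 \<and> s = 2 \<or> r = 2 \<and> s = 1" by auto
      then show ?thesis using half br_minus[of "w1 / 2"] by auto
    qed
  qed (auto simp: zero)
qed

locale elliptic_bracket = period_lattice w1 w2 for w1 w2 +
  fixes br :: "complex \<Rightarrow> complex"
  assumes bracket: "is_bracket (Elliptic w1 w2) br"
begin

lemma br_form: obtains C a where "C \<noteq> 0" "\<And>u. br u = C * (e (a * u\<^sup>2) * sigma u)"
  using bracket by auto

lemma zero_iff: "br u = 0 \<longleftrightarrow> u \<in> \<Lambda>"
  by (rule br_form) (simp add: sigma_eq_0_iff)

lemma minus: "br (- u) = - br u"
  by (rule br_form) (simp add: sigma_minus)

lemma holomorphic: "br holomorphic_on UNIV"
proof (rule br_form)
  fix C a assume "\<And>u. br u = C * (e (a * u\<^sup>2) * sigma u)"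
  then have "br = (\<lambda>u. C * (e (a * u\<^sup>2) * sigma u))" by auto
  then show ?thesis by (auto intro!: holomorphic_intros sigma_holomorphic)
qed

lemmas holomorphic_comp = holomorphic_on_compose_gen[OF _ holomorphic, unfolded o_def]

lemma quasi:
  assumes \<omega>: "\<omega> \<in> \<Lambda>"
  obtains \<epsilon> h where "\<epsilon> = 1 \<or> \<epsilon> = -1" "\<And>u. br (u + \<omega>) = \<epsilon> * e (h * (u + \<omega> / 2)) * br u"
proof -
  obtain C a where C: "\<And>u. br u = C * (e (a * u\<^sup>2) * sigma u)" using br_form by blast
  obtain \<epsilon> h where q: "\<epsilon> = 1 \<or> \<epsilon> = -1" "\<And>u. sigma (u + \<omega>) = \<epsilon> * exp (h * (u + \<omega> / 2)) * sigma u"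
    using sigma_quasi_periodic[OF \<omega>] by blast
  \<comment> \<open>The prefactor \<open>e (a u\<^sup>2)\<close> only adds \<open>2 a \<omega>\<close> to the exponent \<open>k\<close> coming from sigma.\<close>
  define k where "k = h / (2 * of_real pi * \<i>)"
  have exp: "exp (h * (u + \<omega> / 2)) = e (k * (u + \<omega> / 2))" for u
  proof -
    have "2 * of_real pi * \<i> * k = h" unfolding k_def by simp
    then show ?thesis by (simp add: e_def mult.assoc[symmetric])
  qed
  have "br (u + \<omega>) = \<epsilon> * e ((2 * a * \<omega> + k) * (u + \<omega> / 2)) * br u" for u
  proof -
    have "e (a * (u + \<omega>)\<^sup>2) * e (k * (u + \<omega> / 2)) = e ((2 * a * \<omega> + k) * (u + \<omega> / 2)) * e (a * u\<^sup>2)"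
      unfolding e_add[symmetric] by (rule arg_cong[of _ _ e]) (simp add: algebra_simps power2_eq_square)
    then show ?thesis unfolding C q(2) exp by (metis (no_types, opaque_lifting) mult.assoc mult.commute mult.left_commute)
  qed
  with q(1) that show ?thesis by blast
qed

text \<open>Quasi-periodicity carries the derivative at 0 to every other period.\<close>

lemma deriv_nonzero:
  assumes \<omega>: "br \<omega> = 0"
  shows "deriv br \<omega> \<noteq> 0"
proof -
  obtain C a where C: "C \<noteq> 0" "\<And>u. br u = C * (e (a * u\<^sup>2) * sigma u)" using br_form by blast 
  obtain \<epsilon> h where q: "\<epsilon> = 1 \<or> \<epsilon> = -1" "\<And>u. br (u + \<omega>) = \<epsilon> * e (h * (u + \<omega> / 2)) * br u"
    using quasi \<omega> zero_iff by metis
  define E where "E u = \<epsilon> * e (h * (u + \<omega> / 2)) * C * e (a * u\<^sup>2)" for u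
  have "E holomorphic_on UNIV" unfolding E_def by (intro holomorphic_intros) auto
  then have E: "(E has_field_derivative deriv E 0) (at 0)" by (rule holomorphic_derivI) auto
  have "(sigma has_field_derivative deriv sigma 0) (at 0)" by (rule holomorphic_derivI[OF sigma_holomorphic]) auto
  from DERIV_mult[OF E this] have "((\<lambda>u. E u * sigma u) has_field_derivative (deriv sigma 0 * E 0)) (at 0)"
    using sigma_eq_0_iff[of 0] zero_mem by simp
  moreover have "(\<lambda>u. E u * sigma u) = (\<lambda>u. br (u + \<omega>))"
    unfolding q(2) by (simp add: E_def C(2) mult_ac)
  ultimately have 1: "((\<lambda>u. br (u + \<omega>)) has_field_derivative (deriv sigma 0 * E 0)) (at 0)" by simp
  have "(br has_field_derivative deriv br \<omega>) (at (0 + \<omega>))" by (simp, rule holomorphic_derivI[OF holomorphic]) auto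
  then have "((\<lambda>u. br (u + \<omega>)) has_field_derivative deriv br \<omega>) (at 0)" 
    by (simp only: DERIV_shift)
  from DERIV_unique[OF this 1] show ?thesis
    using q(1) C(1) deriv_sigma_zero by (auto simp: E_def)
qed

lemma nontrivial: obtains u where "br u \<noteq> 0"
proof (rule sigma_nontrivial)
  fix u assume "sigma u \<noteq> 0"
  then show ?thesis using that zero_iff sigma_eq_0_iff by metis
qed

text \<open>As functions of \<open>t\<close>, all three terms have the multipliers of \<open>[t + q] [t - q]\<close>, whose zeros are
  simple because \<open>2 q\<close> is not a period. The sum of the terms vanishes at these zeros, so it is a
  constant multiple of \<open>[t + q] [t - q]\<close>; it also vanishes at \<open>t = r\<close>, so the constant is zero.\<close>

lemma three_term_generic:
  assumes q: "br (2 * q) \<noteq> 0" "br (r + q) \<noteq> 0" "br (r - q) \<noteq> 0"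
  shows "br (t + p) * br (t - p) * (br (q + r) * br (q - r))
      + br (t + q) * br (t - q) * (br (r + p) * br (r - p))
      + br (t + r) * br (t - r) * (br (p + q) * br (p - q)) = 0"
proof -
  define f where "f t = br (t + p) * br (t - p) * (br (q + r) * br (q - r))
      + br (t + q) * br (t - q) * (br (r + p) * br (r - p))
      + br (t + r) * br (t - r) * (br (p + q) * br (p - q))" for t
  define h where "h t = br (t + q) * br (t - q)" for t
  have "\<forall>\<omega>\<in>\<Lambda>. \<exists>\<epsilon> k. \<epsilon> * \<epsilon> = 1 \<and> (\<forall>u. br (u + \<omega>) = \<epsilon> * e (k * (u + \<omega> / 2)) * br u)"
    by (metis quasi mult_minus1 mult_minus1_right mult_1 minus_minus)
  then obtain \<epsilon> k where ek: "\<And>\<omega>. \<omega> \<in> \<Lambda> \<Longrightarrow> \<epsilon> \<omega> * \<epsilon> \<omega> = 1"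
    "\<And>\<omega> u. \<omega> \<in> \<Lambda> \<Longrightarrow> br (u + \<omega>) = \<epsilon> \<omega> * e (k \<omega> * (u + \<omega> / 2)) * br u" by metis
  define m where "m \<omega> t = e (2 * k \<omega> * (t + \<omega> / 2))" for \<omega> t
  have pm: "br (t + \<omega> + p) * br (t + \<omega> - p) = m \<omega> t * (br (t + p) * br (t - p))" if "\<omega> \<in> \<Lambda>" for \<omega> t p
  proof -
    have "br (t + \<omega> + p) * br (t + \<omega> - p) = br ((t + p) + \<omega>) * br ((t - p) + \<omega>)"
      by (simp add: algebra_simps)
    also have "\<dots> = (\<epsilon> \<omega> * \<epsilon> \<omega>) * (e (k \<omega> * (t + p + \<omega> / 2)) * e (k \<omega> * (t - p + \<omega> / 2))) * (br (t + p) * br (t - p))"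
      by (simp only: ek(2)[OF that] mult_ac)
    also have "e (k \<omega> * (t + p + \<omega> / 2)) * e (k \<omega> * (t - p + \<omega> / 2)) = m \<omega> t"
      unfolding m_def e_add[symmetric] by (rule arg_cong[of _ _ e]) (simp add: algebra_simps)
    finally show ?thesis by (simp add: ek(1)[OF that])
  qed
  have fm: "f (t + \<omega>) = m \<omega> t * f t" and hm: "h (t + \<omega>) = m \<omega> t * h t" if "\<omega> \<in> \<Lambda>" for \<omega> t
    unfolding f_def h_def pm[OF that] by (simp_all add: algebra_simps)
  have fq: "f q = 0"
    unfolding f_def using minus[of "q + r"] minus[of "r - q"] minus[of "q - r"] minus[of "p - q"] zero_iff[of 0] zero_mem
    by (simp add: add.commute mult_ac)
  have fr: "f r = 0"
    unfolding f_def using minus[of "r - q"] zero_iff[of 0] zero_mem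
    by (simp add: add.commute mult_ac)
  have even: "f (- t) = f t" for t
  proof -
    have *: "br (- t + p) * br (- t - p) = br (t + p) * br (t - p)" for t p
      using minus[of "t + p"] minus[of "t - p"] by (simp add: mult.commute)
    show ?thesis unfolding f_def * ..
  qed
  have w: "\<omega> \<in> \<Lambda>" if "\<omega> \<in> {w1, w2}" for \<omega>
  proof -
    have "w1 = of_int 1 * w1 + of_int 0 * w2" "w2 = of_int 0 * w1 + of_int 1 * w2" by auto
    then show ?thesis using that unfolding Omega.simps by blast
  qed
  have h_nonzero: "h r \<noteq> 0" using q by (simp add: h_def)
  obtain c where c: "\<And>t. f t = c * h t"
  proof (rule proportional_if_same_multipliers[where f = f and h = h and m = m])
    show "f holomorphic_on UNIV" unfolding f_def
      by (intro holomorphic_intros holomorphic_comp[of _ UNIV]) auto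
    show "h holomorphic_on UNIV" unfolding h_def
      by (intro holomorphic_intros holomorphic_comp[of _ UNIV]) auto
    show "h r \<noteq> 0" by (rule h_nonzero)
    show "m \<omega> u \<noteq> 0" for \<omega> u by (simp add: m_def)
    show "f u = 0 \<and> deriv h u \<noteq> 0" if hu: "h u = 0" for u
    proof
      have "br (u + q) = 0 \<or> br (u - q) = 0" using hu by (simp add: h_def)
      then have *: "u + q \<in> \<Lambda> \<or> u - q \<in> \<Lambda>" by (simp only: zero_iff)
      from this show "f u = 0"
      proof
        assume "u + q \<in> \<Lambda>" from fm[OF this, of "- q"] show ?thesis using fq even by simp
      next
        assume "u - q \<in> \<Lambda>" from fm[OF this, of "q"] show ?thesis using fq by simp
      qed
      have D: "(br has_field_derivative deriv br z) (at z)" for z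
        by (rule holomorphic_derivI[OF holomorphic]) auto
      have "(h has_field_derivative (deriv br (u + q) * br (u - q) + deriv br (u - q) * br (u + q))) (at u)"
        unfolding h_def using D by (auto intro!: derivative_eq_intros DERIV_chain2[OF D])
      then have "deriv h u = deriv br (u + q) * br (u - q) + deriv br (u - q) * br (u + q)"
        by (rule DERIV_imp_deriv)
      moreover have "\<not> (u + q \<in> \<Lambda> \<and> u - q \<in> \<Lambda>)"
      proof
        assume "u + q \<in> \<Lambda> \<and> u - q \<in> \<Lambda>"
        then have "(u + q) - (u - q) \<in> \<Lambda>" using diff_mem by blast
        then show False using q(1) by (simp add: zero_iff)
      qed
      ultimately show "deriv h u \<noteq> 0" using * deriv_nonzero[of "u + q"] deriv_nonzero[of "u - q"] zero_iff[of "u + q"] zero_iff[of "u - q"]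
        by auto
    qed
  qed (use w fm hm in blast)+
  have "c = 0" using c[of r] fr h_nonzero by simp
  then show ?thesis using c[of t] by (simp add: f_def)
qed

text \<open>Continuity in \<open>q\<close> removes the genericity assumptions.\<close>

lemma three_term_identity:
  "br (t + p) * br (t - p) * (br (q + r) * br (q - r))
      + br (t + q) * br (t - q) * (br (r + p) * br (r - p))
      + br (t + r) * br (t - r) * (br (p + q) * br (p - q)) = 0"
proof -
  obtain v where v: "br v \<noteq> 0" by (rule nontrivial)
  define h where "h q = br (2 * q) * br (r + q) * br (r - q)" for q
  have h: "h holomorphic_on UNIV" unfolding h_def
    by (intro holomorphic_intros holomorphic_comp[of _ UNIV]) auto
  have hol: "(\<lambda>q. br (a + b * q)) holomorphic_on UNIV" for a b
    by (intro holomorphic_intros holomorphic_comp[of _ UNIV]) auto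
  have "eventually (\<lambda>q. br (0 + 2 * q) \<noteq> 0) (at 0)" 
    by (rule entire_generic_nonzero[OF hol, of _ _ "v / 2"]) (use v in simp)
  moreover have "eventually (\<lambda>q. br (r + 1 * q) \<noteq> 0) (at 0)" 
    by (rule entire_generic_nonzero[OF hol, of _ _ "v - r"]) (use v in simp)
  moreover have "eventually (\<lambda>q. br (r + (-1) * q) \<noteq> 0) (at 0)" 
    by (rule entire_generic_nonzero[OF hol, of _ _ "r - v"]) (use v in simp)
  ultimately have "eventually (\<lambda>q. h q \<noteq> 0) (at 0)"
    by eventually_elim (simp add: h_def)
  then obtain q0 where q0: "h q0 \<noteq> 0"
    using eventually_happens'[of "at (0::complex)" "\<lambda>q. h q \<noteq> 0"] by (auto simp: trivial_limit_at)
  have cont: "isCont (\<lambda>q. br (g q)) u" if "isCont g u" for g u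
    using that holomorphic by (intro isCont_o2[OF that]) (auto simp: continuous_on_eq_continuous_at dest!: holomorphic_on_imp_continuous_on)
  show ?thesis
  proof (rule entire_generic_eq[OF h q0, where u = q and g = "\<lambda>_. 0"
        and f = "\<lambda>q. br (t + p) * br (t - p) * (br (q + r) * br (q - r))
      + br (t + q) * br (t - q) * (br (r + p) * br (r - p))
      + br (t + r) * br (t - r) * (br (p + q) * br (p - q))"])
    fix q assume "h q \<noteq> 0"
    then show "br (t + p) * br (t - p) * (br (q + r) * br (q - r))
      + br (t + q) * br (t - q) * (br (r + p) * br (r - p))
      + br (t + r) * br (t - r) * (br (p + q) * br (p - q)) = 0"
      by (intro three_term_generic) (auto simp: h_def)
  qed (intro continuous_intros cont)+
qed

sublocale odd_bracket br
proof
  show "br u = 0 \<Longrightarrow> br v = 0 \<Longrightarrow> br (u - v) = 0" for u v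
    by (simp add: zero_iff diff_mem)
qed (rule minus three_term_identity)+

lemma omega_coords:
  assumes "r \<in> {1..rho (Elliptic w1 w2)}"
  obtains a b :: int where "omega (Elliptic w1 w2) r = of_int a * w1 + of_int b * w2"
    "(a, b) = (if r = 1 then (1, 0) else if r = 2 then (0, 1) else if r = 3 then (-1, -1) else (0, 0))"
proof (rule that)
  show "omega (Elliptic w1 w2) r = of_int (if r = 1 then 1 else if r = 3 then -1 else 0) * w1
     + of_int (if r = 2 then 1 else if r = 3 then -1 else 0) * w2"
    by (simp add: omega.simps)
qed simp

lemma omega_mem: "r \<in> {1..rho (Elliptic w1 w2)} \<Longrightarrow> omega (Elliptic w1 w2) r \<in> \<Lambda>"
  unfolding Omega.simps by (rule omega_coords) blast+

lemma omega_half_difference: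
  assumes "r \<in> {1..rho (Elliptic w1 w2)}" "s \<in> {1..rho (Elliptic w1 w2)}" "r \<noteq> s"
  shows "(omega (Elliptic w1 w2) r - omega (Elliptic w1 w2) s) / 2 \<notin> \<Lambda>"
proof -
  obtain a b :: int where 1: "omega (Elliptic w1 w2) r = of_int a * w1 + of_int b * w2"
    "(a, b) = (if r = 1 then (1, 0) else if r = 2 then (0, 1) else if r = 3 then (-1, -1) else (0, 0))"
    using omega_coords[OF assms(1)] by blast
  obtain c d :: int where 2: "omega (Elliptic w1 w2) s = of_int c * w1 + of_int d * w2"
    "(c, d) = (if s = 1 then (1, 0) else if s = 2 then (0, 1) else if s = 3 then (-1, -1) else (0, 0))"
    using omega_coords[OF assms(2)] by blast
  have "omega (Elliptic w1 w2) r - omega (Elliptic w1 w2) s = of_int (a - c) * w1 + of_int (b - d) * w2"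
    unfolding 1(1) 2(1) by (simp add: algebra_simps)
  moreover have "\<not> (even (a - c) \<and> even (b - d))"
    using 1(2) 2(2) assms by (auto split: if_splits)
  ultimately show ?thesis by (metis half_period_mem_iff)
qed

text \<open>Both \<open>[2 u]\<close> and the product of the four half-period translates have the multipliers
  \<open>e (k (4 u + 2 \<omega>))\<close>, for the product because the four periods add up to zero. The product has
  simple zeros, since distinct half periods are incongruent, and \<open>[2 u]\<close> vanishes at them.\<close>

lemma duplication_formula:
  obtains D where "D \<noteq> 0" "\<And>u. br (2 * u) = D * (\<Prod>s = 1..4. br (u - omega (Elliptic w1 w2) s / 2))"
proof -
  let ?o = "omega (Elliptic w1 w2)"
  define f where "f u = br (2 * u)" for u
  define h where "h u = (\<Prod>s = 1..4::nat. br (u - ?o s / 2))" for u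
  obtain v where v: "br v \<noteq> 0" by (rule nontrivial)
  have f_nonzero: "f (v / 2) \<noteq> 0" using v by (simp add: f_def)
  have f0: "f u = 0" if hu: "h u = 0" for u
  proof -
    from hu obtain s where s: "s \<in> {1..4}" "br (u - ?o s / 2) = 0" by (auto simp: h_def prod_zero_iff)
    then have "(u - ?o s / 2) + (u - ?o s / 2) + ?o s \<in> \<Lambda>"
      using omega_mem[of s] by (intro add_mem) (simp_all add: zero_iff)
    then show ?thesis by (simp add: f_def zero_iff)
  qed
  have h_nonzero: "h (v / 2) \<noteq> 0" using f0 f_nonzero by blast
  have w: "\<omega> \<in> \<Lambda>" if "\<omega> \<in> {w1, w2}" for \<omega>
    using that omega_mem[of 1] omega_mem[of 2] by (auto simp: omega.simps)
  have "\<forall>\<omega>\<in>\<Lambda>. \<exists>\<epsilon> k. \<epsilon> * \<epsilon> = 1 \<and> (\<forall>u. br (u + \<omega>) = \<epsilon> * e (k * (u + \<omega> / 2)) * br u)"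
    by (metis quasi mult_minus1 mult_minus1_right mult_1 minus_minus)
  then obtain \<epsilon> k where ek: "\<And>\<omega>. \<omega> \<in> \<Lambda> \<Longrightarrow> \<epsilon> \<omega> * \<epsilon> \<omega> = 1"
    "\<And>\<omega> u. \<omega> \<in> \<Lambda> \<Longrightarrow> br (u + \<omega>) = \<epsilon> \<omega> * e (k \<omega> * (u + \<omega> / 2)) * br u" by metis
  define m where "m \<omega> u = e (k \<omega> * (4 * u + 2 * \<omega>))" for \<omega> u
  have fm: "f (u + \<omega>) = m \<omega> u * f u" if "\<omega> \<in> \<Lambda>" for \<omega> u
  proof -
    have "f (u + \<omega>) = br ((2 * u + \<omega>) + \<omega>)" by (simp add: f_def algebra_simps)
    also have "\<dots> = (\<epsilon> \<omega> * \<epsilon> \<omega>) * (e (k \<omega> * (2 * u + \<omega> + \<omega> / 2)) * e (k \<omega> * (2 * u + \<omega> / 2))) * br (2 * u)"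
      by (simp only: ek(2)[OF that] mult_ac)
    also have "e (k \<omega> * (2 * u + \<omega> + \<omega> / 2)) * e (k \<omega> * (2 * u + \<omega> / 2)) = m \<omega> u"
      unfolding m_def e_add[symmetric] by (rule arg_cong[of _ _ e]) (simp add: algebra_simps)
    finally show ?thesis by (simp add: ek(1)[OF that] f_def)
  qed
  have hm: "h (u + \<omega>) = m \<omega> u * h u" if "\<omega> \<in> \<Lambda>" for \<omega> u
  proof -
    have s: "br (u + \<omega> - ?o s / 2) = \<epsilon> \<omega> * e (k \<omega> * (u - ?o s / 2 + \<omega> / 2)) * br (u - ?o s / 2)" for s
      using ek(2)[OF that, of "u - ?o s / 2"] by (simp add: algebra_simps)
    have "(\<Prod>s = 1..4. e (k \<omega> * (u - ?o s / 2 + \<omega> / 2))) = m \<omega> u"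
      unfolding m_def by (simp add: eval_nat_numeral e_add[symmetric])
        (rule arg_cong[of _ _ e], simp add: omega.simps field_simps)
    moreover have "(\<Prod>s = 1..4::nat. \<epsilon> \<omega>) = 1"
      using ek(1)[OF that] by (simp add: eval_nat_numeral mult.assoc[symmetric])
    ultimately show ?thesis unfolding h_def s prod.distrib by simp
  qed
  obtain c where c: "\<And>u. f u = c * h u"
  proof (rule proportional_if_same_multipliers[where f = f and h = h and m = m])
    show "f holomorphic_on UNIV" unfolding f_def
      by (intro holomorphic_intros holomorphic_comp[of _ UNIV]) auto
    show "h holomorphic_on UNIV" unfolding h_def
      by (intro holomorphic_intros holomorphic_comp[of _ UNIV]) auto
    show "h (v / 2) \<noteq> 0" by (rule h_nonzero)
    show "m \<omega> u \<noteq> 0" for \<omega> u by (simp add: m_def)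
    show "f u = 0 \<and> deriv h u \<noteq> 0" if hu: "h u = 0" for u
    proof
      show "f u = 0" using f0 hu by blast
      from hu obtain s where s: "s \<in> {1..4}" "br (u - ?o s / 2) = 0" by (auto simp: h_def prod_zero_iff)
      define g where "g z = (\<Prod>s\<in>{1..4} - {s}. br (z - ?o s / 2))" for z
      have "g holomorphic_on UNIV" unfolding g_def
        by (intro holomorphic_intros holomorphic_comp[of _ UNIV]) auto
      then have G: "(g has_field_derivative deriv g u) (at u)" by (rule holomorphic_derivI) auto
      have "(br has_field_derivative deriv br (u - ?o s / 2)) (at (u + - (?o s / 2)))" 
        using holomorphic_derivI[OF holomorphic, of "u - ?o s / 2"] by simp
      then have "((\<lambda>z. br (z + - (?o s / 2))) has_field_derivative deriv br (u - ?o s / 2)) (at u)"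
        by (simp only: DERIV_shift)
      from DERIV_mult[OF this G] have "((\<lambda>z. br (z - ?o s / 2) * g z) has_field_derivative deriv br (u - ?o s / 2) * g u) (at u)"
        using s(2) by (simp)
      moreover have "(\<lambda>z. br (z - ?o s / 2) * g z) = h"
        unfolding h_def g_def prod.remove[OF finite_atLeastAtMost s(1)] ..
      ultimately have "deriv h u = deriv br (u - ?o s / 2) * g u"
        by (simp add: DERIV_imp_deriv)
      moreover have "g u \<noteq> 0"
      proof
        assume "g u = 0"
        then have "\<exists>r\<in>{1..4} - {s}. br (u - ?o r / 2) = 0" unfolding g_def by (subst (asm) prod_zero_iff) auto
        then obtain r where r: "r \<in> {1..4}" "r \<noteq> s" "br (u - ?o r / 2) = 0" by blast
        from br_zero_diff[OF r(3) s(2)] have "(?o s - ?o r) / 2 \<in> \<Lambda>"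
          by (simp add: zero_iff diff_divide_distrib)
        then show False using omega_half_difference[of s r] r s by (simp)
      qed
      ultimately show "deriv h u \<noteq> 0" using deriv_nonzero[OF s(2)] by simp
    qed
  qed (use w fm hm in blast)+
  have "c \<noteq> 0" using c[of "v / 2"] f_nonzero by auto
  with c that show ?thesis by (simp add: f_def h_def)
qed

lemma bracket_elliptic: "ruijsenaars_bracket (Elliptic w1 w2) br"
proof
  let ?P = "Elliptic w1 w2"
  show "br holomorphic_on UNIV" by (rule holomorphic)
  show "br u = 0 \<longleftrightarrow> u \<in> Omega ?P" for u by (rule zero_iff)
  show "\<exists>u. br u \<noteq> 0" using nontrivial by blast
  show "\<exists>\<epsilon>\<in>{1, -1}. \<forall>u. br (u + omega ?P r) = \<epsilon> * e (eta ?P br r * (u + omega ?P r / 2)) * br u"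
    if r: "r \<in> {1..rho ?P}" for r
  proof (cases "r = 4")
    case False
    have "\<exists>h. \<exists>\<epsilon>\<in>{1, -1}. \<forall>u. br (u + omega ?P r) = \<epsilon> * e (h * (u + omega ?P r / 2)) * br u"
      by (rule quasi[OF omega_mem[OF r]]) blast
    from someI_ex[OF this] False show ?thesis by (simp only: eta.simps if_False)
  qed (simp add: omega.simps)
  show "\<exists>D. D \<noteq> 0 \<and> (\<forall>u. br (2 * u) = D * (\<Prod>s = 1..rho ?P. br (u - omega ?P s / 2)))"
    using duplication_formula by (simp) metis
  show "br ((omega ?P r - omega ?P s) / 2) \<noteq> 0" if "r \<in> {1..rho ?P}" "s \<in> {1..rho ?P}" "r \<noteq> s" for r s
    using omega_half_difference[OF that] by (simp add: zero_iff)
  show "rho ?P = 4 \<and> (\<Sum>s = 1..rho ?P. omega ?P s) = 0" for r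
    by (simp add: eval_nat_numeral omega.simps)
qed

end

theorem ruijsenaars_bracketI:
  assumes "valid_periods P" "is_bracket P br"
  shows "ruijsenaars_bracket P br"
proof (cases P)
  case Rational
  then show ?thesis using bracket_rational assms by simp
next
  case (Trigonometric w1)
  then show ?thesis using bracket_trigonometric assms by simp
next
  case (Elliptic w1 w2)
  then interpret elliptic_bracket w1 w2 br
    by unfold_locales (use assms in simp_all)
  show ?thesis unfolding Elliptic by (rule bracket_elliptic)
qed

section \<open>The partial fraction identity\<close>

context odd_bracket
begin

text \<open>Up to the common factor given by the derivative of the bracket at 0, the sum of the residues of
  \<open>g z / \<Prod>\<^sub>i [z - a\<^sub>i]\<close> at the poles \<open>a\<^sub>i\<close>.\<close>

definition residue_sum :: "'i set \<Rightarrow> ('i \<Rightarrow> complex) \<Rightarrow> (complex \<Rightarrow> complex) \<Rightarrow> complex" where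
  "residue_sum I a g = (\<Sum>k\<in>I. g (a k) / (\<Prod>i\<in>I - {k}. br (a k - a i)))"

definition poles_distinct :: "'i set \<Rightarrow> ('i \<Rightarrow> complex) \<Rightarrow> bool" where
  "poles_distinct I a \<longleftrightarrow> (\<forall>i\<in>I. \<forall>j\<in>I. i \<noteq> j \<longrightarrow> br (a i - a j) \<noteq> 0)"

text \<open>For fixed \<open>S\<close> the functions \<open>w \<mapsto> [u - w] [u - S + w]\<close> lie in a space of dimension two; this is the
  expansion of one of them in terms of those for \<open>u = p\<close> and \<open>u = q\<close>.\<close>

lemma three_term_quadratic:
  "br (u - w) * br (u - S + w) * (br (p + q - S) * br (p - q)) =
     br (u - q) * br (u - S + q) * (br (p - w) * br (p - S + w))
     - br (u - p) * br (u - S + p) * (br (q - w) * br (q - S + w))"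
proof -
  have s: "(u - S / 2) + (w - S / 2) = u - S + w" "(u - S / 2) - (w - S / 2) = u - w" for u w :: complex
    by (simp_all add: field_simps)
  from three_term[of "u - S / 2" "w - S / 2" "p - S / 2" "q - S / 2"]
  have "br (u - S + w) * br (u - w) * (br (p - S + q) * br (p - q))
     + br (u - S + p) * br (u - p) * (br (q - S + w) * br (q - w))
     + br (u - S + q) * br (u - q) * (br (w - S + p) * br (w - p)) = 0"
    unfolding s .
  moreover have "br (w - p) = - br (p - w)" "w - S + p = p - S + w" "p - S + q = p + q - S"
    by (rule br_commute) simp_all
  ultimately show ?thesis by (simp add: mult_ac eq_neg_iff_add_eq_0 algebra_simps)
qed

text \<open>Let two of the zeros, with sum \<open>S\<close>, move to \<open>w\<close> and \<open>S - w\<close>, and let \<open>F w\<close> be the resulting sum.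
  When \<open>w\<close> is one of the poles \<open>a\<^sub>p\<close>, the factor of this zero cancels the pole, and \<open>F (a\<^sub>p)\<close> is the
  sum for one pole fewer, which vanishes by induction. By \<open>three_term_quadratic\<close>, \<open>F w\<close> is a
  combination of \<open>F (a\<^sub>p)\<close> and \<open>F (a\<^sub>q)\<close> divided by \<open>[a\<^sub>p + a\<^sub>q - S] [a\<^sub>p - a\<^sub>q]\<close>. Among three poles there
  are two for which this divisor does not vanish. With one or two poles there is no such choice,
  and the identity is immediate.\<close>

theorem residue_sum_eq_0:
  fixes a :: "'i \<Rightarrow> complex" and b :: "'j \<Rightarrow> complex"
  assumes "finite I" "finite J" "card I = card J" "I \<noteq> {}" "(\<Sum>i\<in>I. a i) = (\<Sum>j\<in>J. b j)"
    and "poles_distinct I a"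
  shows "residue_sum I a (\<lambda>z. \<Prod>j\<in>J. br (z - b j)) = 0"
  using assms
proof (induction "card I" arbitrary: I J b rule: less_induct)
  case less
  note fin = less.prems(1,2) and card = less.prems(3) and sum = less.prems(5)
  have distinct: "br (a i - a j) \<noteq> 0" if "i \<in> I" "j \<in> I" "i \<noteq> j" for i j
    using less.prems(6) that by (simp add: poles_distinct_def)
  have "card I \<noteq> 0" using less.prems(1,4) by (simp only: card_eq_0_iff) simp
  then consider "card I = 1" | "card I = 2" | "card I \<ge> 3" by linarith
  then show ?case
  proof cases
    case 1
    then obtain k j where "I = {k}" "J = {j}" using card by (metis card_1_singletonE)
    then show ?thesis using sum by (simp add: residue_sum_def)
  next
    case 2
    then obtain p q where I: "I = {p, q}" "p \<noteq> q" by (meson card_2_iff)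
    from 2 card obtain c d where J: "J = {c, d}" "c \<noteq> d" by (metis card_2_iff)
    have s: "a p - b d = b c - a q" "a q - b d = b c - a p"
      using sum I J by (auto simp: algebra_simps)
    have Iq: "{p, q} - {p} = {q}" "{p, q} - {q} = {p}" using I by auto
    have "residue_sum I a (\<lambda>z. \<Prod>j\<in>J. br (z - b j)) =
       br (a p - b c) * br (b c - a q) / br (a p - a q) + br (a q - b c) * br (b c - a p) / br (a q - a p)"
      unfolding residue_sum_def I(1) J(1) using I(2) J(2) by (simp add: Iq s)
    also have "\<dots> = 0"
      using br_commute[of "a q" "a p"] br_commute[of "a q" "b c"] br_commute[of "b c" "a p"]
      by (simp add: mult.commute)
    finally show ?thesis .
  next
    case 3
    obtain j1 j2 J' where J: "J = insert j1 (insert j2 J')" "j1 \<noteq> j2" "j1 \<notin> J'" "j2 \<notin> J'"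
    proof -
      have "card J \<ge> 3" using 3 card by simp
      then obtain j1 where j1: "j1 \<in> J" by fastforce
      have "card (J - {j1}) \<ge> 2" using j1 \<open>card J \<ge> 3\<close> fin by simp
      then have "J - {j1} \<noteq> {}" by (metis card.empty not_numeral_le_zero)
      then obtain j2 where j2: "j2 \<in> J - {j1}" by blast
      show ?thesis using j1 j2 by (intro that[of j1 j2 "J - {j1} - {j2}"]) auto
    qed
    have finJ': "finite J'" using fin J by simp
    define S where "S = b j1 + b j2"
    define C where "C k = (\<Prod>j\<in>J'. br (a k - b j)) / (\<Prod>i\<in>I - {k}. br (a k - a i))" for k
    define F where "F w = (\<Sum>k\<in>I. C k * (br (a k - w) * br (a k - S + w)))" for w
    have F0: "F (a p) = 0" if p: "p \<in> I" for p
    proof -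
      let ?b = "b(j2 := S - a p)"
      have "residue_sum (I - {p}) a (\<lambda>z. \<Prod>j\<in>insert j2 J'. br (z - ?b j)) = 0"
      proof (rule less.hyps)
        have cJ: "card J = Suc (Suc (card J'))" using J finJ' by simp
        have cI: "card (I - {p}) = card I - 1" using p fin by simp
        show "card (I - {p}) < card I" unfolding cI using 3 by linarith
        show "card (I - {p}) = card (insert j2 J')"
          unfolding cI card cJ using J(4) finJ' by simp
        show "I - {p} \<noteq> {}"
        proof
          assume "I - {p} = {}"
          then have "card (I - {p}) = 0" by (simp only: card.empty)
          then show False using cI 3 by linarith
        qed
        have "(\<Sum>i\<in>I - {p}. a i) = (\<Sum>j\<in>J. b j) - a p"
          using p fin sum by (simp add: sum_diff1)
        also have "\<dots> = S - a p + (\<Sum>j\<in>J'. b j)" using J finJ' by (simp add: S_def)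
        also have "(\<Sum>j\<in>J'. b j) = (\<Sum>j\<in>J'. ?b j)" using J by (intro sum.cong) auto
        finally show "(\<Sum>i\<in>I - {p}. a i) = (\<Sum>j\<in>insert j2 J'. ?b j)" using J finJ' by simp
      qed (use fin finJ' distinct in \<open>auto simp: poles_distinct_def\<close>)
      moreover have "residue_sum (I - {p}) a (\<lambda>z. \<Prod>j\<in>insert j2 J'. br (z - ?b j)) = F (a p)"
      proof -
        have "F (a p) = (\<Sum>k\<in>I - {p}. C k * (br (a k - a p) * br (a k - S + a p)))"
          unfolding F_def using p fin by (subst sum.remove[of I p]) auto
        also have "\<dots> = residue_sum (I - {p}) a (\<lambda>z. \<Prod>j\<in>insert j2 J'. br (z - ?b j))"
          unfolding residue_sum_def
        proof (rule sum.cong)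
          fix k assume k: "k \<in> I - {p}"
          have "(\<Prod>j\<in>insert j2 J'. br (a k - ?b j)) = br (a k - S + a p) * (\<Prod>j\<in>J'. br (a k - ?b j))"
            using J finJ' by (simp add: algebra_simps)
          also have "(\<Prod>j\<in>J'. br (a k - ?b j)) = (\<Prod>j\<in>J'. br (a k - b j))"
            using J by (intro prod.cong) auto
          finally have 1: "(\<Prod>j\<in>insert j2 J'. br (a k - ?b j)) = br (a k - S + a p) * (\<Prod>j\<in>J'. br (a k - b j))" .
          have 2: "(\<Prod>i\<in>I - {k}. br (a k - a i)) = br (a k - a p) * (\<Prod>i\<in>I - {p} - {k}. br (a k - a i))"
            using k p fin by (subst prod.remove[of "I - {k}" p]) (auto simp: Diff_insert2[symmetric] insert_commute)
          have "br (a k - a p) \<noteq> 0" using distinct k p by auto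
          then show "C k * (br (a k - a p) * br (a k - S + a p)) =
              (\<Prod>j\<in>insert j2 J'. br (a k - ?b j)) / (\<Prod>i\<in>I - {p} - {k}. br (a k - a i))"
            unfolding 1 C_def 2 by simp
        qed simp
        finally show ?thesis ..
      qed
      ultimately show ?thesis by simp
    qed
    obtain p q where pq: "p \<in> I" "q \<in> I" "p \<noteq> q" "br (a p + a q - S) \<noteq> 0"
    proof -
      obtain T where T: "T \<subseteq> I" "card T = 3" using 3 by (metis obtain_subset_with_card_n)
      then obtain p q r where pqr: "T = {p, q, r}" "p \<noteq> q" "q \<noteq> r" "p \<noteq> r" by (auto simp: card_3_iff)
      show ?thesis
      proof (cases "br (a p + a q - S) = 0")
        case True
        have "br (a p + a r - S) \<noteq> 0"
        proof
          assume "br (a p + a r - S) = 0"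
          from br_zero_diff[OF True this] have "br (a q - a r) = 0" by simp
          then show False using distinct[of q r] pqr T by auto
        qed
        then show ?thesis using pqr T that[of p r] by auto
      qed (use pqr T that[of p q] in auto)
    qed
    let ?N = "br (a p + a q - S) * br (a p - a q)"
    \<comment> \<open>This is the three-term relation, summed over the poles.\<close>
    have "F w * ?N = F (a q) * (br (a p - w) * br (a p - S + w)) - F (a p) * (br (a q - w) * br (a q - S + w))" for w
      unfolding F_def sum_distrib_right sum_subtractf[symmetric]
    proof (rule sum.cong)
      fix k assume "k \<in> I"
      have "C k * (br (a k - w) * br (a k - S + w)) * ?N = C k * (br (a k - w) * br (a k - S + w) * ?N)"
        by (simp only: mult.assoc)
      then show "C k * (br (a k - w) * br (a k - S + w)) * ?N =
         C k * (br (a k - a q) * br (a k - S + a q)) * (br (a p - w) * br (a p - S + w))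
         - C k * (br (a k - a p) * br (a k - S + a p)) * (br (a q - w) * br (a q - S + w))"
        unfolding three_term_quadratic[of "a k" w S "a p" "a q"] by (simp only: right_diff_distrib mult.assoc)
    qed simp
    moreover have "?N \<noteq> 0" using pq distinct by auto
    ultimately have "F w = 0" for w using F0[OF pq(1)] F0[OF pq(2)] by simp
    moreover have "residue_sum I a (\<lambda>z. \<Prod>j\<in>J. br (z - b j)) = F (b j1)"
      unfolding residue_sum_def F_def C_def using J finJ' by (simp add: S_def mult_ac)
    ultimately show ?thesis by simp
  qed
qed

lemma residue_sum_Plus:
  assumes "finite A" "finite B"
  shows "residue_sum (A <+> B) (case_sum a b) g =
     residue_sum A a (\<lambda>z. g z / (\<Prod>i\<in>B. br (z - b i))) + residue_sum B b (\<lambda>z. g z / (\<Prod>i\<in>A. br (z - a i)))"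
proof -
  have 1: "(A <+> B) - {Inl k} = (A - {k}) <+> B" for k by auto
  have 2: "(A <+> B) - {Inr k} = A <+> (B - {k})" for k by auto
  show ?thesis
    unfolding residue_sum_def using assms
    by (simp add: sum.Plus prod.Plus 1 2 mult.commute)
qed

text \<open>Reflecting the poles changes the sign of each of the \<open>card I - 1\<close> factors of every denominator.\<close>

lemma residue_sum_reflect:
  assumes "finite I"
  shows "residue_sum I (\<lambda>i. c - a i) g = (-1) ^ (card I - 1) * residue_sum I a (\<lambda>z. g (c - z))"
  unfolding residue_sum_def sum_distrib_left
proof (rule sum.cong)
  fix k assume k: "k \<in> I"
  have "(\<Prod>i\<in>I - {k}. br ((c - a k) - (c - a i))) = (\<Prod>i\<in>I - {k}. (-1) * br (a k - a i))"
  proof (rule prod.cong)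
    fix i show "br ((c - a k) - (c - a i)) = (-1) * br (a k - a i)"
      using br_commute[of "a i" "a k"] by simp
  qed simp
  also have "\<dots> = (-1) ^ (card I - 1) * (\<Prod>i\<in>I - {k}. br (a k - a i))"
    using k assms by (simp only: prod.distrib prod_constant card_Diff_singleton)
  finally show "g (c - a k) / (\<Prod>i\<in>I - {k}. br ((c - a k) - (c - a i))) =
     (-1) ^ (card I - 1) * (g (c - a k) / (\<Prod>i\<in>I - {k}. br (a k - a i)))"
    by (cases "even (card I - 1)") simp_all
qed simp

end

section \<open>The coefficients of the operators as residues\<close>

context ruijsenaars_bracket
begin

abbreviation half_period_prod :: "complex \<Rightarrow> complex \<Rightarrow> complex" where
  "half_period_prod a z \<equiv> \<Prod>s = 1..rho P. br (z + (a - omega P s) / 2)"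

abbreviation parameter_prod :: "(nat \<Rightarrow> complex) \<Rightarrow> complex \<Rightarrow> complex" where
  "parameter_prod \<mu> z \<equiv> \<Prod>s = 1..2 * rho P. br (z + \<mu> s)"

abbreviation pair_prod :: "nat \<Rightarrow> (nat \<Rightarrow> complex) \<Rightarrow> complex \<Rightarrow> complex \<Rightarrow> complex" where
  "pair_prod N x a z \<equiv> \<Prod>j = 1..N. br (z + x j + a) * br (z - x j + a)"

text \<open>The left-hand side collects the factors contributed to the residue at \<open>z\<close> by the pole \<open>- z\<close>, by the
  zero \<open>- z - \<kappa>\<close> and by the half periods shifted by \<open>\<kappa>\<close>.\<close>

lemma duplication_ratio:
  assumes "half_period_prod \<kappa> z \<noteq> 0"
  shows "br (2 * z + \<kappa>) / (br (2 * z) * half_period_prod \<kappa> z) =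
     1 / (\<Prod>s = 1..rho P. br (z - omega P s / 2))"
proof -
  obtain D where D: "D \<noteq> 0" "\<And>u. br (2 * u) = D * (\<Prod>s = 1..rho P. br (u - omega P s / 2))"
    using duplication by blast
  have "br (2 * z + \<kappa>) = br (2 * (z + \<kappa> / 2))" by (simp add: algebra_simps)
  also have "\<dots> = D * half_period_prod \<kappa> z"
    unfolding D(2) by (simp add: diff_divide_distrib add_diff_eq)
  finally show ?thesis using assms D(1) unfolding D(2)[of z] by simp
qed

text \<open>The residue at \<open>x\<^sub>i\<close>, where the other poles are \<open>- x\<^sub>i\<close>, all \<open>\<plusminus>x\<^sub>j\<close> and the points \<open>h\<^sub>s\<close>, which
  stand for shifted half periods. The factor \<open>Q\<close> carries the half periods belonging to the other
  operator, and \<open>Y\<close> is the factor by which the shift acts on the kernel function. Besides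
  the quotients \<open>[x\<^sub>i \<plusminus> x\<^sub>j + \<kappa>] / [x\<^sub>i \<plusminus> x\<^sub>j]\<close> there remain the factor \<open>[\<kappa>]\<close> from the zero \<open>x\<^sub>i - \<kappa>\<close>
  and a factor to which \<open>duplication_ratio\<close> applies.\<close>

lemma A_plus_as_residue:
  fixes x h :: "nat \<Rightarrow> complex"
  assumes i: "i \<in> {1..m}"
    and nz: "half_period_prod \<kappa> (x i) \<noteq> 0"
    and QH: "Q (x i) * (\<Prod>s = 1..rho P. br (x i - h s)) =
      half_period_prod \<kappa> (x i) * half_period_prod \<delta> (x i)"
  shows "parameter_prod \<mu> (x i) * pair_prod m x \<kappa> (x i) * Y (x i) / Q (x i)
      / ((\<Prod>j\<in>{1..m} - {i}. br (x i - x j)) * ((\<Prod>j = 1..m. br (x i + x j)) * (\<Prod>s = 1..rho P. br (x i - h s))))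
     = br \<kappa> * (A_plus P br m \<mu> \<delta> \<kappa> i x * Y (x i))"
proof -
  let ?M = "parameter_prod \<mu> (x i)"
  let ?K = "half_period_prod \<kappa> (x i)"
  let ?D = "half_period_prod \<delta> (x i)"
  let ?O = "\<Prod>s = 1..rho P. br (x i - omega P s / 2)"
  let ?H = "\<Prod>s = 1..rho P. br (x i - h s)"
  let ?n = "\<Prod>j\<in>{1..m} - {i}. br (x i + x j + \<kappa>) * br (x i - x j + \<kappa>)"
  let ?p = "\<Prod>j\<in>{1..m} - {i}. br (x i + x j)"
  let ?q = "\<Prod>j\<in>{1..m} - {i}. br (x i - x j)"
  have num: "pair_prod m x \<kappa> (x i) = br (2 * x i + \<kappa>) * br \<kappa> * ?n"
    using i by (subst prod.remove[of _ i]) auto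
  have den: "(\<Prod>j = 1..m. br (x i + x j)) = br (2 * x i) * ?p"
    using i by (subst prod.remove[of _ i]) auto
  have A: "A_plus P br m \<mu> \<delta> \<kappa> i x = ?M / (?O * ?D) * (?n / (?p * ?q))"
    unfolding A_plus_def by (simp only: prod_dividef prod.distrib)
  have dup: "br (2 * x i + \<kappa>) / (br (2 * x i) * ?K) = 1 / ?O"
    by (rule duplication_ratio[OF nz])
  have "?M * (br (2 * x i + \<kappa>) * br \<kappa> * ?n) * Y (x i) / Q (x i) / (?q * (br (2 * x i) * ?p * ?H))
     = br \<kappa> * ?M * ?n * Y (x i) / (?q * ?p) * (br (2 * x i + \<kappa>) / (br (2 * x i) * (Q (x i) * ?H)))"
    by (simp add: divide_inverse mult_ac)
  also have "br (2 * x i + \<kappa>) / (br (2 * x i) * (Q (x i) * ?H)) = 1 / (?O * ?D)"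
  proof -
    have "br (2 * x i + \<kappa>) / (br (2 * x i) * (Q (x i) * ?H)) = br (2 * x i + \<kappa>) / (br (2 * x i) * ?K) / ?D"
      unfolding QH by (simp only: divide_divide_eq_left mult.assoc)
    then show ?thesis unfolding dup by (simp only: divide_divide_eq_left)
  qed
  also have "br \<kappa> * ?M * ?n * Y (x i) / (?q * ?p) * (1 / (?O * ?D)) = br \<kappa> * (?M / (?O * ?D) * (?n / (?p * ?q)) * Y (x i))"
  proof -
    have "k * M * n * y / (q * p) * (1 / D) = k * (M / D * (n / (p * q)) * y)" for k M n y q p D :: complex
      by (simp add: mult_ac)
    then show ?thesis .
  qed
  finally show ?thesis unfolding num den A .
qed

text \<open>The poles belonging to one operator in \<open>m\<close> variables: the points \<open>x\<^sub>j\<close>, their negatives, and one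
  point \<open>h\<^sub>s\<close> for every period \<open>\<omega>\<^sub>s\<close>.\<close>

definition block_index :: "nat \<Rightarrow> (nat + nat + nat) set" where
  "block_index m = {1..m} <+> {1..m} <+> {1..rho P}"

definition block_poles :: "(nat \<Rightarrow> complex) \<Rightarrow> (nat \<Rightarrow> complex) \<Rightarrow> nat + nat + nat \<Rightarrow> complex" where
  "block_poles x h = case_sum x (case_sum (\<lambda>j. - x j) h)"

lemma finite_block_index [simp]: "finite (block_index m)"
  by (simp add: block_index_def)

lemma card_block_index: "card (block_index m) = 2 * m + rho P"
  by (simp add: block_index_def card_Plus)

lemma prod_block: "(\<Prod>i\<in>block_index m. f (block_poles x h i)) =
   (\<Prod>j = 1..m. f (x j) * f (- x j)) * (\<Prod>s = 1..rho P. f (h s))"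
  by (simp add: block_index_def block_poles_def prod.Plus prod.distrib mult_ac)

lemma sum_block: "(\<Sum>i\<in>block_index m. block_poles x h i) = (\<Sum>s = 1..rho P. h s)"
  by (simp add: block_index_def block_poles_def sum.Plus sum_negf)

text \<open>The residues at \<open>\<plusminus>x\<^sub>i\<close> are the coefficients of the shifts. Those at the points \<open>h\<^sub>r\<close> are left as they
  are, because they become the coefficients of order zero in two different ways.\<close>

lemma block_residue_sum:
  fixes x h \<mu> :: "nat \<Rightarrow> complex" and Q Y :: "complex \<Rightarrow> complex"
  assumes nz: "\<And>i. i \<in> {1..m} \<Longrightarrow> (half_period_prod \<kappa> (x i)) \<noteq> 0"
      "\<And>i. i \<in> {1..m} \<Longrightarrow> (half_period_prod \<kappa> (- x i)) \<noteq> 0"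
    and QH: "\<And>z. Q z * (\<Prod>s = 1..rho P. br (z - h s)) =
      half_period_prod \<kappa> z * half_period_prod \<delta> z"
  defines "g \<equiv> \<lambda>z. parameter_prod \<mu> z * pair_prod m x \<kappa> z * Y z / Q z"
  shows "residue_sum (block_index m) (block_poles x h) g =
     br \<kappa> * ((\<Sum>i = 1..m. A_plus P br m \<mu> \<delta> \<kappa> i x * Y (x i)) + (\<Sum>i = 1..m. A_minus P br m \<mu> \<delta> \<kappa> i x * Y (- x i)))
     + (\<Sum>r = 1..rho P. g (h r) / ((\<Prod>j = 1..m. br (h r + x j) * br (h r - x j)) * (\<Prod>s\<in>{1..rho P} - {r}. br (h r - h s))))"
proof -
  let ?H = "\<lambda>z. \<Prod>s = 1..rho P. br (z - h s)"
  have "residue_sum (block_index m) (block_poles x h) g =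
     (\<Sum>i = 1..m. g (x i) / ((\<Prod>j\<in>{1..m} - {i}. br (x i - x j)) * ((\<Prod>j = 1..m. br (x i + x j)) * ?H (x i))))
   + (\<Sum>i = 1..m. g (- x i) / ((\<Prod>j\<in>{1..m} - {i}. br (- x i - (- x j))) * ((\<Prod>j = 1..m. br (- x i + - x j)) * ?H (- x i))))
   + (\<Sum>r = 1..rho P. g (h r) / ((\<Prod>j = 1..m. br (h r + x j) * br (h r - x j)) * (\<Prod>s\<in>{1..rho P} - {r}. br (h r - h s))))"
    unfolding block_index_def block_poles_def
    by (simp add: residue_sum_Plus prod.Plus) (simp add: residue_sum_def prod.distrib divide_divide_eq_left mult_ac)
  also have "(\<Sum>i = 1..m. g (x i) / ((\<Prod>j\<in>{1..m} - {i}. br (x i - x j)) * ((\<Prod>j = 1..m. br (x i + x j)) * ?H (x i))))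
     = br \<kappa> * (\<Sum>i = 1..m. A_plus P br m \<mu> \<delta> \<kappa> i x * Y (x i))"
    unfolding sum_distrib_left g_def
    by (intro sum.cong A_plus_as_residue QH nz) auto
  also have "(\<Sum>i = 1..m. g (- x i) / ((\<Prod>j\<in>{1..m} - {i}. br (- x i - (- x j))) * ((\<Prod>j = 1..m. br (- x i + - x j)) * ?H (- x i))))
     = br \<kappa> * (\<Sum>i = 1..m. A_minus P br m \<mu> \<delta> \<kappa> i x * Y (- x i))"
  proof -
    have g: "g z = parameter_prod \<mu> z * (\<Prod>j = 1..m. br (z + - x j + \<kappa>) * br (z - - x j + \<kappa>)) * Y z / Q z" for z
      unfolding g_def by (simp add: mult.commute)
    show ?thesis
      unfolding sum_distrib_left g A_minus_def
      by (intro sum.cong A_plus_as_residue[where x = "\<lambda>j. - x j"] QH nz) auto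
  qed
  finally show ?thesis by (simp add: distrib_left)
qed

end

section \<open>Evaluation at half periods\<close>

lemma e_sum: "e (sum f A) = (\<Prod>i\<in>A. e (f i))"
  by (simp add: e_def exp_sum sum_distrib_left) (cases "finite A"; simp add: exp_sum)

lemma e_minus_cancel [simp]: "e (- a) * e a = 1" "e a * e (- a) = 1"
  by (simp_all add: e_add[symmetric])

lemma e_power: "e a ^ n = e (of_nat n * a)"
  by (induction n) (simp_all add: e_add[symmetric] algebra_simps)

context ruijsenaars_bracket
begin

lemma quasi_half:
  assumes "r \<in> {1..rho P}"
  obtains \<epsilon> where "\<epsilon> * \<epsilon> = 1" "\<And>v. br (omega P r / 2 + v) = \<epsilon> * e (eta P br r * v) * br (v - omega P r / 2)"
proof -
  obtain \<epsilon> where q: "\<epsilon> \<in> {1, -1}" "\<And>u. br (u + omega P r) = \<epsilon> * e (eta P br r * (u + omega P r / 2)) * br u"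
    using quasi_periodic[OF assms] by blast
  have "br (omega P r / 2 + v) = \<epsilon> * e (eta P br r * v) * br (v - omega P r / 2)" for v
    using q(2)[of "v - omega P r / 2"] by (simp add: add.commute)
  moreover have "\<epsilon> * \<epsilon> = 1" using q(1) by auto
  ultimately show ?thesis using that by blast
qed

text \<open>Quasi-periodicity relates the bracket at \<open>\<omega>\<^sub>r / 2 + v\<close> and at \<open>v - \<omega>\<^sub>r / 2\<close>, and the bracket is odd. In the
  product over \<open>\<plusminus>y\<close> the signs cancel and the exponent no longer depends on \<open>y\<close>.\<close>

lemma half_period_pair:
  assumes "r \<in> {1..rho P}"
  shows "br (omega P r / 2 + y - a) * br (omega P r / 2 - y - a) =
    e (- (2 * a * eta P br r)) * (br (omega P r / 2 + y + a) * br (omega P r / 2 - y + a))"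
proof -
  let ?w = "omega P r / 2" and ?h = "eta P br r"
  obtain \<epsilon> where \<epsilon>: "\<epsilon> * \<epsilon> = 1" "\<And>v. br (?w + v) = \<epsilon> * e (?h * v) * br (v - ?w)"
    using quasi_half[OF assms] by blast
  have 1: "br (?w + y - a) = \<epsilon> * e (?h * (y - a)) * - br (?w - y + a)"
    using \<epsilon>(2)[of "y - a"] br_commute[of "y - a" ?w] by (simp add: algebra_simps)
  have 2: "br (?w - y - a) = \<epsilon> * e (?h * (- y - a)) * - br (?w + y + a)"
    using \<epsilon>(2)[of "- y - a"] br_commute[of "- y - a" ?w] by (simp add: algebra_simps)
  have "br (?w + y - a) * br (?w - y - a) = (\<epsilon> * \<epsilon>) * (e (?h * (y - a)) * e (?h * (- y - a))) * (br (?w + y + a) * br (?w - y + a))"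
    unfolding 1 2 by simp
  also have "e (?h * (y - a)) * e (?h * (- y - a)) = e (- (2 * a * ?h))"
    unfolding e_add[symmetric] by (rule arg_cong[of _ _ e]) (simp add: algebra_simps)
  finally show ?thesis using \<epsilon>(1) by simp
qed

text \<open>Both sides are multiples of \<open>[2 u]\<close> by the duplication formula.\<close>

lemma prod_half_periods_reflect:
  "(\<Prod>s = 1..rho P. br (u + omega P s / 2)) = (-1) ^ (rho P + 1) * (\<Prod>s = 1..rho P. br (u - omega P s / 2))"
proof -
  obtain D where D: "D \<noteq> 0" "\<And>u. br (2 * u) = D * (\<Prod>s = 1..rho P. br (u - omega P s / 2))"
    using duplication by blast
  have "D * (\<Prod>s = 1..rho P. br (u + omega P s / 2)) = D * (\<Prod>s = 1..rho P. - br (- u - omega P s / 2))"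
  proof -
    have "br (u + omega P s / 2) = - br (- u - omega P s / 2)" for s
      using br_minus[of "u + omega P s / 2"] by simp
    then show ?thesis by simp
  qed
  also have "\<dots> = (-1) ^ rho P * br (2 * - u)"
    unfolding D(2) by (simp add: prod_uminus)
  also have "br (2 * - u) = - (D * (\<Prod>s = 1..rho P. br (u - omega P s / 2)))"
    using br_minus[of "2 * u"] D(2)[of u] by simp
  finally have "D * (\<Prod>s = 1..rho P. br (u + omega P s / 2)) =
      D * ((-1) ^ (rho P + 1) * (\<Prod>s = 1..rho P. br (u - omega P s / 2)))"
    by (simp add: mult_ac)
  then show ?thesis using D(1) by (simp only: mult_cancel_left) simp
qed

text \<open>The residue at \<open>(\<omega>\<^sub>r - \<delta>) / 2\<close>, provided that the factor \<open>Y\<close> of the kernel function is the exponential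
  in the definition of \<open>A_zero\<close>.\<close>

lemma A_zero_as_residue:
  assumes r: "r \<in> {1..rho P}" and \<kappa>: "br \<kappa> \<noteq> 0"
    and Y: "Y ((omega P r - \<delta>) / 2) = e (- (of_nat N * \<kappa> + c_const P \<mu> \<delta> \<kappa> / 2) * eta P br r)"
  defines "h \<equiv> \<lambda>s. (omega P s - \<delta>) / 2"
  shows "parameter_prod \<mu> (h r) * pair_prod N x \<kappa> (h r) * Y (h r)
       / half_period_prod \<kappa> (h r)
     / ((\<Prod>j = 1..N. br (h r + x j) * br (h r - x j)) * (\<Prod>s\<in>{1..rho P} - {r}. br (h r - h s)))
     = br \<kappa> * A_zero P br N \<mu> \<delta> \<kappa> r x"
proof -
  have 1: "br (h r + (\<kappa> - omega P s) / 2) = br ((omega P r - omega P s + \<kappa> - \<delta>) / 2)" for s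
    by (rule arg_cong[of _ _ br]) (simp add: h_def field_simps)
  have 2: "br (h r - h s) = br ((omega P r - omega P s) / 2)" for s
    by (rule arg_cong[of _ _ br]) (simp add: h_def field_simps)
  have alg: "M * p * E / D1 / (q * D2) = k * (E * M / (k * D2 * D1) * (p / q))" if "k \<noteq> 0" for M p E D1 q D2 k :: complex
    using that by (simp add: mult_ac)
  have hr: "h r = (omega P r - \<delta>) / 2" by (simp add: h_def)
  show ?thesis
    unfolding A_zero_def 1 2 unfolding hr Y prod_dividef by (rule alg[OF \<kappa>])
qed

text \<open>In the first part of the theorem the poles belonging to \<open>y\<close> are reflected by
  \<open>z \<mapsto> - (\<delta> + \<kappa>) / 2 - z\<close>, which takes \<open>(\<omega>\<^sub>s - \<kappa>) / 2\<close> to \<open>- (\<omega>\<^sub>s + \<delta>) / 2\<close>. This differs by the period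
  \<open>\<omega>\<^sub>s\<close> from the half-period argument \<open>k = (\<omega>\<^sub>s - \<delta>) / 2\<close> at which \<open>A_zero\<close> is evaluated. Moving every
  factor of the residue by this period produces exponentials; by the balancing condition their product
  is the one in \<open>A_zero\<close>.\<close>

lemma A_zero_dual_as_residue:
  fixes \<nu> :: "nat \<Rightarrow> complex"
  assumes r: "r \<in> {1..rho P}" and \<kappa>: "br \<kappa> \<noteq> 0"
    and Y: "Y (- (omega P r + \<delta>) / 2) = e (of_nat m * \<kappa> * eta P br r)"
    and balance: "2 * (of_nat m - of_nat n) * \<kappa> = (\<Sum>s = 1..2 * rho P. \<nu> s) - of_nat (rho P) * (\<delta> + \<kappa>) / 2 - (\<Sum>s = 1..rho P. omega P s)"
  defines "h \<equiv> \<lambda>s. - (omega P s + \<delta>) / 2"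
  shows "parameter_prod \<nu> (h r) * pair_prod n y \<kappa> (h r) * Y (h r)
       / (\<Prod>s = 1..rho P. br (h r + (\<kappa> + omega P s) / 2))
     / ((\<Prod>j = 1..n. br (h r + y j) * br (h r - y j)) * (\<Prod>s\<in>{1..rho P} - {r}. br (h r - h s)))
     = br \<kappa> * A_zero P br n \<nu> \<delta> \<kappa> r y"
proof -
  let ?\<eta> = "eta P br r" and ?\<rho> = "rho P"
  define k where "k = (omega P r - \<delta>) / 2"
  obtain \<epsilon> where \<epsilon>: "\<epsilon> * \<epsilon> = 1" "\<And>v. br (omega P r / 2 + v) = \<epsilon> * e (?\<eta> * v) * br (v - omega P r / 2)"
    using quasi_half[OF r] by blast
  have shift: "br (h r + v) = \<epsilon> * e (- (?\<eta> * (v - \<delta> / 2))) * br (k + v)" for v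
  proof -
    have k: "k + v = omega P r / 2 + (v - \<delta> / 2)" and h: "h r + v = v - \<delta> / 2 - omega P r / 2"
      by (simp_all add: k_def h_def field_simps)
    have "\<epsilon> * e (- (?\<eta> * (v - \<delta> / 2))) * br (k + v) =
        (\<epsilon> * \<epsilon>) * (e (- (?\<eta> * (v - \<delta> / 2))) * e (?\<eta> * (v - \<delta> / 2))) * br (h r + v)"
      unfolding k \<epsilon>(2) h by (simp only: mult_ac)
    then show ?thesis using \<epsilon>(1) by simp
  qed
  have pair: "br (h r + v) * br (h r + w) = e (- (?\<eta> * (v + w - \<delta>))) * (br (k + v) * br (k + w))" for v w
  proof -
    have "br (h r + v) * br (h r + w) = (\<epsilon> * \<epsilon>) * (e (- (?\<eta> * (v - \<delta> / 2))) * e (- (?\<eta> * (w - \<delta> / 2)))) * (br (k + v) * br (k + w))"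
      unfolding shift by (simp only: mult_ac)
    also have "e (- (?\<eta> * (v - \<delta> / 2))) * e (- (?\<eta> * (w - \<delta> / 2))) = e (- (?\<eta> * (v + w - \<delta>)))"
      unfolding e_add[symmetric] by (rule arg_cong[of _ _ e]) (simp add: algebra_simps)
    finally show ?thesis using \<epsilon>(1) by simp
  qed
  have pm: "a + b + c = a + (b + c)" "a - b + c = a + (c - b)" "a - b = a + - b" for a b c :: complex
    by simp_all
  have M: "parameter_prod \<nu> (h r) = e (?\<eta> * (of_nat ?\<rho> * \<delta> - (\<Sum>s = 1..2 * ?\<rho>. \<nu> s))) * parameter_prod \<nu> k"
  proof -
    have "(\<Prod>s = 1..2 * ?\<rho>. \<epsilon>) = 1" using \<epsilon>(1) by (simp add: power_mult power2_eq_square)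
    moreover have "(\<Prod>s = 1..2 * ?\<rho>. e (- (?\<eta> * (\<nu> s - \<delta> / 2)))) = e (?\<eta> * (of_nat ?\<rho> * \<delta> - (\<Sum>s = 1..2 * ?\<rho>. \<nu> s)))"
      unfolding e_sum[symmetric]
    proof (rule arg_cong[of _ _ e])
      have "(\<Sum>s = 1..2 * ?\<rho>. - (?\<eta> * (\<nu> s - \<delta> / 2))) = - ?\<eta> * (\<Sum>s = 1..2 * ?\<rho>. \<nu> s - \<delta> / 2)"
        by (simp only: sum_distrib_left mult_minus_left)
      also have "(\<Sum>s = 1..2 * ?\<rho>. \<nu> s - \<delta> / 2) = (\<Sum>s = 1..2 * ?\<rho>. \<nu> s) - of_nat ?\<rho> * \<delta>"
        by (simp add: sum_subtractf)
      finally show "(\<Sum>s = 1..2 * ?\<rho>. - (?\<eta> * (\<nu> s - \<delta> / 2))) = ?\<eta> * (of_nat ?\<rho> * \<delta> - (\<Sum>s = 1..2 * ?\<rho>. \<nu> s))"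
        by (simp add: algebra_simps)
    qed
    ultimately show ?thesis unfolding shift prod.distrib by simp
  qed
  have N1: "pair_prod n y \<kappa> (h r) =
      e (- (?\<eta> * (2 * \<kappa> - \<delta>))) ^ n * pair_prod n y \<kappa> k"
  proof -
    have "br (h r + y j + \<kappa>) * br (h r - y j + \<kappa>) = e (- (?\<eta> * (2 * \<kappa> - \<delta>))) * (br (k + y j + \<kappa>) * br (k - y j + \<kappa>))" for j
      using pair[of "y j + \<kappa>" "\<kappa> - y j"] by (simp add: algebra_simps)
    then show ?thesis by (simp add: prod.distrib)
  qed
  have N2: "(\<Prod>j = 1..n. br (h r + y j) * br (h r - y j)) =
      e (?\<eta> * \<delta>) ^ n * (\<Prod>j = 1..n. br (k + y j) * br (k - y j))"
  proof -
    have "br (h r + y j) * br (h r - y j) = e (?\<eta> * \<delta>) * (br (k + y j) * br (k - y j))" for j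
      using pair[of "y j" "- y j"] by simp
    then show ?thesis by (simp add: prod.distrib)
  qed
  have Q: "(\<Prod>s = 1..?\<rho>. br (h r + (\<kappa> + omega P s) / 2)) =
      (-1) ^ (?\<rho> + 1) * (e (- (2 * ?\<eta> * (\<kappa> - \<delta>))) * half_period_prod \<kappa> k)"
  proof -
    obtain D where D: "D \<noteq> 0" "\<And>u. br (2 * u) = D * (\<Prod>s = 1..rho P. br (u - omega P s / 2))"
      using duplication by blast
    have "(\<Prod>s = 1..?\<rho>. br (h r + (\<kappa> + omega P s) / 2)) = (\<Prod>s = 1..?\<rho>. br ((h r + \<kappa> / 2) + omega P s / 2))"
      by (simp add: add_divide_distrib add.assoc)
    also have "\<dots> = (-1) ^ (?\<rho> + 1) * (\<Prod>s = 1..?\<rho>. br ((h r + \<kappa> / 2) - omega P s / 2))"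
      by (rule prod_half_periods_reflect)
    also have "(\<Prod>s = 1..?\<rho>. br ((h r + \<kappa> / 2) - omega P s / 2)) =
       e (- (2 * ?\<eta> * (\<kappa> - \<delta>))) * (\<Prod>s = 1..?\<rho>. br ((k + \<kappa> / 2) - omega P s / 2))"
    proof -
      have "2 * (k + \<kappa> / 2) = omega P r / 2 + (\<kappa> - \<delta> + omega P r / 2)"
        "2 * (h r + \<kappa> / 2) = (\<kappa> - \<delta> - omega P r / 2) - omega P r / 2"
        by (simp_all add: k_def h_def field_simps)
      note args = this
      have "br (2 * (k + \<kappa> / 2)) = \<epsilon> * e (?\<eta> * (\<kappa> - \<delta> + omega P r / 2)) * br (\<kappa> - \<delta> + omega P r / 2 - omega P r / 2)"
        unfolding args(1) by (rule \<epsilon>(2))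
      also have "\<kappa> - \<delta> + omega P r / 2 - omega P r / 2 = omega P r / 2 + (\<kappa> - \<delta> - omega P r / 2)"
        by simp
      also have "\<epsilon> * e (?\<eta> * (\<kappa> - \<delta> + omega P r / 2)) * br (omega P r / 2 + (\<kappa> - \<delta> - omega P r / 2)) = (\<epsilon> * \<epsilon>) * (e (?\<eta> * (\<kappa> - \<delta> + omega P r / 2)) * e (?\<eta> * (\<kappa> - \<delta> - omega P r / 2))) * br (2 * (h r + \<kappa> / 2))"
        unfolding \<epsilon>(2)[of "\<kappa> - \<delta> - omega P r / 2"] args(2) by (simp only: mult_ac)
      also have "e (?\<eta> * (\<kappa> - \<delta> + omega P r / 2)) * e (?\<eta> * (\<kappa> - \<delta> - omega P r / 2)) = e (2 * ?\<eta> * (\<kappa> - \<delta>))"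
        unfolding e_add[symmetric] by (rule arg_cong[of _ _ e]) (simp add: algebra_simps)
      finally have "br (2 * (k + \<kappa> / 2)) = e (2 * ?\<eta> * (\<kappa> - \<delta>)) * br (2 * (h r + \<kappa> / 2))"
        using \<epsilon>(1) by simp
      then have "e (- (2 * ?\<eta> * (\<kappa> - \<delta>))) * br (2 * (k + \<kappa> / 2)) = br (2 * (h r + \<kappa> / 2))"
        by (simp add: mult.assoc[symmetric])
      then show ?thesis unfolding D(2) using D(1) by (simp add: mult_ac)
    qed
    finally show ?thesis by (simp add: diff_divide_distrib add_diff_eq)
  qed
  have H: "(\<Prod>s\<in>{1..?\<rho>} - {r}. br (h r - h s)) = (-1) ^ (?\<rho> - 1) * (\<Prod>s\<in>{1..?\<rho>} - {r}. br (k - (omega P s - \<delta>) / 2))"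
  proof -
    have "br (h r - h s) = - br (k - (omega P s - \<delta>) / 2)" for s
    proof -
      have "h r - h s = - (k - (omega P s - \<delta>) / 2)" by (simp add: h_def k_def field_simps)
      then show ?thesis by (simp only: br_minus)
    qed
    then show ?thesis using r by (simp add: prod_uminus)
  qed
  \<comment> \<open>Only in the elliptic case can \<open>\<eta>\<^sub>r\<close> be nonzero, and then \<open>\<rho> = 4\<close> and the periods add up to zero; the equation of the exponents is the balancing condition.\<close>
  have expo: "e (?\<eta> * (of_nat ?\<rho> * \<delta> - (\<Sum>s = 1..2 * ?\<rho>. \<nu> s))) * e (- (?\<eta> * (2 * \<kappa> - \<delta>))) ^ n * e (of_nat m * \<kappa> * ?\<eta>) =
     e (- (of_nat n * \<kappa> + c_const P \<nu> \<delta> \<kappa> / 2) * ?\<eta>) * (e (?\<eta> * \<delta>) ^ n * e (- (2 * ?\<eta> * (\<kappa> - \<delta>))))"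
    unfolding e_power e_add[symmetric]
  proof (cases "?\<eta> = 0")
    case False
    from eta_nonzero[OF this] have w: "?\<rho> = 4" "(\<Sum>s = 1..?\<rho>. omega P s) = 0" by auto
    define N where "N = (\<Sum>s = 1..2 * ?\<rho>. \<nu> s)"
    have N: "N = 2 * (of_nat m - of_nat n) * \<kappa> + 2 * (\<delta> + \<kappa>)"
    proof -
      have "2 * (of_nat m - of_nat n) * \<kappa> = N - of_nat ?\<rho> * (\<delta> + \<kappa>) / 2 - 0"
        using balance unfolding w(2) N_def[symmetric] .
      moreover have "of_nat ?\<rho> * (\<delta> + \<kappa>) / 2 = 2 * (\<delta> + \<kappa>)" unfolding w(1) by (simp add: field_simps)
      ultimately have "2 * (of_nat m - of_nat n) * \<kappa> = N - 2 * (\<delta> + \<kappa>)" by simp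
      then show ?thesis by (simp only: eq_diff_eq)
    qed
    have c: "c_const P \<nu> \<delta> \<kappa> = N - 2 * (\<delta> + \<kappa>)"
      unfolding c_const_def w(2) N_def[symmetric] unfolding w(1) by simp
    show "e (?\<eta> * (of_nat ?\<rho> * \<delta> - (\<Sum>s = 1..2 * ?\<rho>. \<nu> s)) + of_nat n * - (?\<eta> * (2 * \<kappa> - \<delta>)) + of_nat m * \<kappa> * ?\<eta>) =
        e (- (of_nat n * \<kappa> + c_const P \<nu> \<delta> \<kappa> / 2) * ?\<eta> + (of_nat n * (?\<eta> * \<delta>) + - (2 * ?\<eta> * (\<kappa> - \<delta>))))"
      unfolding c N_def[symmetric] unfolding N w(1) by (rule arg_cong[of _ _ e]) (simp add: field_simps)
  qed simp
  define Y0 where "Y0 = (\<lambda>_::complex. e (- (of_nat n * \<kappa> + c_const P \<nu> \<delta> \<kappa> / 2) * ?\<eta>))"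
  have main: "parameter_prod \<nu> k * pair_prod n y \<kappa> k * Y0 k
       / half_period_prod \<kappa> k
     / ((\<Prod>j = 1..n. br (k + y j) * br (k - y j)) * (\<Prod>s\<in>{1..?\<rho>} - {r}. br (k - (omega P s - \<delta>) / 2)))
     = br \<kappa> * A_zero P br n \<nu> \<delta> \<kappa> r y"
    unfolding k_def by (rule A_zero_as_residue[OF r \<kappa>]) (simp add: Y0_def)
  have alg: "(E1 * M) * (E2 * p) * E3 / (s1 * (E5 * Q)) / ((E4 * q) * (s2 * H)) = M * p * E / Q / (q * H)"
    if "E1 * E2 * E3 = E * (E4 * E5)" "E4 \<noteq> 0" "E5 \<noteq> 0" "s1 * s2 = 1" for E1 E2 E3 E4 E5 E M p q Q H s1 s2 :: complex
  proof -
    have "(E1 * M) * (E2 * p) * E3 / (s1 * (E5 * Q)) / ((E4 * q) * (s2 * H)) =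
       (E1 * E2 * E3) * (M * p) / ((s1 * s2) * (E4 * E5) * (Q * (q * H)))"
      by (simp add: mult_ac)
    also have "\<dots> = M * p * E / Q / (q * H)"
      unfolding that(1,4) using that(2,3) by (simp add: mult_ac)
    finally show ?thesis .
  qed
  have sgn: "(-1) ^ (?\<rho> + 1) * (-1) ^ (?\<rho> - 1) = (1 :: complex)"
  proof -
    have "?\<rho> + 1 + (?\<rho> - 1) = 2 * ?\<rho>" using r by simp
    then show ?thesis by (simp only: power_add[symmetric]) (simp add: power_mult)
  qed
  have Yr: "Y (h r) = e (of_nat m * \<kappa> * ?\<eta>)" using Y by (simp add: h_def)
  show ?thesis
    unfolding M N1 N2 Q H Yr main[symmetric] Y0_def
    by (rule alg[OF expo _ _ sgn]) (simp_all add: e_power)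
qed

end

section \<open>The identities at generic points\<close>

context ruijsenaars_bracket
begin

text \<open>The result of applying the operator to a function and dividing by that function, when the shifts
  of \<open>x\<^sub>i\<close> by \<open>\<plusminus>\<delta>\<close> multiply the function by \<open>Y (\<plusminus>x\<^sub>i)\<close>.\<close>

definition E_sum :: "nat \<Rightarrow> (nat \<Rightarrow> complex) \<Rightarrow> complex \<Rightarrow> complex \<Rightarrow> (complex \<Rightarrow> complex) \<Rightarrow> (nat \<Rightarrow> complex) \<Rightarrow> complex" where
  "E_sum N \<mu> \<delta> \<kappa> Y x =
     (\<Sum>i = 1..N. A_plus P br N \<mu> \<delta> \<kappa> i x * Y (x i)) + (\<Sum>i = 1..N. A_minus P br N \<mu> \<delta> \<kappa> i x * Y (- x i))
     + (\<Sum>r = 1..rho P. A_zero P br N \<mu> \<delta> \<kappa> r x)"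

lemma E_op_eq_E_sum:
  assumes "\<And>i. i \<in> {1..N} \<Longrightarrow> F (x(i := x i + \<delta>)) = Y (x i) * F x"
    and "\<And>i. i \<in> {1..N} \<Longrightarrow> F (x(i := x i - \<delta>)) = Y (- x i) * F x"
  shows "E_op P br N \<mu> \<delta> \<kappa> F x = E_sum N \<mu> \<delta> \<kappa> Y x * F x"
  unfolding E_op_def E_sum_def by (simp add: assms sum_distrib_right distrib_right mult.assoc)

definition ratio :: "nat \<Rightarrow> (nat \<Rightarrow> complex) \<Rightarrow> complex \<Rightarrow> complex \<Rightarrow> complex \<Rightarrow> complex" where
  "ratio n y a b z = (\<Prod>l = 1..n. (br (z + y l + a) * br (z - y l + a)) / (br (z + y l + b) * br (z - y l + b)))"

lemma residue_sum_eq_E_sum: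
  assumes \<kappa>: "br \<kappa> \<noteq> 0"
    and nz: "\<And>i s. i \<in> {1..N} \<Longrightarrow> s \<in> {1..rho P} \<Longrightarrow> br (x i + (\<kappa> - omega P s) / 2) \<noteq> 0 \<and> br (- x i + (\<kappa> - omega P s) / 2) \<noteq> 0"
    and Y: "\<And>r. r \<in> {1..rho P} \<Longrightarrow> Y ((omega P r - \<delta>) / 2) = e (- (of_nat N * \<kappa> + c_const P \<mu> \<delta> \<kappa> / 2) * eta P br r)"
  shows "residue_sum (block_index N) (block_poles x (\<lambda>s. (omega P s - \<delta>) / 2))
      (\<lambda>z. parameter_prod \<mu> z * pair_prod N x \<kappa> z * Y z
        / half_period_prod \<kappa> z)
    = br \<kappa> * E_sum N \<mu> \<delta> \<kappa> Y x"
proof (subst block_residue_sum[where \<delta> = \<delta>])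
  show "half_period_prod \<kappa> z * (\<Prod>s = 1..rho P. br (z - (omega P s - \<delta>) / 2)) =
      half_period_prod \<kappa> z * half_period_prod \<delta> z" for z
    by (simp add: diff_divide_distrib algebra_simps)
  show "half_period_prod \<kappa> (x i) \<noteq> 0" "half_period_prod \<kappa> (- x i) \<noteq> 0"
    if "i \<in> {1..N}" for i
    using nz[OF that] by auto
qed (simp only: E_sum_def distrib_left sum_distrib_left, intro arg_cong2[of _ _ _ _ plus] sum.cong refl A_zero_as_residue \<kappa> Y)

text \<open>The counterpart of \<open>residue_sum_eq_E_sum\<close> for the reflected poles, at which the periods \<open>\<omega>\<^sub>s\<close> occur
  with the opposite sign.\<close>

lemma residue_sum_eq_E_sum_dual:
  assumes \<kappa>: "br \<kappa> \<noteq> 0"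
    and nz: "\<And>i s. i \<in> {1..n} \<Longrightarrow> s \<in> {1..rho P} \<Longrightarrow> br (y i + (\<kappa> + omega P s) / 2) \<noteq> 0 \<and> br (- y i + (\<kappa> + omega P s) / 2) \<noteq> 0"
    and Y: "\<And>r. r \<in> {1..rho P} \<Longrightarrow> Y (- (omega P r + \<delta>) / 2) = e (of_nat m * \<kappa> * eta P br r)"
    and balance: "2 * (of_nat m - of_nat n) * \<kappa> = (\<Sum>s = 1..2 * rho P. \<nu> s) - of_nat (rho P) * (\<delta> + \<kappa>) / 2 - (\<Sum>s = 1..rho P. omega P s)"
  shows "residue_sum (block_index n) (block_poles y (\<lambda>s. - (omega P s + \<delta>) / 2))
      (\<lambda>z. parameter_prod \<nu> z * pair_prod n y \<kappa> z * Y z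
        / (\<Prod>s = 1..rho P. br (z + (\<kappa> + omega P s) / 2)))
    = br \<kappa> * E_sum n \<nu> \<delta> \<kappa> Y y"
proof (subst block_residue_sum[where \<delta> = \<delta>])
  have refl: "(\<Prod>s = 1..rho P. br (z + (a + omega P s) / 2)) = (-1) ^ (rho P + 1) * half_period_prod a z" for z a
    using prod_half_periods_reflect[of "z + a / 2"] by (simp add: add_divide_distrib diff_divide_distrib algebra_simps)
  show "(\<Prod>s = 1..rho P. br (z + (\<kappa> + omega P s) / 2)) * (\<Prod>s = 1..rho P. br (z - (- (omega P s + \<delta>) / 2))) =
      half_period_prod \<kappa> z * half_period_prod \<delta> z" for z
  proof -
    have neg: "z - (- (omega P s + \<delta>) / 2) = z + (\<delta> + omega P s) / 2" for s by (simp add: field_simps)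
    show ?thesis unfolding neg refl by (cases "even (rho P)") simp_all
  qed
  show "half_period_prod \<kappa> (y i) \<noteq> 0" if "i \<in> {1..n}" for i
  proof -
    have "(\<Prod>s = 1..rho P. br (y i + (\<kappa> + omega P s) / 2)) \<noteq> 0" using nz[OF that] by auto
    then show ?thesis unfolding refl by simp
  qed
  show "half_period_prod \<kappa> (- y i) \<noteq> 0" if "i \<in> {1..n}" for i
  proof -
    have "(\<Prod>s = 1..rho P. br (- y i + (\<kappa> + omega P s) / 2)) \<noteq> 0" using nz[OF that] by auto
    then show ?thesis unfolding refl by simp
  qed
qed (simp only: E_sum_def distrib_left sum_distrib_left, intro arg_cong2[of _ _ _ _ plus] sum.cong refl A_zero_dual_as_residue[where m = m] \<kappa> Y balance)

lemma block_index_mem: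
  "Inl i \<in> block_index n \<longleftrightarrow> i \<in> {1..n}" "Inr (Inl i) \<in> block_index n \<longleftrightarrow> i \<in> {1..n}"
  "Inr (Inr s) \<in> block_index n \<longleftrightarrow> s \<in> {1..rho P}"
  by (auto simp: block_index_def)

lemma block_poles_simps:
  "block_poles x h (Inl i) = x i" "block_poles x h (Inr (Inl i)) = - x i" "block_poles x h (Inr (Inr s)) = h s"
  by (simp_all add: block_poles_def)

lemma poles_distinctD:
  assumes "poles_distinct (block_index m <+> B) (case_sum (block_poles x h) b)" "j \<in> B"
  shows "i \<in> {1..m} \<Longrightarrow> br (x i - b j) \<noteq> 0" "i \<in> {1..m} \<Longrightarrow> br (- x i - b j) \<noteq> 0"
    "r \<in> {1..rho P} \<Longrightarrow> br (h r - b j) \<noteq> 0"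
proof -
  have "br (block_poles x h i - b j) \<noteq> 0" if "i \<in> block_index m" for i
    using assms that unfolding poles_distinct_def by (metis InlI InrI old.sum.simps(5,6) sum.distinct(1))
  from this[of "Inl i"] this[of "Inr (Inl i)"] this[of "Inr (Inr r)"]
  show "i \<in> {1..m} \<Longrightarrow> br (x i - b j) \<noteq> 0" "i \<in> {1..m} \<Longrightarrow> br (- x i - b j) \<noteq> 0"
    "r \<in> {1..rho P} \<Longrightarrow> br (h r - b j) \<noteq> 0"
    by (simp_all only: block_index_mem block_poles_simps not_False_eq_True simp_thms)
qed

lemma balance_halved: "2 * a + 2 * b + c = 0 \<Longrightarrow> - (a + c / 2) = (b :: complex)"
proof -
  assume "2 * a + 2 * b + c = 0"
  then have "c = - (2 * a) - 2 * b" by algebra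
  then show ?thesis by (simp add: diff_divide_distrib)
qed

text \<open>The offsets \<open>a\<close> and \<open>b\<close> are symmetric about the point that takes \<open>h\<close> to a half period, so
  \<open>half_period_pair\<close> applies to every factor.\<close>

lemma ratio_at_half_period:
  assumes r: "r \<in> {1..rho P}"
    and h: "h + a = omega P r / 2 + d" "h + b = omega P r / 2 - d"
    and nz: "\<And>l. l \<in> {1..n} \<Longrightarrow> br (h + y l + b) \<noteq> 0 \<and> br (h - y l + b) \<noteq> 0"
  shows "ratio n y a b h = e (of_nat n * (2 * d * eta P br r))"
proof -
  have "(br (h + y l + a) * br (h - y l + a)) / (br (h + y l + b) * br (h - y l + b)) = e (2 * d * eta P br r)"
    if l: "l \<in> {1..n}" for l
  proof -
    have s: "h + y l + a = omega P r / 2 + y l + d" "h - y l + a = omega P r / 2 - y l + d"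
      "h + y l + b = omega P r / 2 + y l - d" "h - y l + b = omega P r / 2 - y l - d"
      using h by (simp_all add: algebra_simps)
    have "br (h + y l + a) * br (h - y l + a) = e (2 * d * eta P br r) * (br (h + y l + b) * br (h - y l + b))"
      unfolding s half_period_pair[OF r] by (simp flip: mult.assoc)
    then show ?thesis using nz[OF l] by simp
  qed
  then show ?thesis by (simp add: ratio_def e_power)
qed

lemma rho_pos: "rho P > 0"
  by (cases P) auto

text \<open>The partial fraction identity for one block of poles belonging to \<open>x\<close> and a second block \<open>p\<close>; the
  hypothesis on the sums is what becomes of the balancing condition. The zeros are \<open>- \<mu>\<^sub>s\<close>,
  \<open>\<plusminus>x\<^sub>j - \<kappa>\<close> and \<open>\<plusminus>y\<^sub>l - d\<close>.\<close>

lemma two_block_residue_sum: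
  fixes \<mu> x y :: "nat \<Rightarrow> complex"
  assumes distinct: "poles_distinct (block_index m <+> block_index n) (case_sum (block_poles x h) p)"
    and sum: "(\<Sum>s = 1..rho P. h s) + (\<Sum>i\<in>block_index n. p i) = - (\<Sum>s = 1..2 * rho P. \<mu> s) - 2 * of_nat m * \<kappa> - 2 * of_nat n * d"
  defines "f \<equiv> \<lambda>z. parameter_prod \<mu> z * pair_prod m x \<kappa> z
      * pair_prod n y d z"
  shows "residue_sum (block_index m) (block_poles x h) (\<lambda>z. f z / (\<Prod>i\<in>block_index n. br (z - p i)))
    + residue_sum (block_index n) p (\<lambda>z. f z / (\<Prod>i\<in>block_index m. br (z - block_poles x h i))) = 0"
proof -
  let ?J = "{1..2 * rho P} <+> ({1..m} <+> {1..m}) <+> ({1..n} <+> {1..n})"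
  let ?b = "case_sum (\<lambda>s. - \<mu> s) (case_sum (case_sum (\<lambda>j. - x j - \<kappa>) (\<lambda>j. x j - \<kappa>)) (case_sum (\<lambda>l. - y l - d) (\<lambda>l. y l - d)))"
  have f: "f = (\<lambda>z. \<Prod>j\<in>?J. br (z - ?b j))"
    by (rule ext) (simp add: f_def prod.Plus prod.distrib algebra_simps)
  have "residue_sum (block_index m <+> block_index n) (case_sum (block_poles x h) p) f = 0"
    unfolding f
  proof (rule residue_sum_eq_0)
    show "card (block_index m <+> block_index n) = card ?J"
      by (simp add: card_Plus card_block_index)
    have "card (block_index m) \<noteq> 0" using rho_pos by (simp add: card_block_index)
    then show "block_index m <+> block_index n \<noteq> {}" by (auto simp: Plus_def)
    show "(\<Sum>i\<in>block_index m <+> block_index n. case_sum (block_poles x h) p i) = (\<Sum>j\<in>?J. ?b j)"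
      using sum by (simp add: sum.Plus sum_block sum_subtractf sum_negf)
  qed (use distinct in auto)
  then show ?thesis by (simp add: residue_sum_Plus)
qed

lemma poles_distinct_swap:
  assumes "poles_distinct (A <+> B) (case_sum a b)"
  shows "poles_distinct (B <+> A) (case_sum b a)"
proof -
  have "br (case_sum b a i - case_sum b a j) \<noteq> 0" if "i \<in> B <+> A" "j \<in> B <+> A" "i \<noteq> j" for i j
    using assms[unfolded poles_distinct_def, rule_format, of "case_sum Inr Inl i" "case_sum Inr Inl j"] that
    by (auto simp: Plus_def image_iff) blast+
  then show ?thesis by (simp add: poles_distinct_def)
qed

text \<open>The other block \<open>p\<close> consists of half periods and of the poles \<open>\<plusminus>y\<^sub>l - b\<close>. Together with the zeros
  \<open>\<plusminus>y\<^sub>l - a\<close> the latter make up the factor by which the shifts act on the kernel function.\<close>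

lemma residue_sum_eq_E_sum_ratio:
  assumes \<kappa>: "br \<kappa> \<noteq> 0" and B: "finite B"
    and distinct: "poles_distinct (block_index N <+> B) (case_sum (block_poles x (\<lambda>s. (omega P s - \<delta>) / 2)) p)"
    and den: "\<And>z. (\<Prod>i\<in>B. br (z - p i)) = pair_prod n y b z * half_period_prod \<kappa> z"
    and offsets: "a = \<delta> / 2 + d" "b = \<delta> / 2 - d"
    and balance: "- (of_nat N * \<kappa> + c_const P \<mu> \<delta> \<kappa> / 2) = of_nat n * (2 * d)"
  shows "residue_sum (block_index N) (block_poles x (\<lambda>s. (omega P s - \<delta>) / 2))
      (\<lambda>z. parameter_prod \<mu> z * pair_prod N x \<kappa> z
        * pair_prod n y a z / (\<Prod>i\<in>B. br (z - p i)))
    = br \<kappa> * E_sum N \<mu> \<delta> \<kappa> (ratio n y a b) x"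
proof -
  let ?h = "\<lambda>s. (omega P s - \<delta>) / 2"
  note cross = poles_distinctD[OF distinct]
  have nz: "pair_prod n y b z \<noteq> 0" "half_period_prod \<kappa> z \<noteq> 0"
    if "\<And>i. i \<in> B \<Longrightarrow> br (z - p i) \<noteq> 0" for z
  proof -
    have "(\<Prod>i\<in>B. br (z - p i)) \<noteq> 0" using that B by (simp add: prod_zero_iff)
    then show "pair_prod n y b z \<noteq> 0" "half_period_prod \<kappa> z \<noteq> 0"
      unfolding den by auto
  qed
  have Y: "ratio n y a b (?h r) = e (- (of_nat N * \<kappa> + c_const P \<mu> \<delta> \<kappa> / 2) * eta P br r)" if r: "r \<in> {1..rho P}" for r
  proof -
    have "ratio n y a b (?h r) = e (of_nat n * (2 * d * eta P br r))"
    proof (rule ratio_at_half_period[OF r])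
      show "br (?h r + y l + b) \<noteq> 0 \<and> br (?h r - y l + b) \<noteq> 0" if "l \<in> {1..n}" for l
        using nz(1)[of "?h r", OF cross(3)[OF _ r]] that by (simp add: prod_zero_iff)
    qed (simp_all add: offsets diff_divide_distrib)
    then show ?thesis unfolding balance by (simp add: mult.assoc)
  qed
  have x: "br (x i + (\<kappa> - omega P s) / 2) \<noteq> 0 \<and> br (- x i + (\<kappa> - omega P s) / 2) \<noteq> 0" if "i \<in> {1..N}" "s \<in> {1..rho P}" for i s
  proof -
    have "half_period_prod \<kappa> (x i) \<noteq> 0" "half_period_prod \<kappa> (- x i) \<noteq> 0"
      using nz(2)[of "x i", OF cross(1)[OF _ that(1)]] nz(2)[of "- x i", OF cross(2)[OF _ that(1)]] by blast+
    then show ?thesis using that(2) by (simp only: prod_zero_iff[OF finite_atLeastAtMost]) blast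
  qed
  have "(\<lambda>z. parameter_prod \<mu> z * pair_prod N x \<kappa> z
        * pair_prod n y a z / (\<Prod>i\<in>B. br (z - p i))) =
      (\<lambda>z. parameter_prod \<mu> z * pair_prod N x \<kappa> z * ratio n y a b z
        / half_period_prod \<kappa> z)"
    unfolding den ratio_def prod_dividef by simp
  then show ?thesis using residue_sum_eq_E_sum[where Y = "ratio n y a b", OF \<kappa> x Y] by simp
qed

text \<open>The configuration is symmetric under exchanging \<open>(x, \<delta>)\<close> and \<open>(y, \<kappa>)\<close>, so
  \<open>residue_sum_eq_E_sum_ratio\<close> applies to both blocks. The factor for the first block is
  \<open>ratio n y \<delta> 0\<close>, the effect of a shift by \<open>\<delta>\<close> on \<open>\<Prod> [x\<^sub>j \<plusminus> y\<^sub>l]\<close>.\<close>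

theorem dual_cauchy_generic:
  assumes \<delta>: "br \<delta> \<noteq> 0" and \<kappa>: "br \<kappa> \<noteq> 0"
    and balance: "2 * of_nat m * \<kappa> + 2 * of_nat n * \<delta> + c_const P \<mu> \<delta> \<kappa> = 0"
    and distinct: "poles_distinct (block_index m <+> block_index n)
      (case_sum (block_poles x (\<lambda>s. (omega P s - \<delta>) / 2)) (block_poles y (\<lambda>s. (omega P s - \<kappa>) / 2)))"
  shows "br \<kappa> * E_sum m \<mu> \<delta> \<kappa> (ratio n y \<delta> 0) x + br \<delta> * E_sum n \<mu> \<kappa> \<delta> (ratio m x \<kappa> 0) y = 0"
proof -
  let ?hx = "\<lambda>s. (omega P s - \<delta>) / 2" and ?hy = "\<lambda>s. (omega P s - \<kappa>) / 2"
  let ?px = "block_poles x ?hx" and ?py = "block_poles y ?hy"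
  define f where "f z = parameter_prod \<mu> z * pair_prod m x \<kappa> z
      * pair_prod n y \<delta> z" for z
  have "(\<Sum>s = 1..rho P. ?hx s) + (\<Sum>i\<in>block_index n. ?py i) = (\<Sum>s = 1..rho P. ?hx s) + (\<Sum>s = 1..rho P. ?hy s)"
    by (simp only: sum_block)
  also have "\<dots> = (\<Sum>s = 1..rho P. omega P s) - of_nat (rho P) / 2 * (\<delta> + \<kappa>)"
  proof -
    have "?hx s + ?hy s = omega P s - (\<delta> + \<kappa>) / 2" for s by (simp add: field_simps)
    then show ?thesis unfolding sum.distrib[symmetric] by (simp add: sum_subtractf)
  qed
  also have "\<dots> = - (\<Sum>s = 1..2 * rho P. \<mu> s) - 2 * of_nat m * \<kappa> - 2 * of_nat n * \<delta>"
    using balance by (simp add: c_const_def algebra_simps eq_neg_iff_add_eq_0)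
  finally have "(\<Sum>s = 1..rho P. ?hx s) + (\<Sum>i\<in>block_index n. ?py i) = - (\<Sum>s = 1..2 * rho P. \<mu> s) - 2 * of_nat m * \<kappa> - 2 * of_nat n * \<delta>" .
  note two_block_residue_sum[where y = y, OF distinct this, folded f_def]
  moreover have "residue_sum (block_index m) ?px (\<lambda>z. f z / (\<Prod>i\<in>block_index n. br (z - ?py i))) = br \<kappa> * E_sum m \<mu> \<delta> \<kappa> (ratio n y \<delta> 0) x"
    unfolding f_def
  proof (rule residue_sum_eq_E_sum_ratio[OF \<kappa> finite_block_index distinct, where d = "\<delta> / 2"])
    have s: "z - ?hy s = z + (\<kappa> - omega P s) / 2" for z s by (simp add: field_simps)
    show "(\<Prod>i\<in>block_index n. br (z - ?py i)) = pair_prod n y 0 z * half_period_prod \<kappa> z" for z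
      unfolding prod_block[of "\<lambda>w. br (z - w)"] s by (simp add: mult.commute)
    show "- (of_nat m * \<kappa> + c_const P \<mu> \<delta> \<kappa> / 2) = of_nat n * (2 * (\<delta> / 2))"
      by (rule balance_halved) (use balance in \<open>simp add: mult.assoc\<close>)
  qed simp_all
  moreover have "residue_sum (block_index n) ?py (\<lambda>z. f z / (\<Prod>i\<in>block_index m. br (z - ?px i))) = br \<delta> * E_sum n \<mu> \<kappa> \<delta> (ratio m x \<kappa> 0) y"
    \<comment> \<open>The factors are reordered so that those with \<open>y\<close> precede those with \<open>x\<close>.\<close>
    unfolding f_def mult.assoc mult.commute[of "pair_prod m x \<kappa> _"] unfolding mult.assoc[symmetric]
  proof (rule residue_sum_eq_E_sum_ratio[OF \<delta> finite_block_index poles_distinct_swap[OF distinct], where d = "\<kappa> / 2"])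
    have s: "z - ?hx s = z + (\<delta> - omega P s) / 2" for z s by (simp add: field_simps)
    show "(\<Prod>i\<in>block_index m. br (z - ?px i)) = pair_prod m x 0 z * half_period_prod \<delta> z" for z
      unfolding prod_block[of "\<lambda>w. br (z - w)"] s by (simp add: mult.commute)
    show "- (of_nat n * \<delta> + c_const P \<mu> \<kappa> \<delta> / 2) = of_nat m * (2 * (\<kappa> / 2))"
      by (rule balance_halved) (use balance in \<open>simp add: c_const_def algebra_simps\<close>)
  qed simp_all
  ultimately show ?thesis by simp
qed

text \<open>The same scheme with the poles of the second block reflected by \<open>z \<mapsto> - (\<delta> + \<kappa>) / 2 - z\<close>. The
  reflection takes \<open>- \<mu>\<^sub>s\<close> to \<open>- \<nu>\<^sub>s\<close>, and it takes the zeros and poles of the first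
  block to those of the factor \<open>ratio m x\<close>. Its total sign is \<open>- 1\<close>, so the two blocks are equal
  instead of opposite.\<close>

theorem cauchy_generic:
  fixes \<mu> \<nu> :: "nat \<Rightarrow> complex"
  assumes \<kappa>: "br \<kappa> \<noteq> 0"
    and balance: "2 * (of_nat m - of_nat n) * \<kappa> + c_const P \<mu> \<delta> \<kappa> = 0"
    and \<nu>: "\<And>s. s \<in> {1..2 * rho P} \<Longrightarrow> \<nu> s = (\<delta> + \<kappa>) / 2 - \<mu> s"
    and distinct: "poles_distinct (block_index m <+> block_index n)
      (case_sum (block_poles x (\<lambda>s. (omega P s - \<delta>) / 2)) (\<lambda>i. - (\<delta> + \<kappa>) / 2 - block_poles y (\<lambda>s. - (omega P s + \<delta>) / 2) i))"
  shows "E_sum m \<mu> \<delta> \<kappa> (ratio n y ((\<delta> - \<kappa>) / 2) ((\<delta> + \<kappa>) / 2)) x = E_sum n \<nu> \<delta> \<kappa> (ratio m x ((\<delta> - \<kappa>) / 2) ((\<delta> + \<kappa>) / 2)) y"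
proof -
  let ?c = "- (\<delta> + \<kappa>) / 2" and ?p = "(\<delta> + \<kappa>) / 2" and ?m = "(\<delta> - \<kappa>) / 2"
  let ?hx = "\<lambda>s. (omega P s - \<delta>) / 2" and ?hy = "\<lambda>s. - (omega P s + \<delta>) / 2"
  let ?px = "block_poles x ?hx" and ?qy = "block_poles y ?hy" and ?py = "\<lambda>i. ?c - block_poles y ?hy i"
  define f where "f z = parameter_prod \<mu> z * pair_prod m x \<kappa> z
      * pair_prod n y ?m z" for z
  note cross = poles_distinctD[OF distinct]
  have "(\<Sum>s = 1..rho P. ?hx s) + (\<Sum>i\<in>block_index n. ?py i) =
      (\<Sum>s = 1..rho P. ?hx s) + (of_nat (2 * n + rho P) * ?c - (\<Sum>s = 1..rho P. ?hy s))"
    by (simp add: sum_subtractf sum_block card_block_index)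
  also have "\<dots> = (\<Sum>s = 1..rho P. omega P s) + of_nat (2 * n + rho P) * ?c"
  proof -
    have "?hx s - ?hy s = omega P s" for s by (simp add: field_simps)
    then have "(\<Sum>s = 1..rho P. ?hx s) - (\<Sum>s = 1..rho P. ?hy s) = (\<Sum>s = 1..rho P. omega P s)"
      unfolding sum_subtractf[symmetric] by simp
    then show ?thesis by (simp add: algebra_simps)
  qed
  also have "\<dots> = - (\<Sum>s = 1..2 * rho P. \<mu> s) - 2 * of_nat m * \<kappa> - 2 * of_nat n * ?m"
  proof -
    have "W = R - M - B" if "B + (M - R + W) = 0" for B M R W :: complex
      using that by algebra
    note W = this[OF balance[unfolded c_const_def]]
    show ?thesis unfolding W by (simp add: field_simps)
  qed
  finally have "(\<Sum>s = 1..rho P. ?hx s) + (\<Sum>i\<in>block_index n. ?py i) = - (\<Sum>s = 1..2 * rho P. \<mu> s) - 2 * of_nat m * \<kappa> - 2 * of_nat n * ?m" .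
  note two_block_residue_sum[where y = y, OF distinct this, folded f_def]
  moreover have "residue_sum (block_index m) ?px (\<lambda>z. f z / (\<Prod>i\<in>block_index n. br (z - ?py i))) = br \<kappa> * E_sum m \<mu> \<delta> \<kappa> (ratio n y ?m ?p) x"
    unfolding f_def
  proof (rule residue_sum_eq_E_sum_ratio[OF \<kappa> finite_block_index distinct, where d = "- \<kappa> / 2"])
    have s: "z - (?c - ?hy s) = z + (\<kappa> - omega P s) / 2" "z - (?c - y l) = z + y l + ?p" "z - (?c - - y l) = z - y l + ?p" for z s l
      by (simp_all add: field_simps)
    show "(\<Prod>i\<in>block_index n. br (z - ?py i)) = pair_prod n y ?p z * half_period_prod \<kappa> z" for z
      unfolding prod_block[of "\<lambda>w. br (z - (?c - w))"] s by (simp add: mult.commute)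
    show "- (of_nat m * \<kappa> + c_const P \<mu> \<delta> \<kappa> / 2) = of_nat n * (2 * (- \<kappa> / 2))"
      by (rule balance_halved) (use balance in \<open>simp add: algebra_simps\<close>)
  qed (simp_all add: field_simps)
  moreover have "residue_sum (block_index n) ?py (\<lambda>z. f z / (\<Prod>i\<in>block_index m. br (z - ?px i))) = - (br \<kappa> * E_sum n \<nu> \<delta> \<kappa> (ratio m x ?m ?p) y)"
  proof -
    have neg: "br (?c - w + \<mu> s) = - br (w + \<nu> s)" if "s \<in> {1..2 * rho P}" for w s
    proof -
      have "?c - w + \<mu> s = - (w + \<nu> s)" using \<nu>[OF that] by (simp add: field_simps)
      then show ?thesis by (simp only: br_minus)
    qed
    have neg2: "br (?c - w + v + \<kappa>) = - br (w - v + ?m)" "br (?c - w - v + \<kappa>) = - br (w + v + ?m)"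
      "br (?c - w + v + ?m) = - br (w - v + \<kappa>)" "br (?c - w - v + ?m) = - br (w + v + \<kappa>)"
      "br (?c - w - v) = - br (w + v + ?p)" "br (?c - w - - v) = - br (w - v + ?p)" for w v
    proof -
      have "?c - w + v + \<kappa> = - (w - v + ?m)" "?c - w - v + \<kappa> = - (w + v + ?m)"
        "?c - w + v + ?m = - (w - v + \<kappa>)" "?c - w - v + ?m = - (w + v + \<kappa>)"
        "?c - w - v = - (w + v + ?p)" "?c - w - - v = - (w - v + ?p)" by (simp_all add: field_simps)
      then show "br (?c - w + v + \<kappa>) = - br (w - v + ?m)" "br (?c - w - v + \<kappa>) = - br (w + v + ?m)"
        "br (?c - w + v + ?m) = - br (w - v + \<kappa>)" "br (?c - w - v + ?m) = - br (w + v + \<kappa>)"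
        "br (?c - w - v) = - br (w + v + ?p)" "br (?c - w - - v) = - br (w - v + ?p)"
        by (simp_all only: br_minus)
    qed
    have neg3: "br (?c - w - ?hx s) = - br (w + (\<kappa> + omega P s) / 2)" for w s
    proof -
      have "?c - w - ?hx s = - (w + (\<kappa> + omega P s) / 2)" by (simp add: field_simps)
      then show ?thesis by (simp only: br_minus)
    qed
    have num: "f (?c - w) = parameter_prod \<nu> w * pair_prod n y \<kappa> w * pair_prod m x ?m w" for w
    proof -
      have "(\<Prod>s = 1..2 * rho P. br (?c - w + \<mu> s)) = (\<Prod>s = 1..2 * rho P. - br (w + \<nu> s))"
        by (intro prod.cong refl neg)
      also have "\<dots> = parameter_prod \<nu> w" by (simp add: prod_uminus power_mult)
      finally show ?thesis unfolding f_def neg2 by (simp add: mult_ac)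
    qed
    have den: "(\<Prod>i\<in>block_index m. br (?c - w - ?px i)) = (-1) ^ rho P * (pair_prod m x ?p w * (\<Prod>s = 1..rho P. br (w + (\<kappa> + omega P s) / 2)))" for w
      unfolding prod_block[of "\<lambda>v. br (?c - w - v)"] unfolding neg3 unfolding neg2 by (simp add: prod_uminus mult_ac)
    define g where "g w = parameter_prod \<nu> w * pair_prod n y \<kappa> w * ratio m x ?m ?p w
        / (\<Prod>s = 1..rho P. br (w + (\<kappa> + omega P s) / 2))" for w
    have fg: "f (?c - w) / (\<Prod>i\<in>block_index m. br (?c - w - ?px i)) = (-1) ^ rho P * g w" for w
      unfolding num den g_def ratio_def prod_dividef by (cases "even (rho P)") simp_all
    have "residue_sum (block_index n) ?py (\<lambda>z. f z / (\<Prod>i\<in>block_index m. br (z - ?px i))) =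
       (-1) ^ (2 * n + rho P - 1) * residue_sum (block_index n) ?qy (\<lambda>w. (-1) ^ rho P * g w)"
      unfolding residue_sum_reflect[OF finite_block_index] fg card_block_index ..
    also have "residue_sum (block_index n) ?qy (\<lambda>w. (-1) ^ rho P * g w) = (-1) ^ rho P * residue_sum (block_index n) ?qy g"
      by (simp add: residue_sum_def sum_distrib_left)
    also have "(-1) ^ (2 * n + rho P - 1) * ((-1) ^ rho P * residue_sum (block_index n) ?qy g) = - residue_sum (block_index n) ?qy g"
    proof -
      obtain k where k: "rho P = Suc k" using rho_pos by (metis Suc_pred')
      have "(-1) ^ (2 * n + rho P - 1) * (-1) ^ rho P = (- 1 :: complex)"
        unfolding k by (simp add: power_add power_mult)
      then show ?thesis by (simp flip: mult.assoc)
    qed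
    also have "residue_sum (block_index n) ?qy g = br \<kappa> * E_sum n \<nu> \<delta> \<kappa> (ratio m x ?m ?p) y"
      unfolding g_def
    proof (rule residue_sum_eq_E_sum_dual[OF \<kappa>, where m = m])
      show "br (y i + (\<kappa> + omega P s) / 2) \<noteq> 0 \<and> br (- y i + (\<kappa> + omega P s) / 2) \<noteq> 0" if "i \<in> {1..n}" "s \<in> {1..rho P}" for i s
      proof -
        have "br (?hx s - (?c - y i)) \<noteq> 0" "br (?hx s - (?c - - y i)) \<noteq> 0"
          using cross(3)[OF _ that(2), of "Inl i"] cross(3)[OF _ that(2), of "Inr (Inl i)"] that(1)
          by (simp_all only: block_index_mem block_poles_simps not_False_eq_True simp_thms)
        then show ?thesis
          using neg3[of "y i" s] neg3[of "- y i" s] br_commute[of "?hx s" "?c - y i"] br_commute[of "?hx s" "?c - - y i"] by auto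
      qed
      show "ratio m x ?m ?p (?hy r) = e (of_nat m * \<kappa> * eta P br r)" if r: "r \<in> {1..rho P}" for r
      proof -
        have r': "Inr (Inr r) \<in> block_index n" using r by (simp add: block_index_mem)
        have nz: "br (omega P r / 2 - x j - \<kappa> / 2) \<noteq> 0" "br (omega P r / 2 + x j - \<kappa> / 2) \<noteq> 0" if "j \<in> {1..m}" for j
        proof -
          have "x j - (?c - ?hy r) = - (omega P r / 2 - x j - \<kappa> / 2)" "- x j - (?c - ?hy r) = - (omega P r / 2 + x j - \<kappa> / 2)"
            by (simp_all add: field_simps)
          then show "br (omega P r / 2 - x j - \<kappa> / 2) \<noteq> 0" "br (omega P r / 2 + x j - \<kappa> / 2) \<noteq> 0"
            using cross(1,2)[OF r' that] unfolding block_poles_simps by (simp_all only: br_minus neg_equal_0_iff_equal not_False_eq_True)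
        qed
        have "(br (?hy r + x j + ?m) * br (?hy r - x j + ?m)) / (br (?hy r + x j + ?p) * br (?hy r - x j + ?p)) = e (\<kappa> * eta P br r)"
          if j: "j \<in> {1..m}" for j
        proof -
          have "?hy r + x j + ?m = - (omega P r / 2 - x j + \<kappa> / 2)" "?hy r - x j + ?m = - (omega P r / 2 + x j + \<kappa> / 2)"
            "?hy r + x j + ?p = - (omega P r / 2 - x j - \<kappa> / 2)" "?hy r - x j + ?p = - (omega P r / 2 + x j - \<kappa> / 2)"
            by (simp_all add: field_simps)
          note eqs = this
          have pair: "br (omega P r / 2 + x j - \<kappa> / 2) * br (omega P r / 2 - x j - \<kappa> / 2) =
             e (- (\<kappa> * eta P br r)) * (br (omega P r / 2 + x j + \<kappa> / 2) * br (omega P r / 2 - x j + \<kappa> / 2))"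
            using half_period_pair[OF r, of "x j" "\<kappa> / 2"] by simp
          have "e (\<kappa> * eta P br r) * (br (omega P r / 2 + x j - \<kappa> / 2) * br (omega P r / 2 - x j - \<kappa> / 2)) =
             br (omega P r / 2 + x j + \<kappa> / 2) * br (omega P r / 2 - x j + \<kappa> / 2)"
            unfolding pair by (simp flip: mult.assoc)
          then show ?thesis unfolding eqs br_minus using nz[OF j] by (simp add: divide_eq_eq mult_ac)
        qed
        then have "ratio m x ?m ?p (?hy r) = (\<Prod>j = 1..m. e (\<kappa> * eta P br r))"
          unfolding ratio_def by (intro prod.cong refl)
        then show ?thesis by (simp add: e_power mult.assoc)
      qed
      have "(\<Sum>s = 1..2 * rho P. \<nu> s) = (\<Sum>s = 1..2 * rho P. (\<delta> + \<kappa>) / 2 - \<mu> s)"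
        by (intro sum.cong refl \<nu>)
      also have "\<dots> = of_nat (rho P) * (\<delta> + \<kappa>) - (\<Sum>s = 1..2 * rho P. \<mu> s)"
        by (simp add: sum_subtractf)
      finally have N: "(\<Sum>s = 1..2 * rho P. \<nu> s) = of_nat (rho P) * (\<delta> + \<kappa>) - (\<Sum>s = 1..2 * rho P. \<mu> s)" .
      have "2 * (of_nat m - of_nat n) * \<kappa> = - c_const P \<mu> \<delta> \<kappa>" using balance by (simp add: eq_neg_iff_add_eq_0)
      also have "\<dots> = of_nat (rho P) * (\<delta> + \<kappa>) - (\<Sum>s = 1..2 * rho P. \<mu> s) - of_nat (rho P) * (\<delta> + \<kappa>) / 2 - (\<Sum>s = 1..rho P. omega P s)"
        by (simp add: c_const_def field_simps)
      finally show "2 * (of_nat m - of_nat n) * \<kappa> = (\<Sum>s = 1..2 * rho P. \<nu> s) - of_nat (rho P) * (\<delta> + \<kappa>) / 2 - (\<Sum>s = 1..rho P. omega P s)"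
        unfolding N .
    qed
    finally show ?thesis .
  qed
  ultimately have "br \<kappa> * E_sum m \<mu> \<delta> \<kappa> (ratio n y ?m ?p) x = br \<kappa> * E_sum n \<nu> \<delta> \<kappa> (ratio m x ?m ?p) y" by simp
  then show ?thesis using \<kappa> by simp
qed

end

section \<open>Approaching a point through generic points\<close>

lemma of_nat_eq_minus_of_nat [simp]:
  "(of_nat a = - (of_nat b :: complex)) \<longleftrightarrow> a = 0 \<and> b = 0"
  "(- of_nat a = (of_nat b :: complex)) \<longleftrightarrow> a = 0 \<and> b = 0"
proof -
  have *: "of_nat a = - (of_nat b :: complex) \<longleftrightarrow> a = 0 \<and> b = 0" for a b
  proof -
    have "of_nat a = - (of_nat b :: complex) \<longleftrightarrow> of_nat (a + b) = (0 :: complex)"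
      by (simp add: eq_neg_iff_add_eq_0)
    then show ?thesis by (simp only: of_nat_eq_0_iff add_is_0)
  qed
  from *[of a b] show "of_nat a = - (of_nat b :: complex) \<longleftrightarrow> a = 0 \<and> b = 0" .
  have "- of_nat a = (of_nat b :: complex) \<longleftrightarrow> of_nat b = - (of_nat a :: complex)" by (rule eq_commute)
  with *[of b a] show "- of_nat a = (of_nat b :: complex) \<longleftrightarrow> a = 0 \<and> b = 0" by blast
qed

lemma filterlim_affine:
  fixes a b :: complex
  assumes "b \<noteq> 0"
  shows "filterlim (\<lambda>t. a + b * t) (at a) (at 0)"
  unfolding filterlim_at
proof (intro conjI)
  show "((\<lambda>t. a + b * t) \<longlongrightarrow> a) (at 0)" by (auto intro!: tendsto_eq_intros)
  show "eventually (\<lambda>t. a + b * t \<in> UNIV \<and> a + b * t \<noteq> a) (at 0)"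
    using assms by (auto simp: eventually_at intro!: exI[of _ 1])
qed

lemma eventually_affine_cosparse:
  fixes a b :: complex
  assumes "eventually Q (cosparse UNIV)" "b \<noteq> 0"
  shows "eventually (\<lambda>t. Q (a + b * t)) (at 0)"
  using eventually_cosparse_imp_eventually_at[OF assms(1), of a UNIV] filterlim_affine[OF assms(2)]
  by (simp add: filterlim_iff)

lemma eq_at_limit:
  fixes L R :: "complex \<Rightarrow> complex"
  assumes "isCont L 0" "isCont R 0" "eventually (\<lambda>t. L t = R t) (at 0)"
  shows "L 0 = R 0"
  using tendsto_unique[OF _ Lim_transform_eventually[of L "L 0" "at 0" R]] assms by (simp add: isCont_def)

context ruijsenaars_bracket
begin

lemma br_nonzero_cosparse: "eventually (\<lambda>u. br u \<noteq> 0) (cosparse UNIV)"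
proof -
  obtain v where "br v \<noteq> 0" using br_nontrivial by blast
  then show ?thesis
    by (simp add: eventually_cosparse_open_eq entire_generic_nonzero[OF br_holomorphic])
qed

lemma isCont_br:
  assumes "isCont f t"
  shows "isCont (\<lambda>t. br (f t)) t"
proof (rule isCont_o2[OF assms])
  have "continuous_on UNIV br" by (rule holomorphic_on_imp_continuous_on[OF br_holomorphic])
  then show "isCont br (f t)" by (simp add: continuous_on_eq_continuous_at)
qed

lemma br_omega_zero: "r \<in> {1..rho P} \<Longrightarrow> br (omega P r) = 0"
  using quasi_periodic[of r] by (metis add_0 br_zero mult_zero_right)

text \<open>Twice a zero and every period are zeros, and the zeros form a group.\<close>

lemma half_period_difference_nonzero:
  assumes "r \<in> {1..rho P}" "s \<in> {1..rho P}" "br v \<noteq> 0"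
  shows "br ((omega P r - omega P s + v) / 2) \<noteq> 0"
proof
  let ?u = "(omega P r - omega P s + v) / 2"
  assume u: "br ?u = 0"
  have neg: "br (- a) = 0" if "br a = 0" for a using that by (simp add: br_minus)
  have "br (?u - - ?u - (omega P r - omega P s)) = 0"
    by (intro br_zero_diff u neg br_omega_zero assms)
  moreover have "?u - - ?u - (omega P r - omega P s) = v" by (simp add: field_simps)
  ultimately show False using assms(3) by simp
qed

text \<open>Two poles moving with different speeds coincide modulo the periods only at isolated times.\<close>

lemma eventually_poles_distinct:
  assumes I: "finite I"
    and cases: "\<And>i j. i \<in> I \<Longrightarrow> j \<in> I \<Longrightarrow> i \<noteq> j \<Longrightarrow> \<beta> i = \<beta> j \<Longrightarrow> br (\<alpha> i - \<alpha> j) \<noteq> 0"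
  shows "eventually (\<lambda>t. poles_distinct I (\<lambda>i. \<alpha> i + t * \<beta> i)) (at 0)"
  unfolding poles_distinct_def
proof (intro eventually_ball_finite[OF I] ballI)
  fix i j assume ij: "i \<in> I" "j \<in> I"
  show "eventually (\<lambda>t. i \<noteq> j \<longrightarrow> br (\<alpha> i + t * \<beta> i - (\<alpha> j + t * \<beta> j)) \<noteq> 0) (at 0)"
  proof (cases "\<beta> i = \<beta> j")
    case True
    then show ?thesis using cases[OF ij] by (intro always_eventually) auto
  next
    case False
    have "eventually (\<lambda>t. br ((\<alpha> i - \<alpha> j) + (\<beta> i - \<beta> j) * t) \<noteq> 0) (at 0)"
      using False by (intro eventually_affine_cosparse[OF br_nonzero_cosparse]) simp
    then show ?thesis by eventually_elim (simp add: algebra_simps)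
  qed
qed

text \<open>The variables \<open>x\<^sub>1, \<dots>, x\<^sub>m, y\<^sub>1, \<dots>, y\<^sub>n\<close> move with the speeds \<open>1, \<dots>, m + n\<close>. Since these are positive
  and distinct, \<open>\<plusminus>x\<^sub>j\<close> and \<open>\<plusminus>y\<^sub>l\<close> all have different nonzero speeds, while the half
  periods stay fixed.\<close>

definition moved_x :: "(nat \<Rightarrow> complex) \<Rightarrow> complex \<Rightarrow> nat \<Rightarrow> complex" where
  "moved_x x t j = x j + t * of_nat j"

definition moved_y :: "nat \<Rightarrow> (nat \<Rightarrow> complex) \<Rightarrow> complex \<Rightarrow> nat \<Rightarrow> complex" where
  "moved_y m y t l = y l + t * of_nat (m + l)"

lemma moved_0 [simp]: "moved_x x 0 = x" "moved_y m y 0 = y"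
  by (auto simp: moved_x_def moved_y_def)

lemma isCont_moved: "isCont (\<lambda>t. moved_x x t j) 0" "isCont (\<lambda>t. moved_y m y t l) 0"
  unfolding moved_x_def moved_y_def by (intro continuous_intros)+

lemma block_poles_moved:
  "block_poles (moved_x x t) h i = block_poles x h i + t * block_poles of_nat (\<lambda>_. 0) i"
  "block_poles (moved_y m y t) h i = block_poles y h i + t * block_poles (\<lambda>l. of_nat (m + l)) (\<lambda>_. 0) i"
  by (auto simp: block_poles_def moved_x_def moved_y_def ring_distribs split: sum.split)

text \<open>Two distinct poles of equal speed are both half periods, and for these the assumptions exclude a
  coincidence. The case \<open>\<sigma> = - 1\<close> covers the reflected block.\<close>

lemma eventually_poles_distinct_moved:
  assumes \<sigma>: "\<sigma> = 1 \<or> \<sigma> = -1"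
    and same: "\<And>r s. r \<in> {1..rho P} \<Longrightarrow> s \<in> {1..rho P} \<Longrightarrow> r \<noteq> s \<Longrightarrow> br (h r - h s) \<noteq> 0"
      "\<And>r s. r \<in> {1..rho P} \<Longrightarrow> s \<in> {1..rho P} \<Longrightarrow> r \<noteq> s \<Longrightarrow> br (k r - k s) \<noteq> 0"
    and mixed: "\<And>r s. r \<in> {1..rho P} \<Longrightarrow> s \<in> {1..rho P} \<Longrightarrow> br (h r - (c + \<sigma> * k s)) \<noteq> 0"
  shows "eventually (\<lambda>t. poles_distinct (block_index m <+> block_index n)
      (case_sum (block_poles (moved_x x t) h) (\<lambda>i. c + \<sigma> * block_poles (moved_y m y t) k i))) (at 0)"
proof -
  \<comment> \<open>The poles at time \<open>t\<close> are \<open>\<alpha> + t \<beta>\<close>, with speeds \<open>\<beta>\<close>.\<close>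
  let ?q = "block_poles (\<lambda>l. of_nat (m + l)) (\<lambda>_. 0) :: nat + nat + nat \<Rightarrow> complex"
  let ?\<alpha> = "case_sum (block_poles x h) (\<lambda>i. c + \<sigma> * block_poles y k i)"
  let ?\<beta> = "case_sum (block_poles of_nat (\<lambda>_. 0)) (\<lambda>i. \<sigma> * ?q i)"
  have "eventually (\<lambda>t. poles_distinct (block_index m <+> block_index n) (\<lambda>i. ?\<alpha> i + t * ?\<beta> i)) (at 0)"
  proof (rule eventually_poles_distinct)
    fix i j
    assume ij: "i \<in> block_index m <+> block_index n" "j \<in> block_index m <+> block_index n" "i \<noteq> j" "?\<beta> i = ?\<beta> j"
    have "\<exists>r\<in>{1..rho P}. \<exists>s\<in>{1..rho P}. i = Inl (Inr (Inr r)) \<and> j = Inl (Inr (Inr s)) \<and> r \<noteq> s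
        \<or> i = Inr (Inr (Inr r)) \<and> j = Inr (Inr (Inr s)) \<and> r \<noteq> s
        \<or> i = Inl (Inr (Inr r)) \<and> j = Inr (Inr (Inr s)) \<or> i = Inr (Inr (Inr s)) \<and> j = Inl (Inr (Inr r))"
      using \<sigma>
    proof
      assume "\<sigma> = 1"
      then show ?thesis using ij by (auto simp: block_index_def block_poles_def simp del: of_nat_add)
    next
      assume "\<sigma> = -1"
      then show ?thesis using ij by (auto simp: block_index_def block_poles_def simp del: of_nat_add)
    qed
    moreover have "br (c + \<sigma> * k r - (c + \<sigma> * k s)) \<noteq> 0" if "r \<in> {1..rho P}" "s \<in> {1..rho P}" "r \<noteq> s" for r s
      using \<sigma> same(2)[OF that] br_commute[of "k s" "k r"] by auto
    moreover have "br (c + \<sigma> * k s - h r) \<noteq> 0" if "r \<in> {1..rho P}" "s \<in> {1..rho P}" for r s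
      using mixed[OF that] br_commute[of "c + \<sigma> * k s" "h r"] by simp
    ultimately show "br (?\<alpha> i - ?\<alpha> j) \<noteq> 0"
      by (elim bexE disjE conjE) (simp_all only: sum.case block_poles_simps same mixed not_False_eq_True)
  qed simp
  moreover have "case_sum (block_poles (moved_x x t) h) (\<lambda>i. c + \<sigma> * block_poles (moved_y m y t) k i) = (\<lambda>i. ?\<alpha> i + t * ?\<beta> i)" for t
    by (rule ext) (simp add: block_poles_moved ring_distribs split: sum.split)
  ultimately show ?thesis by simp
qed

lemma eventually_poles_distinct_dual_cauchy:
  assumes "br (\<kappa> - \<delta>) \<noteq> 0"
  shows "eventually (\<lambda>t. poles_distinct (block_index m <+> block_index n)
      (case_sum (block_poles (moved_x x t) (\<lambda>s. (omega P s - \<delta>) / 2)) (block_poles (moved_y m y t) (\<lambda>s. (omega P s - \<kappa>) / 2)))) (at 0)"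
proof -
  let ?h = "\<lambda>v s. (omega P s - v) / 2"
  have "?h v r - ?h v s = (omega P r - omega P s) / 2" for v r s by (simp add: field_simps)
  then have same: "br (?h v r - ?h v s) \<noteq> 0" if "r \<in> {1..rho P}" "s \<in> {1..rho P}" "r \<noteq> s" for v r s
    using half_period_nonzero[OF that] by (simp only: not_False_eq_True)
  have "?h \<delta> r - (0 + 1 * ?h \<kappa> s) = (omega P r - omega P s + (\<kappa> - \<delta>)) / 2" for r s by (simp add: field_simps)
  then have mixed: "br (?h \<delta> r - (0 + 1 * ?h \<kappa> s)) \<noteq> 0" if "r \<in> {1..rho P}" "s \<in> {1..rho P}" for r s
    using half_period_difference_nonzero[OF that assms] by (simp only: not_False_eq_True)
  show ?thesis
    using eventually_poles_distinct_moved[of 1 "?h \<delta>" "?h \<kappa>" 0 m n x y, OF _ same same mixed] by simp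
qed

lemma eventually_poles_distinct_cauchy:
  assumes "br (\<kappa> - \<delta>) \<noteq> 0"
  shows "eventually (\<lambda>t. poles_distinct (block_index m <+> block_index n)
      (case_sum (block_poles (moved_x x t) (\<lambda>s. (omega P s - \<delta>) / 2))
        (\<lambda>i. - (\<delta> + \<kappa>) / 2 - block_poles (moved_y m y t) (\<lambda>s. - (omega P s + \<delta>) / 2) i))) (at 0)"
proof -
  let ?c = "- (\<delta> + \<kappa>) / 2" and ?h = "\<lambda>s. (omega P s - \<delta>) / 2" and ?k = "\<lambda>s. - (omega P s + \<delta>) / 2"
  have "?h r - ?h s = (omega P r - omega P s) / 2" "?k r - ?k s = (omega P s - omega P r) / 2" for r s by (simp_all add: field_simps)
  then have same: "br (?h r - ?h s) \<noteq> 0" "br (?k r - ?k s) \<noteq> 0" if "r \<in> {1..rho P}" "s \<in> {1..rho P}" "r \<noteq> s" for r s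
    using half_period_nonzero[OF that] half_period_nonzero[OF that(2,1) that(3)[symmetric]] by (simp_all only: not_False_eq_True)
  have "?h r - (?c + -1 * ?k s) = (omega P r - omega P s + (\<kappa> - \<delta>)) / 2" for r s by (simp add: field_simps)
  then have mixed: "br (?h r - (?c + -1 * ?k s)) \<noteq> 0" if "r \<in> {1..rho P}" "s \<in> {1..rho P}" for r s
    using half_period_difference_nonzero[OF that assms] by (simp only: not_False_eq_True)
  have "?c - u = ?c + -1 * u" for u by simp
  then show ?thesis
    using eventually_poles_distinct_moved[of "-1" ?h ?k ?c m n x y, OF _ same mixed] by (simp only: simp_thms)
qed

lemmas isCont_coefficient = isCont_mult isCont_divide continuous_prod isCont_br continuous_add continuous_diff continuous_const

lemma isCont_A_plus:
  fixes xs :: "complex \<Rightarrow> nat \<Rightarrow> complex"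
  assumes "\<And>j. isCont (\<lambda>t. xs t j) t0" and "A_plus_regular P br N \<delta> i (xs t0)"
  shows "isCont (\<lambda>t. A_plus P br N \<mu> \<delta> \<kappa> i (xs t)) t0"
  unfolding A_plus_def
  using assms(2) unfolding A_plus_regular_def
  by (intro isCont_coefficient assms(1)) auto

lemma isCont_E_op:
  fixes xs :: "complex \<Rightarrow> nat \<Rightarrow> complex"
  assumes xs: "\<And>j. isCont (\<lambda>t. xs t j) t0"
    and reg: "coeffs_regular P br N \<delta> (xs t0)"
    and F: "isCont (\<lambda>t. F t (xs t)) t0"
      "\<And>i. i \<in> {1..N} \<Longrightarrow> isCont (\<lambda>t. F t ((xs t)(i := xs t i + \<delta>))) t0"
      "\<And>i. i \<in> {1..N} \<Longrightarrow> isCont (\<lambda>t. F t ((xs t)(i := xs t i - \<delta>))) t0"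
  shows "isCont (\<lambda>t. E_op P br N \<mu> \<delta> \<kappa> (F t) (xs t)) t0"
proof -
  have plus: "isCont (\<lambda>t. A_plus P br N \<mu> \<delta> \<kappa> i (xs t)) t0" if "i \<in> {1..N}" for i
    using reg that by (intro isCont_A_plus xs) (auto simp: coeffs_regular_def)
  have minus: "isCont (\<lambda>t. A_minus P br N \<mu> \<delta> \<kappa> i (xs t)) t0" if "i \<in> {1..N}" for i
    unfolding A_minus_def using reg that
    by (intro isCont_A_plus[where xs = "\<lambda>t j. - xs t j"] continuous_minus xs) (auto simp: coeffs_regular_def)
  have zero: "isCont (\<lambda>t. A_zero P br N \<mu> \<delta> \<kappa> r (xs t)) t0" if r: "r \<in> {1..rho P}" for r
  proof -
    have "isCont (\<lambda>t. \<Prod>j = 1..N. (br ((omega P r - \<delta>) / 2 + xs t j + \<kappa>) * br ((omega P r - \<delta>) / 2 - xs t j + \<kappa>))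
            / (br ((omega P r - \<delta>) / 2 + xs t j) * br ((omega P r - \<delta>) / 2 - xs t j))) t0"
      using reg r by (intro isCont_coefficient xs) (auto simp: coeffs_regular_def)
    then show ?thesis unfolding A_zero_def by (rule isCont_mult[OF continuous_const])
  qed
  show ?thesis
    unfolding E_op_def by (intro continuous_add continuous_sum isCont_mult plus minus zero F)
qed

section \<open>Kernel functions\<close>

definition shift_factor :: "complex \<Rightarrow> complex \<Rightarrow> complex \<Rightarrow> complex \<Rightarrow> complex" where
  "shift_factor a b w z = (br (z + w + a) * br (z - w + a)) / (br (z + w + b) * br (z - w + b))"

definition double_prod :: "(complex \<Rightarrow> complex \<Rightarrow> complex) \<Rightarrow> nat \<Rightarrow> nat \<Rightarrow> (nat \<Rightarrow> complex) \<Rightarrow> (nat \<Rightarrow> complex) \<Rightarrow> complex" where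
  "double_prod \<phi> m n x y = (\<Prod>j = 1..m. \<Prod>l = 1..n. \<phi> (x j) (y l))"

lemma double_prod_swap: "double_prod \<phi> m n x y = double_prod (\<lambda>Y X. \<phi> X Y) n m y x"
  unfolding double_prod_def by (rule prod.swap)

lemma ratio_eq_prod: "ratio n y a b z = (\<Prod>l = 1..n. shift_factor a b (y l) z)"
  unfolding ratio_def shift_factor_def ..

lemma double_prod_shift:
  assumes i: "i \<in> {1..m}" and "\<And>l. l \<in> {1..n} \<Longrightarrow> \<phi> X (y l) = shift_factor a b (y l) z * \<phi> (x i) (y l)"
  shows "double_prod \<phi> m n (x(i := X)) y = ratio n y a b z * double_prod \<phi> m n x y"
proof -
  have "double_prod \<phi> m n (x(i := X)) y = (\<Prod>l = 1..n. \<phi> X (y l)) * (\<Prod>j\<in>{1..m} - {i}. \<Prod>l = 1..n. \<phi> (x j) (y l))"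
    unfolding double_prod_def using i by (subst prod.remove[of _ i]) (auto intro!: prod.cong)
  also have "(\<Prod>l = 1..n. \<phi> X (y l)) = (\<Prod>l = 1..n. shift_factor a b (y l) z * \<phi> (x i) (y l))"
    using assms(2) by (intro prod.cong) auto
  also have "\<dots> = ratio n y a b z * (\<Prod>l = 1..n. \<phi> (x i) (y l))"
    by (simp only: prod.distrib ratio_eq_prod)
  finally show ?thesis
    unfolding double_prod_def using i by (subst prod.remove[of _ i]) (auto simp: mult.assoc)
qed

lemma E_op_double_prod:
  assumes "\<And>j l. j \<in> {1..m} \<Longrightarrow> l \<in> {1..n} \<Longrightarrow> \<phi> (x j + \<delta>) (y l) = shift_factor a b (y l) (x j) * \<phi> (x j) (y l)"
    and "\<And>j l. j \<in> {1..m} \<Longrightarrow> l \<in> {1..n} \<Longrightarrow> \<phi> (x j - \<delta>) (y l) = shift_factor a b (y l) (- x j) * \<phi> (x j) (y l)"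
  shows "E_op P br m \<mu> \<delta> \<kappa> (\<lambda>x. double_prod \<phi> m n x y) x = E_sum m \<mu> \<delta> \<kappa> (ratio n y a b) x * double_prod \<phi> m n x y"
proof (rule E_op_eq_E_sum)
  fix i assume i: "i \<in> {1..m}"
  show "double_prod \<phi> m n (x(i := x i + \<delta>)) y = ratio n y a b (x i) * double_prod \<phi> m n x y"
    by (rule double_prod_shift[OF i]) (rule assms(1)[OF i])
  show "double_prod \<phi> m n (x(i := x i - \<delta>)) y = ratio n y a b (- x i) * double_prod \<phi> m n x y"
    by (rule double_prod_shift[OF i]) (rule assms(2)[OF i])
qed

lemma E_op_double_prod_y:
  assumes "\<And>j l. j \<in> {1..m} \<Longrightarrow> l \<in> {1..n} \<Longrightarrow> \<phi> (x j) (y l + \<delta>) = shift_factor a b (x j) (y l) * \<phi> (x j) (y l)"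
    and "\<And>j l. j \<in> {1..m} \<Longrightarrow> l \<in> {1..n} \<Longrightarrow> \<phi> (x j) (y l - \<delta>) = shift_factor a b (x j) (- y l) * \<phi> (x j) (y l)"
  shows "E_op P br n \<mu> \<delta> \<kappa> (\<lambda>y. double_prod \<phi> m n x y) y = E_sum n \<mu> \<delta> \<kappa> (ratio m x a b) y * double_prod \<phi> m n x y"
proof -
  have "double_prod \<phi> m n x = (\<lambda>y. double_prod (\<lambda>Y X. \<phi> X Y) n m y x)"
    by (rule ext) (rule double_prod_swap)
  moreover have "E_op P br n \<mu> \<delta> \<kappa> (\<lambda>y. double_prod (\<lambda>Y X. \<phi> X Y) n m y x) y =
      E_sum n \<mu> \<delta> \<kappa> (ratio m x a b) y * double_prod (\<lambda>Y X. \<phi> X Y) n m y x"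
    by (rule E_op_double_prod) (rule assms; assumption)+
  ultimately show ?thesis by simp
qed

text \<open>The domain \<open>D\<close> of \<open>\<Phi>\<close> contains the given point and its shifts, so all terms are continuous along
  the line.\<close>

lemma isCont_E_op_moved:
  fixes \<Phi> :: "(nat \<Rightarrow> complex) \<Rightarrow> (nat \<Rightarrow> complex) \<Rightarrow> complex"
  assumes cont: "\<And>xs ys. (\<And>j. isCont (\<lambda>t. xs t j) 0) \<Longrightarrow> (\<And>l. isCont (\<lambda>t. ys t l) 0) \<Longrightarrow> D (xs 0) (ys 0) \<Longrightarrow>
      isCont (\<lambda>t. \<Phi> (xs t) (ys t)) (0 :: complex)"
  shows "E_defined P br m \<delta> (\<lambda>x. D x y) x \<Longrightarrow>
      isCont (\<lambda>t. E_op P br m \<mu> \<delta> \<kappa> (\<lambda>x. \<Phi> x (moved_y m' y t)) (moved_x x t)) 0"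
    and "E_defined P br n \<delta> (\<lambda>y. D x y) y \<Longrightarrow>
      isCont (\<lambda>t. E_op P br n \<mu> \<delta> \<kappa> (\<lambda>y. \<Phi> (moved_x x t) y) (moved_y m' y t)) 0"
proof -
  have upd: "isCont (\<lambda>t. ((xs t)(i := xs t i + d)) j) 0" if "\<And>j. isCont (\<lambda>t. xs t j) 0" for xs :: "complex \<Rightarrow> nat \<Rightarrow> complex" and i j d
    using that by (cases "j = i") (auto intro!: continuous_intros)
  have upd': "isCont (\<lambda>t. ((xs t)(i := xs t i - d)) j) 0" if "\<And>j. isCont (\<lambda>t. xs t j) 0" for xs :: "complex \<Rightarrow> nat \<Rightarrow> complex" and i j d
    using that by (cases "j = i") (auto intro!: continuous_intros)
  note moved = isCont_moved(1)[of x] isCont_moved(2)[of m' y]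
  {
    assume d: "E_defined P br m \<delta> (\<lambda>x. D x y) x"
    show "isCont (\<lambda>t. E_op P br m \<mu> \<delta> \<kappa> (\<lambda>x. \<Phi> x (moved_y m' y t)) (moved_x x t)) 0"
    proof (rule isCont_E_op)
      show "isCont (\<lambda>t. \<Phi> (moved_x x t) (moved_y m' y t)) 0"
        by (rule cont) (use d moved in \<open>simp_all add: E_defined_def\<close>)
      show "isCont (\<lambda>t. \<Phi> ((moved_x x t)(i := moved_x x t i + \<delta>)) (moved_y m' y t)) 0" if "i \<in> {1..m}" for i
        by (rule cont[of "\<lambda>t. (moved_x x t)(i := moved_x x t i + \<delta>)"], rule upd[OF moved(1)], rule moved(2))
          (use d that in \<open>simp add: E_defined_def\<close>)
      show "isCont (\<lambda>t. \<Phi> ((moved_x x t)(i := moved_x x t i - \<delta>)) (moved_y m' y t)) 0" if "i \<in> {1..m}" for i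
        by (rule cont[of "\<lambda>t. (moved_x x t)(i := moved_x x t i - \<delta>)"], rule upd'[OF moved(1)], rule moved(2))
          (use d that in \<open>simp add: E_defined_def\<close>)
    qed (use d moved in \<open>simp_all add: E_defined_def\<close>)
  next
    assume d: "E_defined P br n \<delta> (\<lambda>y. D x y) y"
    show "isCont (\<lambda>t. E_op P br n \<mu> \<delta> \<kappa> (\<lambda>y. \<Phi> (moved_x x t) y) (moved_y m' y t)) 0"
    proof (rule isCont_E_op)
      show "isCont (\<lambda>t. \<Phi> (moved_x x t) (moved_y m' y t)) 0"
        by (rule cont) (use d moved in \<open>simp_all add: E_defined_def\<close>)
      show "isCont (\<lambda>t. \<Phi> (moved_x x t) ((moved_y m' y t)(i := moved_y m' y t i + \<delta>))) 0" if "i \<in> {1..n}" for i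
        by (rule cont[of _ "\<lambda>t. (moved_y m' y t)(i := moved_y m' y t i + \<delta>)"], rule moved(1), rule upd[OF moved(2)])
          (use d that in \<open>simp add: E_defined_def\<close>)
      show "isCont (\<lambda>t. \<Phi> (moved_x x t) ((moved_y m' y t)(i := moved_y m' y t i - \<delta>))) 0" if "i \<in> {1..n}" for i
        by (rule cont[of _ "\<lambda>t. (moved_y m' y t)(i := moved_y m' y t i - \<delta>)"], rule moved(1), rule upd'[OF moved(2)])
          (use d that in \<open>simp add: E_defined_def\<close>)
    qed (use d moved in \<open>simp_all add: E_defined_def\<close>)
  }
qed

text \<open>The property of a kernel function of two variables on which the identity rests; \<open>a\<close> and \<open>b\<close> stand for
  \<open>(\<delta> - \<kappa>) / 2\<close> and \<open>(\<delta> + \<kappa>) / 2\<close>. Then \<open>d = a + b\<close>, so that a shift by \<open>d\<close> followed by a shift by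
  \<open>- d\<close> has the factor 1.\<close>

definition cauchy_shifts :: "complex \<Rightarrow> complex \<Rightarrow> complex \<Rightarrow> (complex \<Rightarrow> complex \<Rightarrow> complex) \<Rightarrow> complex \<Rightarrow> complex \<Rightarrow> bool" where
  "cauchy_shifts d a b \<phi> X Y \<longleftrightarrow>
     \<phi> (X + d) Y = shift_factor a b Y X * \<phi> X Y \<and> \<phi> (X - d) Y = shift_factor a b Y (- X) * \<phi> X Y
     \<and> \<phi> X (Y + d) = shift_factor a b X Y * \<phi> X Y \<and> \<phi> X (Y - d) = shift_factor a b X (- Y) * \<phi> X Y"

text \<open>Near the given point, but off it, both sides are the kernel function times the two members of
  \<open>cauchy_generic\<close>; at the point itself they agree by continuity.\<close>

theorem cauchy_identity:
  fixes \<mu> \<nu> :: "nat \<Rightarrow> complex"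
  assumes \<kappa>: "br \<kappa> \<noteq> 0" "br (\<kappa> - \<delta>) \<noteq> 0"
    and balance: "2 * (of_nat m - of_nat n) * \<kappa> + c_const P \<mu> \<delta> \<kappa> = 0"
    and \<nu>: "\<And>s. s \<in> {1..2 * rho P} \<Longrightarrow> \<nu> s = (\<delta> + \<kappa>) / 2 - \<mu> s"
    and cont: "\<And>xs ys. (\<And>j. isCont (\<lambda>t. xs t j) 0) \<Longrightarrow> (\<And>l. isCont (\<lambda>t. ys t l) 0) \<Longrightarrow> D (xs 0) (ys 0) \<Longrightarrow>
      isCont (\<lambda>t. double_prod \<phi> m n (xs t) (ys t)) (0 :: complex)"
    and defined: "E_defined P br m \<delta> (\<lambda>x. D x y) x" "E_defined P br n \<delta> (\<lambda>y. D x y) y"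
    and shifts: "\<And>j l. j \<in> {1..m} \<Longrightarrow> l \<in> {1..n} \<Longrightarrow>
      eventually (\<lambda>t. cauchy_shifts \<delta> ((\<delta> - \<kappa>) / 2) ((\<delta> + \<kappa>) / 2) \<phi> (moved_x x t j) (moved_y m y t l)) (at 0)"
  shows "E_op P br m \<mu> \<delta> \<kappa> (\<lambda>x. double_prod \<phi> m n x y) x = E_op P br n \<nu> \<delta> \<kappa> (\<lambda>y. double_prod \<phi> m n x y) y"
proof -
  let ?L = "\<lambda>t. E_op P br m \<mu> \<delta> \<kappa> (\<lambda>x. double_prod \<phi> m n x (moved_y m y t)) (moved_x x t)"
  let ?R = "\<lambda>t. E_op P br n \<nu> \<delta> \<kappa> (\<lambda>y. double_prod \<phi> m n (moved_x x t) y) (moved_y m y t)"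
  have "eventually (\<lambda>t. \<forall>j\<in>{1..m}. \<forall>l\<in>{1..n}. cauchy_shifts \<delta> ((\<delta> - \<kappa>) / 2) ((\<delta> + \<kappa>) / 2) \<phi> (moved_x x t j) (moved_y m y t l)) (at 0)"
    by (intro eventually_ball_finite ballI shifts) auto
  then have "eventually (\<lambda>t. ?L t = ?R t) (at 0)"
    using eventually_poles_distinct_cauchy[OF \<kappa>(2), of m n x y]
  proof eventually_elim
    case (elim t)
    let ?x = "moved_x x t" and ?y = "moved_y m y t"
    have "?L t = E_sum m \<mu> \<delta> \<kappa> (ratio n ?y ((\<delta> - \<kappa>) / 2) ((\<delta> + \<kappa>) / 2)) ?x * double_prod \<phi> m n ?x ?y"
      using elim(1) by (intro E_op_double_prod) (simp_all add: cauchy_shifts_def)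
    moreover have "?R t = E_sum n \<nu> \<delta> \<kappa> (ratio m ?x ((\<delta> - \<kappa>) / 2) ((\<delta> + \<kappa>) / 2)) ?y * double_prod \<phi> m n ?x ?y"
      using elim(1) by (intro E_op_double_prod_y) (simp_all add: cauchy_shifts_def)
    ultimately show ?case using cauchy_generic[OF \<kappa>(1) balance \<nu> elim(2)] by simp
  qed
  moreover have "isCont ?L 0" "isCont ?R 0"
    using isCont_E_op_moved[of D "double_prod \<phi> m n", OF cont] defined by blast+
  ultimately have "?L 0 = ?R 0" by (rule eq_at_limit[rotated 2])
  then show ?thesis by simp
qed

end

context ruijsenaars_bracket
begin

lemma eventually_moved:
  assumes Q: "eventually Q (cosparse UNIV)"
    and jl: "j \<in> {1..m}" "l \<in> {1..n}"
    and \<epsilon>: "\<epsilon>1 = 1 \<or> \<epsilon>1 = -1" "\<epsilon>2 = 1 \<or> \<epsilon>2 = -1"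
  shows "eventually (\<lambda>t. Q (\<epsilon>1 * moved_x x t j + \<epsilon>2 * moved_y m y t l + v)) (at 0)"
proof -
  have "of_nat j \<noteq> (of_nat (m + l) :: complex)" "of_nat j + of_nat (m + l) \<noteq> (0 :: complex)"
    using jl by (simp_all only: of_nat_eq_iff of_nat_add[symmetric] of_nat_eq_0_iff) auto
  moreover have "\<epsilon>1 * a + \<epsilon>2 * b \<noteq> 0" if "a \<noteq> b" "a + b \<noteq> 0" for a b
  proof -
    have "\<epsilon>1 * a + \<epsilon>2 * b = \<epsilon>1 * (a + b) \<or> \<epsilon>1 * a + \<epsilon>2 * b = \<epsilon>1 * (a - b)" "\<epsilon>1 \<noteq> 0"
      using \<epsilon> by auto
    then show ?thesis using that by auto
  qed
  ultimately have "\<epsilon>1 * of_nat j + \<epsilon>2 * of_nat (m + l) \<noteq> 0" by blast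
  from eventually_affine_cosparse[OF Q this, of "\<epsilon>1 * x j + \<epsilon>2 * y l + v"]
  show ?thesis by eventually_elim (simp add: moved_x_def moved_y_def algebra_simps)
qed

lemma dual_cauchy_shifts:
  assumes "br (X + Y) \<noteq> 0" "br (X - Y) \<noteq> 0"
  defines "\<phi> \<equiv> \<lambda>X Y. br (X + Y) * br (X - Y)"
  shows "\<phi> (X + d) Y = shift_factor d 0 Y X * \<phi> X Y" "\<phi> (X - d) Y = shift_factor d 0 Y (- X) * \<phi> X Y"
    "\<phi> X (Y + d) = shift_factor d 0 X Y * \<phi> X Y" "\<phi> X (Y - d) = shift_factor d 0 X (- Y) * \<phi> X Y"
proof -
  have neg: "- X + Y = - (X - Y)" "- X - Y = - (X + Y)" "Y + X = X + Y" "Y - X = - (X - Y)" "- Y + X = X - Y" "- Y - X = - (X + Y)"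
    "- (X - Y) + d = - (X - Y - d)" "- (X + Y) + d = - (X + Y - d)"
    by simp_all
  have arg: "X + d + Y = X + Y + d" "X + d - Y = X - Y + d" "X - d + Y = X + Y - d" "X - d - Y = X - Y - d"
    "X + (Y + d) = X + Y + d" "X - (Y + d) = X - Y - d" "X + (Y - d) = X + Y - d" "X - (Y - d) = X - Y + d"
    by simp_all
  show "\<phi> (X + d) Y = shift_factor d 0 Y X * \<phi> X Y" "\<phi> (X - d) Y = shift_factor d 0 Y (- X) * \<phi> X Y"
    "\<phi> X (Y + d) = shift_factor d 0 X Y * \<phi> X Y" "\<phi> X (Y - d) = shift_factor d 0 X (- Y) * \<phi> X Y"
    unfolding \<phi>_def shift_factor_def neg arg br_minus add_0_right using assms(1,2) by simp_all
qed

theorem dual_cauchy_identity: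
  assumes \<delta>: "br \<delta> \<noteq> 0" and \<kappa>: "br \<kappa> \<noteq> 0" "br (\<kappa> - \<delta>) \<noteq> 0"
    and balance: "2 * of_nat m * \<kappa> + 2 * of_nat n * \<delta> + c_const P \<mu> \<delta> \<kappa> = 0"
    and defined: "E_defined P br m \<delta> (\<lambda>_. True) x" "E_defined P br n \<kappa> (\<lambda>_. True) y"
  shows "br \<kappa> * E_op P br m \<mu> \<delta> \<kappa> (\<lambda>x. Psi br m n x y) x + br \<delta> * E_op P br n \<mu> \<kappa> \<delta> (\<lambda>y. Psi br m n x y) y = 0"
proof -
  let ?\<phi> = "\<lambda>X Y. br (X + Y) * br (X - Y)"
  let ?L = "\<lambda>t. E_op P br m \<mu> \<delta> \<kappa> (\<lambda>x. double_prod ?\<phi> m n x (moved_y m y t)) (moved_x x t)"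
  let ?R = "\<lambda>t. E_op P br n \<mu> \<kappa> \<delta> (\<lambda>y. double_prod ?\<phi> m n (moved_x x t) y) (moved_y m y t)"
  have Psi: "Psi br m n = double_prod ?\<phi> m n" by (intro ext) (simp add: Psi_def double_prod_def)
  have "eventually (\<lambda>t. br (moved_x x t j + moved_y m y t l) \<noteq> 0 \<and> br (moved_x x t j - moved_y m y t l) \<noteq> 0) (at 0)"
    if "j \<in> {1..m}" "l \<in> {1..n}" for j l
    using eventually_moved[OF br_nonzero_cosparse that, of 1 1 x y 0] eventually_moved[OF br_nonzero_cosparse that, of 1 "-1" x y 0]
    by simp (rule eventually_conj)
  then have "eventually (\<lambda>t. \<forall>j\<in>{1..m}. \<forall>l\<in>{1..n}. br (moved_x x t j + moved_y m y t l) \<noteq> 0 \<and> br (moved_x x t j - moved_y m y t l) \<noteq> 0) (at 0)"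
    by (intro eventually_ball_finite ballI) auto
  then have "eventually (\<lambda>t. br \<kappa> * ?L t + br \<delta> * ?R t = 0) (at 0)"
    using eventually_poles_distinct_dual_cauchy[OF \<kappa>(2), of m n x y]
  proof eventually_elim
    case (elim t)
    let ?x = "moved_x x t" and ?y = "moved_y m y t"
    have "?L t = E_sum m \<mu> \<delta> \<kappa> (ratio n ?y \<delta> 0) ?x * double_prod ?\<phi> m n ?x ?y"
      using elim(1) by (intro E_op_double_prod dual_cauchy_shifts) simp_all
    moreover have "?R t = E_sum n \<mu> \<kappa> \<delta> (ratio m ?x \<kappa> 0) ?y * double_prod ?\<phi> m n ?x ?y"
      using elim(1) by (intro E_op_double_prod_y dual_cauchy_shifts) simp_all
    ultimately have "br \<kappa> * ?L t + br \<delta> * ?R t =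
        (br \<kappa> * E_sum m \<mu> \<delta> \<kappa> (ratio n ?y \<delta> 0) ?x + br \<delta> * E_sum n \<mu> \<kappa> \<delta> (ratio m ?x \<kappa> 0) ?y) * double_prod ?\<phi> m n ?x ?y"
      by (simp only: distrib_right mult.assoc)
    then show ?case using dual_cauchy_generic[OF \<delta> \<kappa>(1) balance elim(2)] by simp
  qed
  moreover have cont: "isCont (\<lambda>t. double_prod ?\<phi> m n (xs t) (ys t)) 0"
    if "\<And>j. isCont (\<lambda>t. xs t j) 0" "\<And>l. isCont (\<lambda>t. ys t l) 0" for xs ys :: "complex \<Rightarrow> nat \<Rightarrow> complex"
    unfolding double_prod_def using that by (intro isCont_coefficient)
  have "isCont ?L 0" "isCont ?R 0"
    using isCont_E_op_moved[of "\<lambda>_ _. True" "double_prod ?\<phi> m n", OF cont] defined by blast+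
  then have "isCont (\<lambda>t. br \<kappa> * ?L t + br \<delta> * ?R t) 0" by (intro isCont_coefficient)
  ultimately have "br \<kappa> * ?L 0 + br \<delta> * ?R 0 = 0"
    using eq_at_limit[of "\<lambda>t. br \<kappa> * ?L t + br \<delta> * ?R t" "\<lambda>_. 0"] by simp
  then show ?thesis by (simp add: Psi)
qed

text \<open>The functional equation together with the conditions under which it can be used in both directions.
  It holds off a sparse set, hence at almost all times along the moving arguments.\<close>

definition gamma_regular :: "(complex \<Rightarrow> complex) \<Rightarrow> complex \<Rightarrow> complex \<Rightarrow> complex \<Rightarrow> bool" where
  "gamma_regular G \<delta> c u \<longleftrightarrow> G (u + \<delta>) = c * br u * G u \<and> G u \<noteq> 0 \<and> br u \<noteq> 0"

lemma gamma_regular_cosparse: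
  assumes "G meromorphic_on UNIV" "\<not> (\<forall>\<^sub>\<approx>u\<in>UNIV. G u = 0)" "\<forall>\<^sub>\<approx>u\<in>UNIV. G (u + \<delta>) = c * br u * G u"
  shows "eventually (gamma_regular G \<delta> c) (cosparse UNIV)"
proof -
  have "\<forall>\<^sub>\<approx>u\<in>UNIV. G u \<noteq> 0"
    using meromorphic_imp_constant_or_avoid[OF assms(1), of 0] assms(2) by (simp add: connected_UNIV)
  with assms(3) br_nonzero_cosparse show ?thesis
    unfolding gamma_regular_def by eventually_elim simp
qed

text \<open>Write \<open>u = X \<plusminus> Y\<close>. A shift by \<open>\<plusminus>(a + b)\<close> moves the arguments \<open>u + a\<close> and \<open>u + b\<close> either up by
  \<open>a + b\<close> or down to \<open>u - b\<close> and \<open>u - a\<close>, so eight instances of the functional equation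
  occur.\<close>

lemma cauchy_shifts_quot:
  assumes c: "c \<noteq> 0"
    and good: "\<And>\<epsilon> v. \<epsilon> \<in> {1, -1} \<Longrightarrow> v \<in> {a, b, - a, - b} \<Longrightarrow> gamma_regular G (a + b) c (1 * X + \<epsilon> * Y + v)"
  shows "cauchy_shifts (a + b) a b (\<lambda>X Y. (G (X + Y + a) * G (X - Y + a)) / (G (X + Y + b) * G (X - Y + b))) X Y"
proof -
  have s: "u - b + (a + b) = u + a" "u - a + (a + b) = u + b" for u by simp_all
  have g: "gamma_regular G (a + b) c (X + Y + v)" "gamma_regular G (a + b) c (X - Y + v)" if "v \<in> {a, b, - a, - b}" for v
    using good[of 1 v] good[of "-1" v] that by simp_all
  have "gamma_regular G (a + b) c (X + Y + a)" "gamma_regular G (a + b) c (X - Y + a)"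
    "gamma_regular G (a + b) c (X + Y + b)" "gamma_regular G (a + b) c (X - Y + b)"
    "gamma_regular G (a + b) c (X + Y - a)" "gamma_regular G (a + b) c (X - Y - a)"
    "gamma_regular G (a + b) c (X + Y - b)" "gamma_regular G (a + b) c (X - Y - b)"
    using g[of a] g[of b] g[of "- a"] g[of "- b"] by simp_all
  note gs = this[unfolded gamma_regular_def s]
  have 1: "G (X + Y + a + (a + b)) = c * br (X + Y + a) * G (X + Y + a)" "G (X - Y + a + (a + b)) = c * br (X - Y + a) * G (X - Y + a)"
    "G (X + Y + b + (a + b)) = c * br (X + Y + b) * G (X + Y + b)" "G (X - Y + b + (a + b)) = c * br (X - Y + b) * G (X - Y + b)"
    "G (X + Y + a) = c * br (X + Y - b) * G (X + Y - b)" "G (X - Y + a) = c * br (X - Y - b) * G (X - Y - b)"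
    "G (X + Y + b) = c * br (X + Y - a) * G (X + Y - a)" "G (X - Y + b) = c * br (X - Y - a) * G (X - Y - a)"
    using gs by blast+
  have 2: "br (X + Y + a) \<noteq> 0" "br (X - Y + a) \<noteq> 0" "br (X + Y + b) \<noteq> 0" "br (X - Y + b) \<noteq> 0"
    "br (X + Y - a) \<noteq> 0" "br (X - Y - a) \<noteq> 0" "br (X + Y - b) \<noteq> 0" "br (X - Y - b) \<noteq> 0"
    "G (X + Y - a) \<noteq> 0" "G (X - Y - a) \<noteq> 0" "G (X + Y - b) \<noteq> 0" "G (X - Y - b) \<noteq> 0"
    using gs by blast+
  have arg: "X + (a + b) + Y + a = X + Y + a + (a + b)" "X + (a + b) - Y + a = X - Y + a + (a + b)"
    "X + (a + b) + Y + b = X + Y + b + (a + b)" "X + (a + b) - Y + b = X - Y + b + (a + b)"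
    "X - (a + b) + Y + a = X + Y - b" "X - (a + b) - Y + a = X - Y - b" "X - (a + b) + Y + b = X + Y - a" "X - (a + b) - Y + b = X - Y - a"
    "X + (Y + (a + b)) + a = X + Y + a + (a + b)" "X - (Y + (a + b)) + a = X - Y - b"
    "X + (Y + (a + b)) + b = X + Y + b + (a + b)" "X - (Y + (a + b)) + b = X - Y - a"
    "X + (Y - (a + b)) + a = X + Y - b" "X - (Y - (a + b)) + a = X - Y + a + (a + b)"
    "X + (Y - (a + b)) + b = X + Y - a" "X - (Y - (a + b)) + b = X - Y + b + (a + b)"
    by simp_all
  have neg: "br (- X + Y + v) = - br (X - Y - v)" "br (- X - Y + v) = - br (X + Y - v)"
    "br (Y + X + v) = br (X + Y + v)" "br (Y - X + v) = - br (X - Y - v)"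
    "br (- Y + X + v) = br (X - Y + v)" "br (- Y - X + v) = - br (X + Y - v)" for v
    using br_minus[of "X - Y - v"] br_minus[of "X + Y - v"] by (simp_all add: algebra_simps)
  show ?thesis
    unfolding cauchy_shifts_def shift_factor_def neg arg 1(1-4) unfolding 1(5-8) using 2 c by (simp add: mult_ac)
qed

text \<open>The product is even in \<open>X\<close> and symmetric in \<open>X\<close> and \<open>Y\<close>, so all four shifts reduce to the shift of
  \<open>X\<close> by \<open>\<delta>\<close>.\<close>

lemma cauchy_shifts_prod:
  assumes c: "c \<noteq> 0"
    and good: "\<And>\<epsilon>1 \<epsilon>2 v. \<epsilon>1 \<in> {1, -1} \<Longrightarrow> \<epsilon>2 \<in> {1, -1} \<Longrightarrow> v \<in> {a, - b} \<Longrightarrow>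
      gamma_regular G (a + b) c (\<epsilon>1 * X + \<epsilon>2 * Y + v)"
  shows "cauchy_shifts (a + b) a b (\<lambda>X Y. \<Prod>\<epsilon>1\<in>{1, -1}. \<Prod>\<epsilon>2\<in>{1, -1}. G (\<epsilon>1 * X + \<epsilon>2 * Y + a)) X Y"
proof -
  define \<phi> where "\<phi> X Y = G (X + Y + a) * G (X - Y + a) * G (- X + Y + a) * G (- X - Y + a)" for X Y
  have \<phi>: "(\<Prod>\<epsilon>1\<in>{1, -1}. \<Prod>\<epsilon>2\<in>{1, -1}. G (\<epsilon>1 * X + \<epsilon>2 * Y + a)) = \<phi> X Y" for X Y
    by (simp add: \<phi>_def mult.assoc)
  have s: "u - b + (a + b) = u + a" for u by simp
  have even: "\<phi> (- X) Y = \<phi> X Y" and sym: "\<phi> X Y = \<phi> Y X" for X Y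
    by (simp_all add: \<phi>_def add.commute minus_diff_commute mult_ac)
  define R where "R X Y \<longleftrightarrow> (\<forall>\<epsilon>1\<in>{1, -1}. \<forall>\<epsilon>2\<in>{1, -1}. \<forall>v\<in>{a, - b}. gamma_regular G (a + b) c (\<epsilon>1 * X + \<epsilon>2 * Y + v))" for X Y
  have step: "\<phi> (X + (a + b)) Y = shift_factor a b Y X * \<phi> X Y" if R: "R X Y" for X Y
  proof -
    have g: "gamma_regular G (a + b) c (\<epsilon>1 * X + \<epsilon>2 * Y + v)" if "\<epsilon>1 \<in> {1, -1}" "\<epsilon>2 \<in> {1, -1}" "v \<in> {a, - b}" for \<epsilon>1 \<epsilon>2 v
      using R that unfolding R_def by blast
    have "gamma_regular G (a + b) c (X + Y + a)" "gamma_regular G (a + b) c (X - Y + a)"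
      "gamma_regular G (a + b) c (- X + Y - b)" "gamma_regular G (a + b) c (- X - Y - b)"
      using g[of 1 1 a] g[of 1 "-1" a] g[of "-1" 1 "- b"] g[of "-1" "-1" "- b"] by simp_all
    note gs = this[unfolded gamma_regular_def s]
    have 1: "G (X + Y + a + (a + b)) = c * br (X + Y + a) * G (X + Y + a)" "G (X - Y + a + (a + b)) = c * br (X - Y + a) * G (X - Y + a)"
      "G (- X + Y + a) = c * br (- X + Y - b) * G (- X + Y - b)" "G (- X - Y + a) = c * br (- X - Y - b) * G (- X - Y - b)"
      "br (- X + Y - b) \<noteq> 0" "br (- X - Y - b) \<noteq> 0"
      using gs by blast+
    have arg: "X + (a + b) + Y + a = X + Y + a + (a + b)" "X + (a + b) - Y + a = X - Y + a + (a + b)"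
      "- (X + (a + b)) + Y + a = - X + Y - b" "- (X + (a + b)) - Y + a = - X - Y - b"
      by simp_all
    have neg: "br (X + Y + b) = - br (- X - Y - b)" "br (X - Y + b) = - br (- X + Y - b)"
      using br_minus[of "X + Y + b"] br_minus[of "X - Y + b"] by (simp_all add: algebra_simps)
    show ?thesis
      unfolding \<phi>_def arg shift_factor_def neg 1(1,2) 1(3,4) using 1(5,6) by (simp add: field_simps)
  qed
  have R: "R X Y" using good unfolding R_def by blast
  have R_cases: "R (- X) Y" "R Y X" "R (- Y) X"
    using R by (auto simp: R_def add.commute minus_diff_commute)
  have "\<phi> (X - (a + b)) Y = shift_factor a b Y (- X) * \<phi> X Y"
    using step[OF R_cases(1)] even[of X Y] even[of "X - (a + b)" Y] by (simp add: algebra_simps)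
  moreover have "\<phi> X (Y + (a + b)) = shift_factor a b X Y * \<phi> X Y"
    using step[OF R_cases(2)] sym[of X] by simp
  moreover have "\<phi> X (Y - (a + b)) = shift_factor a b X (- Y) * \<phi> X Y"
    using step[OF R_cases(3)] even[of Y X] even[of "Y - (a + b)" X] sym[of X] by (simp add: algebra_simps)
  ultimately show ?thesis
    using step[OF R] unfolding cauchy_shifts_def \<phi> by blast
qed

lemma isCont_analytic_comp:
  assumes "isCont f t" "G analytic_on {f t}"
  shows "isCont (\<lambda>t. G (f t)) t"
  by (rule isCont_o2[OF assms(1) analytic_at_imp_isCont[OF assms(2)]])

context
  fixes G :: "complex \<Rightarrow> complex" and \<delta> \<kappa> c0 :: complex and m n :: nat and \<mu> \<nu> :: "nat \<Rightarrow> complex"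
  assumes G: "G meromorphic_on UNIV" "\<not> (\<forall>\<^sub>\<approx>u\<in>UNIV. G u = 0)" "\<forall>\<^sub>\<approx>u\<in>UNIV. G (u + \<delta>) = c0 * br u * G u"
    and c0: "c0 \<noteq> 0"
    and \<kappa>: "br \<kappa> \<noteq> 0" "br (\<kappa> - \<delta>) \<noteq> 0"
    and balance: "2 * (of_nat m - of_nat n) * \<kappa> + c_const P \<mu> \<delta> \<kappa> = 0"
    and \<nu>: "\<And>s. s \<in> {1..2 * rho P} \<Longrightarrow> \<nu> s = (\<delta> + \<kappa>) / 2 - \<mu> s"
begin

lemma half_sum: "(\<delta> - \<kappa>) / 2 + (\<delta> + \<kappa>) / 2 = \<delta>"
  by (simp add: field_simps)

lemma eventually_gamma_regular:
  assumes "j \<in> {1..m}" "l \<in> {1..n}" "finite V"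
  shows "eventually (\<lambda>t. \<forall>\<epsilon>1\<in>{1, -1}. \<forall>\<epsilon>2\<in>{1, -1}. \<forall>v\<in>V.
      gamma_regular G \<delta> c0 (\<epsilon>1 * moved_x x t j + \<epsilon>2 * moved_y m y t l + v)) (at 0)"
proof (intro eventually_ball_finite ballI)
  fix \<epsilon>1 \<epsilon>2 v :: complex
  assume "\<epsilon>1 \<in> {1, -1}" "\<epsilon>2 \<in> {1, -1}"
  then show "eventually (\<lambda>t. gamma_regular G \<delta> c0 (\<epsilon>1 * moved_x x t j + \<epsilon>2 * moved_y m y t l + v)) (at 0)"
    by (intro eventually_moved[OF gamma_regular_cosparse[OF G] assms(1,2)]) simp_all
qed (use assms(3) in simp_all)

lemma cauchy_identity_quot:
  assumes "E_defined P br m \<delta> (\<lambda>x. Phi_quot_defined G \<delta> \<kappa> m n x y) x" "E_defined P br n \<delta> (\<lambda>y. Phi_quot_defined G \<delta> \<kappa> m n x y) y"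
  shows "E_op P br m \<mu> \<delta> \<kappa> (\<lambda>x. Phi_quot G \<delta> \<kappa> m n x y) x = E_op P br n \<nu> \<delta> \<kappa> (\<lambda>y. Phi_quot G \<delta> \<kappa> m n x y) y"
proof -
  let ?\<phi> = "\<lambda>X Y. (G (X + Y + (\<delta> - \<kappa>) / 2) * G (X - Y + (\<delta> - \<kappa>) / 2)) / (G (X + Y + (\<delta> + \<kappa>) / 2) * G (X - Y + (\<delta> + \<kappa>) / 2))"
  have Phi: "Phi_quot G \<delta> \<kappa> m n = double_prod ?\<phi> m n" by (intro ext) (simp add: Phi_quot_def double_prod_def)
  show ?thesis
    unfolding Phi
  proof (rule cauchy_identity[OF \<kappa> balance \<nu> _ assms])
    fix xs ys :: "complex \<Rightarrow> nat \<Rightarrow> complex"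
    assume xy: "\<And>j. isCont (\<lambda>t. xs t j) 0" "\<And>l. isCont (\<lambda>t. ys t l) 0" and D: "Phi_quot_defined G \<delta> \<kappa> m n (xs 0) (ys 0)"
    show "isCont (\<lambda>t. double_prod ?\<phi> m n (xs t) (ys t)) 0"
      unfolding double_prod_def
    proof (intro continuous_prod isCont_mult isCont_divide isCont_analytic_comp[where G = G] continuous_add continuous_diff continuous_const xy)
    qed (use D in \<open>auto simp: Phi_quot_defined_def\<close>)
  next
    fix j l assume "j \<in> {1..m}" "l \<in> {1..n}"
    from eventually_gamma_regular[OF this, of "{(\<delta> - \<kappa>) / 2, (\<delta> + \<kappa>) / 2, - ((\<delta> - \<kappa>) / 2), - ((\<delta> + \<kappa>) / 2)}" x y]
    show "eventually (\<lambda>t. cauchy_shifts \<delta> ((\<delta> - \<kappa>) / 2) ((\<delta> + \<kappa>) / 2) ?\<phi> (moved_x x t j) (moved_y m y t l)) (at 0)"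
    proof (rule eventually_mono, goal_cases)
      case (2 t)
      then show ?case
        by (intro cauchy_shifts_quot[OF c0, where a = "(\<delta> - \<kappa>) / 2" and b = "(\<delta> + \<kappa>) / 2", unfolded half_sum]) blast
    qed simp
  qed
qed

lemma cauchy_identity_prod:
  assumes "E_defined P br m \<delta> (\<lambda>x. Phi_prod_defined G \<delta> \<kappa> m n x y) x" "E_defined P br n \<delta> (\<lambda>y. Phi_prod_defined G \<delta> \<kappa> m n x y) y"
  shows "E_op P br m \<mu> \<delta> \<kappa> (\<lambda>x. Phi_prod G \<delta> \<kappa> m n x y) x = E_op P br n \<nu> \<delta> \<kappa> (\<lambda>y. Phi_prod G \<delta> \<kappa> m n x y) y"
proof -
  let ?\<phi> = "\<lambda>X Y. \<Prod>\<epsilon>1\<in>{1, -1}. \<Prod>\<epsilon>2\<in>{1, -1}. G (\<epsilon>1 * X + \<epsilon>2 * Y + (\<delta> - \<kappa>) / 2)"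
  have Phi: "Phi_prod G \<delta> \<kappa> m n = double_prod ?\<phi> m n" by (intro ext) (simp add: Phi_prod_def double_prod_def)
  show ?thesis
    unfolding Phi
  proof (rule cauchy_identity[OF \<kappa> balance \<nu> _ assms])
    fix xs ys :: "complex \<Rightarrow> nat \<Rightarrow> complex"
    assume xy: "\<And>j. isCont (\<lambda>t. xs t j) 0" "\<And>l. isCont (\<lambda>t. ys t l) 0" and D: "Phi_prod_defined G \<delta> \<kappa> m n (xs 0) (ys 0)"
    show "isCont (\<lambda>t. double_prod ?\<phi> m n (xs t) (ys t)) 0"
      unfolding double_prod_def
    proof (intro continuous_prod isCont_analytic_comp[where G = G] continuous_add isCont_mult continuous_const xy)
    qed (use D in \<open>auto simp: Phi_prod_defined_def\<close>)
  next
    fix j l assume "j \<in> {1..m}" "l \<in> {1..n}"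
    from eventually_gamma_regular[OF this, of "{(\<delta> - \<kappa>) / 2, - ((\<delta> + \<kappa>) / 2)}" x y]
    show "eventually (\<lambda>t. cauchy_shifts \<delta> ((\<delta> - \<kappa>) / 2) ((\<delta> + \<kappa>) / 2) ?\<phi> (moved_x x t j) (moved_y m y t l)) (at 0)"
    proof (rule eventually_mono, goal_cases)
      case (2 t)
      then show ?case
        by (intro cauchy_shifts_prod[OF c0, where a = "(\<delta> - \<kappa>) / 2" and b = "(\<delta> + \<kappa>) / 2", unfolded half_sum]) blast
    qed simp
  qed
qed

end

end

theorem theorem2p3:
  fixes P :: periods and br :: "complex \<Rightarrow> complex" and \<delta> \<kappa> :: complex
    and \<mu> :: "nat \<Rightarrow> complex" and m n :: nat
  assumes "valid_periods P" and "is_bracket P br"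
    and "\<delta> \<notin> Omega P" and "\<kappa> \<notin> Omega P" and "\<kappa> - \<delta> \<notin> Omega P"
  shows
    "(\<forall>(G :: complex \<Rightarrow> complex) (c0 :: complex) (\<nu> :: nat \<Rightarrow> complex).
        G meromorphic_on UNIV \<and> \<not> (\<forall>\<^sub>\<approx>u\<in>UNIV. G u = 0) \<and> c0 \<noteq> 0
        \<and> (\<forall>\<^sub>\<approx>u\<in>UNIV. G (u + \<delta>) = c0 * br u * G u)
        \<and> 2 * (of_nat m - of_nat n) * \<kappa> + c_const P \<mu> \<delta> \<kappa> = 0
        \<and> (\<forall>r\<in>{1..2 * rho P}. \<nu> r = (\<delta> + \<kappa>) / 2 - \<mu> r) \<longrightarrow>
        (\<forall>x y :: nat \<Rightarrow> complex.
           E_defined P br m \<delta> (\<lambda>x. Phi_quot_defined G \<delta> \<kappa> m n x y) x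
           \<and> E_defined P br n \<delta> (\<lambda>y. Phi_quot_defined G \<delta> \<kappa> m n x y) y \<longrightarrow>
           E_op P br m \<mu> \<delta> \<kappa> (\<lambda>x. Phi_quot G \<delta> \<kappa> m n x y) x
             = E_op P br n \<nu> \<delta> \<kappa> (\<lambda>y. Phi_quot G \<delta> \<kappa> m n x y) y)
        \<and> (\<forall>x y :: nat \<Rightarrow> complex.
           E_defined P br m \<delta> (\<lambda>x. Phi_prod_defined G \<delta> \<kappa> m n x y) x
           \<and> E_defined P br n \<delta> (\<lambda>y. Phi_prod_defined G \<delta> \<kappa> m n x y) y \<longrightarrow>
           E_op P br m \<mu> \<delta> \<kappa> (\<lambda>x. Phi_prod G \<delta> \<kappa> m n x y) x
             = E_op P br n \<nu> \<delta> \<kappa> (\<lambda>y. Phi_prod G \<delta> \<kappa> m n x y) y))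
     \<and>
     (2 * of_nat m * \<kappa> + 2 * of_nat n * \<delta> + c_const P \<mu> \<delta> \<kappa> = 0 \<longrightarrow>
        (\<forall>x y :: nat \<Rightarrow> complex.
           E_defined P br m \<delta> (\<lambda>_. True) x \<and> E_defined P br n \<kappa> (\<lambda>_. True) y \<longrightarrow>
           br \<kappa> * E_op P br m \<mu> \<delta> \<kappa> (\<lambda>x. Psi br m n x y) x
             + br \<delta> * E_op P br n \<mu> \<kappa> \<delta> (\<lambda>y. Psi br m n x y) y = 0))"
proof -
  interpret ruijsenaars_bracket P br by (rule ruijsenaars_bracketI[OF assms(1,2)])
  have nz: "br \<delta> \<noteq> 0" "br \<kappa> \<noteq> 0" "br (\<kappa> - \<delta>) \<noteq> 0"
    using assms(3-5) by (simp_all add: br_eq_0_iff)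
  show ?thesis
  proof (intro conjI allI impI; (elim conjE)?)
    fix G :: "complex \<Rightarrow> complex" and c0 :: complex and \<nu> x y :: "nat \<Rightarrow> complex"
    assume G: "G meromorphic_on UNIV" "\<not> (\<forall>\<^sub>\<approx>u\<in>UNIV. G u = 0)" "c0 \<noteq> 0" "\<forall>\<^sub>\<approx>u\<in>UNIV. G (u + \<delta>) = c0 * br u * G u"
      and balance: "2 * (of_nat m - of_nat n) * \<kappa> + c_const P \<mu> \<delta> \<kappa> = 0"
      and \<nu>: "\<forall>r\<in>{1..2 * rho P}. \<nu> r = (\<delta> + \<kappa>) / 2 - \<mu> r"
    note kernel = G(1,2,4,3) nz(2,3) balance bspec[OF \<nu>]
    show "E_op P br m \<mu> \<delta> \<kappa> (\<lambda>x. Phi_quot G \<delta> \<kappa> m n x y) x = E_op P br n \<nu> \<delta> \<kappa> (\<lambda>y. Phi_quot G \<delta> \<kappa> m n x y) y"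
      if "E_defined P br m \<delta> (\<lambda>x. Phi_quot_defined G \<delta> \<kappa> m n x y) x" "E_defined P br n \<delta> (\<lambda>y. Phi_quot_defined G \<delta> \<kappa> m n x y) y"
      by (rule cauchy_identity_quot[OF kernel that])
    show "E_op P br m \<mu> \<delta> \<kappa> (\<lambda>x. Phi_prod G \<delta> \<kappa> m n x y) x = E_op P br n \<nu> \<delta> \<kappa> (\<lambda>y. Phi_prod G \<delta> \<kappa> m n x y) y"
      if "E_defined P br m \<delta> (\<lambda>x. Phi_prod_defined G \<delta> \<kappa> m n x y) x" "E_defined P br n \<delta> (\<lambda>y. Phi_prod_defined G \<delta> \<kappa> m n x y) y"
      by (rule cauchy_identity_prod[OF kernel that])
  qed (rule dual_cauchy_identity[OF nz])
qed

end
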